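(* Let $\Psi=(\Psi_1,\Psi_2)$ be a coverage-reweighted moment stationary bivariate random measure on $\mathbb{R}^d$. For $t\ge 0$ and $a\in\mathbb{R}^d$ put $$u_t^a(x,i)=\frac{1\{(x,i)\in B(a,t)\times\{2\}\}}{p_1(x,i)},\qquad (x,i)\in\mathbb{R}^d\times\{1,2\}.$$ Suppose that the series expansion $$L(u_t^a)=1+\sum_{k=1}^\infty\frac{(-1)^k}{k!}\sum_{i_1=1}^2\int_{\mathbb{R}^d}\cdots\sum_{i_k=1}^2\int_{\mathbb{R}^d}u_t^a(x_1,i_1)\cdots u_t^a(x_k,i_k)\,d\mu^{(k)}((x_1,i_1),\dots,(x_k,i_k))$$ and the series defining the cross $J$-function $J_{12}(t)$ are absolutely convergent. Then, for almost all $a\in\mathbb{R}^d$, $$J_{12}(t)=\frac{L^{(a,1)}(u_t^a)}{L(u_t^a)}.$$ In particular, the right-hand side does not depend on the choice of origin $a$.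
   Context: $B(a,t)$ is the closed ball of radius $t\ge0$ centred at $a\in\mathbb{R}^d$. Random measures. A bivariate random measure $\Psi=(\Psi_1,\Psi_2)$ on $\mathbb{R}^d$ is a measurable map from a probability space into the locally finite Borel measures on $\mathbb{R}^d\times\{1,2\}$ (with the smallest $\sigma$-algebra making all $\Psi_i(B)$, $B$ bounded Borel, random variables); $\Psi_i(B)$ denotes the mass of $B\times\{i\}$. Its $k$-th order moment measure is $\mu^{(k)}((B_1\times\{i_1\})\times\cdots\times(B_k\times\{i_k\}))=\mathbb{E}(\Psi_{i_1}(B_1)\cdots\Psi_{i_k}(B_k))$, assumed to be locally finite. If it is absolutely continuous, i.e. equals $\int_{B_1}\cdots\int_{B_k}p_k((x_1,i_1),\dots,(x_k,i_k))\,dx_1\cdots dx_k$, then $p_k$ is called the $k$-point coverage function. Cumulant densities. Assume all $p_k$ exist and $p_1>0$. The coverage-reweighted cumulant densities are defined recursively by $\xi_1\equiv1$ and, for $k\ge2$, $$\frac{p_k((x_1,i_1),\dots,(x_k,i_k))}{p_1(x_1,i_1)\cdots p_1(x_k,i_k)}=\sum_{m=1}^k\sum_{D_1,\dots,D_m}\prod_{j=1}^m\xi_{|D_j|}(\{(x_l,i_l):l\in D_j\}),$$ the inner sum being over all partitions $\{D_1,\dots,D_m\}$ of $\{1,\dots,k\}$ into $m$ non-empty sets. $\Psi$ is coverage-reweighted moment stationary if moment measures of all orders exist and are absolutely continuous, $\inf p_1(x,i)>0$, and every $\xi_k$ is translation invariant: $\xi_k((x_1+a,i_1),\dots,(x_k+a,i_k))=\xi_k((x_1,i_1),\dots,(x_k,i_k))$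 for all $a\in\mathbb{R}^d$, all labels and almost all $x_j$. Expressions $\xi_{k+1}((0,i),(x_1,i_1),\dots,(x_k,i_k))$ denote the a.e. determined function of $(x_1,\dots,x_k)$ that equals $\xi_{k+1}((a,i),(a+x_1,i_1),\dots,(a+x_k,i_k))$ for almost all $(a,x_1,\dots,x_k)$. Cross $J$-function. For $t\ge0$, $k\ge1$, $$J_{12}^{(k)}(t)=\int_{B(0,t)}\cdots\int_{B(0,t)}\xi_{k+1}((0,1),(x_1,2),\dots,(x_k,2))\,dx_1\cdots dx_k,\qquad J_{12}(t)=1+\sum_{k=1}^\infty\frac{(-1)^k}{k!}J_{12}^{(k)}(t),$$ for all $t\ge 0$ for which the series is absolutely convergent. Laplace functional. For bounded non-negative measurable $u$ on $\mathbb{R}^d\times\{1,2\}$ with bounded support in the first coordinate, $L(u)=\mathbb{E}\exp[-\sum_{i=1}^2\int u(x,i)\,d\Psi_i(x)]$. Palm distributions. $P^{(x,i)}$, with expectation $\mathbb{E}^{(x,i)}$, is the Palm distribution, unique up to a $\mu^{(1)}$-null set of $(x,i)$ and determined by $\mathbb{E}[\sum_{i}\int g((x,i),\Psi)\,d\Psi_i(x)]=\sum_{i}\int\mathbb{E}^{(x,i)}[g((x,i),\Psi)]\,d\mu^{(1)}(x,i)$ for all non-negative measurable $g$. $L^{(a,1)}$ is the Laplace functional of $\Psi$ under $P^{(a,1)}$. *)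

theory Defs
  imports "HOL-Probability.Probability"
begin

datatype label = L1 | L2

lemma UNIV_label: "(UNIV :: label set) = {L1, L2}"
  using label.exhaust by auto

instance label :: finite
  by standard (simp add: UNIV_label)


section \<open>Bivariate random measures\<close>

text \<open>A type of class \<^class>\<open>euclidean_space\<close> plays the role of \<open>\<real>\<^sup>d\<close>. The reference measure on
  \<open>\<real>\<^sup>d \<times> {1, 2}\<close> is Lebesgue measure times counting measure; its sets are the Borel sets.\<close>

definition ref_measure :: "('a::euclidean_space \<times> label) measure" where
  "ref_measure = lborel \<Otimes>\<^sub>M count_space UNIV"

text \<open>The \<open>i\<close>-th component \<open>B \<mapsto> N (B \<times> {i})\<close>.\<close>

definition component :: "('a::euclidean_space \<times> label) measure \<Rightarrow> label \<Rightarrow> 'a measure" where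
  "component N i = distr (restrict_space N (UNIV \<times> {i})) borel fst"

definition locally_finite_measure :: "('a::euclidean_space \<times> label) measure \<Rightarrow> bool" where
  "locally_finite_measure N \<longleftrightarrow> sets N = sets ref_measure \<and>
     (\<forall>i. \<forall>B\<in>sets borel. bounded B \<longrightarrow> emeasure (component N i) B < \<infinity>)"

definition lf_measures :: "('a::euclidean_space \<times> label) measure measure" where
  "lf_measures =
     (SUP (i, B) \<in> {(i, B). B \<in> sets borel \<and> bounded B}.
        vimage_algebra {N. locally_finite_measure N} (\<lambda>N. emeasure (component N i) B) borel)"

lemma space_lf_measures: "space lf_measures = {N. locally_finite_measure N}"
  unfolding lf_measures_def by (subst space_Sup_eq_UN) (auto intro: exI[of _ "{}"])

lemma measurable_emeasure_component:
  assumes "B \<in> sets borel" "bounded B"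
  shows "(\<lambda>N. emeasure (component N i) B) \<in> borel_measurable lf_measures"
  unfolding lf_measures_def
  by (rule measurable_Sup1[where m = "vimage_algebra {N. locally_finite_measure N}
        (\<lambda>N. emeasure (component N i) B) borel"])
    (use assms in \<open>auto intro!: measurable_vimage_algebra1\<close>)

definition random_measure ::
    "'w measure \<Rightarrow> ('w \<Rightarrow> ('a::euclidean_space \<times> label) measure) \<Rightarrow> bool" where
  "random_measure M \<Psi> \<longleftrightarrow> prob_space M \<and> \<Psi> \<in> measurable M lf_measures"

lemma sets_ref_measure: "sets (ref_measure :: ('a::euclidean_space \<times> label) measure) =
    sets (borel \<Otimes>\<^sub>M count_space UNIV)"
  unfolding ref_measure_def by (intro sets_pair_measure_cong) simp_all

lemma emeasure_component:
  fixes N :: "('a::euclidean_space \<times> label) measure"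
  assumes N: "sets N = sets ref_measure" and B: "B \<in> sets borel"
  shows "emeasure (component N i) B = emeasure N (B \<times> {i})"
proof -
  have sN: "sets N = sets (borel \<Otimes>\<^sub>M count_space UNIV)"
    using N sets_ref_measure by simp
  have spN: "space N = UNIV"
    using sets_eq_imp_space_eq[OF sN] by (simp add: space_pair_measure)
  have S: "UNIV \<times> {i} \<inter> space N \<in> sets N"
    unfolding sN spN by (auto intro!: pair_measureI)
  have f: "fst \<in> measurable (restrict_space N (UNIV \<times> {i})) borel"
    by (intro measurable_restrict_space1) (simp add: measurable_cong_sets[OF sN refl])
  have "emeasure (component N i) B =
      emeasure (restrict_space N (UNIV \<times> {i})) (fst -` B \<inter> (UNIV \<times> {i}))"
    unfolding component_def using B f by (simp add: emeasure_distr space_restrict_space spN)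
  also have "fst -` B \<inter> (UNIV \<times> {i}) = B \<times> {i}"
    by auto
  also have "emeasure (restrict_space N (UNIV \<times> {i})) (B \<times> {i}) = emeasure N (B \<times> {i})"
    using S by (intro emeasure_restrict_space) auto
  finally show ?thesis .
qed


section \<open>Moment measures and coverage functions\<close>

text \<open>A \<open>k\<close>-tuple \<open>((x\<^sub>1, i\<^sub>1), \<dots>, (x\<^sub>k, i\<^sub>k))\<close> is an element \<open>z\<close> of the product space over the index
  set \<open>{..<k}\<close>, so \<open>z j\<close> is \<open>(x\<^sub>j\<^sub>+\<^sub>1, i\<^sub>j\<^sub>+\<^sub>1)\<close>, and \<open>z\<close> is undefined outside \<open>{..<k}\<close>.\<close>

definition moment_measure ::
    "'w measure \<Rightarrow> ('w \<Rightarrow> ('a::euclidean_space \<times> label) measure) \<Rightarrow> nat \<Rightarrow>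
     (nat \<Rightarrow> 'a \<times> label) measure \<Rightarrow> bool" where
  "moment_measure M \<Psi> k \<mu> \<longleftrightarrow>
     sets \<mu> = sets (PiM {..<k} (\<lambda>_. ref_measure)) \<and>
     (\<forall>B i. (\<forall>j<k. B j \<in> sets borel) \<longrightarrow>
        emeasure \<mu> (\<Pi>\<^sub>E j\<in>{..<k}. B j \<times> {i j}) =
          (\<integral>\<^sup>+\<omega>. (\<Prod>j<k. emeasure (component (\<Psi> \<omega>) (i j)) (B j)) \<partial>M)) \<and>
     (\<forall>B i. (\<forall>j<k. B j \<in> sets borel \<and> bounded (B j)) \<longrightarrow>
        emeasure \<mu> (\<Pi>\<^sub>E j\<in>{..<k}. B j \<times> {i j}) < \<infinity>)"

definition coverage_function ::
    "nat \<Rightarrow> (nat \<Rightarrow> 'a::euclidean_space \<times> label) measure \<Rightarrow>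
     ((nat \<Rightarrow> 'a \<times> label) \<Rightarrow> real) \<Rightarrow> bool" where
  "coverage_function k \<mu> f \<longleftrightarrow>
     f \<in> borel_measurable (PiM {..<k} (\<lambda>_. ref_measure)) \<and>
     (\<forall>z\<in>space (PiM {..<k} (\<lambda>_. ref_measure)). 0 \<le> f z) \<and>
     \<mu> = density (PiM {..<k} (\<lambda>_. ref_measure)) (\<lambda>z. ennreal (f z))"


section \<open>Coverage-reweighted cumulant densities\<close>

text \<open>Throughout, \<open>p\<close> is the family of coverage functions, \<open>p k\<close> being the \<open>k\<close>-point one.\<close>

definition coverage1 :: "(nat \<Rightarrow> (nat \<Rightarrow> 'a \<times> label) \<Rightarrow> real) \<Rightarrow> 'a \<times> label \<Rightarrow> real" where
  "coverage1 p z = p 1 (\<lambda>_\<in>{..<1}. z)"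

text \<open>The components of \<open>z\<close> with index in \<open>D\<close>, in increasing order of the index. The order is
  immaterial almost everywhere, since moment measures are symmetric.\<close>

definition subtuple :: "(nat \<Rightarrow> 'b) \<Rightarrow> nat set \<Rightarrow> nat \<Rightarrow> 'b" where
  "subtuple z D = (\<lambda>j\<in>{..<card D}. z (sorted_list_of_set D ! j))"

lemma partition_on_card_less:
  assumes "partition_on {..<k::nat} P" "P \<noteq> {{..<k}}" "D \<in> P"
  shows "card D < k"
proof -
  have sub: "D \<subseteq> {..<k}"
    using assms by (auto simp: partition_on_def)
  have "D \<noteq> {..<k}"
  proof
    assume D: "D = {..<k}"
    have "E = D" if "E \<in> P" for E
    proof (rule ccontr)
      assume "E \<noteq> D"
      then have "E \<inter> D = {}" "E \<noteq> {}" "E \<subseteq> {..<k}"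
        using assms that by (auto simp: partition_on_def disjoint_def)
      then show False using D by auto
    qed
    with assms D show False by auto
  qed
  with sub have "D \<subset> {..<k}" by blast
  then show ?thesis
    using psubset_card_mono[of "{..<k}" D] by simp
qed

text \<open>The recursion, solved for the term of the one-block partition; the displayed form is
  \<open>cumulant_partition_sum\<close> below.\<close>

function cumulant ::
    "(nat \<Rightarrow> (nat \<Rightarrow> 'a \<times> label) \<Rightarrow> real) \<Rightarrow> nat \<Rightarrow> (nat \<Rightarrow> 'a \<times> label) \<Rightarrow> real" where
  "cumulant p k z =
     (if k \<le> 1 then 1
      else p k z / (\<Prod>j<k. coverage1 p (z j)) -
        (\<Sum>P\<in>{P. partition_on {..<k} P \<and> P \<noteq> {{..<k}}}.
           \<Prod>D\<in>P. cumulant p (card D) (subtuple z D)))"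
  by auto
termination
  by (relation "Wellfounded.measure (\<lambda>(p, k, z). k)") (auto intro: partition_on_card_less)

declare cumulant.simps [simp del]

lemma cumulant_1: "cumulant p 1 z = 1"
  by (simp add: cumulant.simps)

lemma subtuple_lessThan:
  assumes "z \<in> extensional {..<k}"
  shows "subtuple z {..<k} = z"
  using assms
  by (auto simp: subtuple_def fun_eq_iff restrict_def extensional_def
      sorted_list_of_set_range simp flip: atLeast0LessThan)

lemma cumulant_partition_sum:
  assumes "k \<ge> 2" "z \<in> extensional {..<k}"
  shows "p k z / (\<Prod>j<k. coverage1 p (z j)) =
    (\<Sum>P\<in>{P. partition_on {..<k} P}. \<Prod>D\<in>P. cumulant p (card D) (subtuple z D))"
proof -
  let ?f = "\<lambda>P. \<Prod>D\<in>P. cumulant p (card D) (subtuple z D)"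
  have fin: "finite {P. partition_on {..<k} P}"
    by (rule finitely_many_partition_on) simp
  have top: "{{..<k}} \<in> {P. partition_on {..<k} P}"
    using assms(1) by (auto simp: lessThan_empty_iff intro!: partition_on_space)
  have "sum ?f {P. partition_on {..<k} P} =
      ?f {{..<k}} + sum ?f ({P. partition_on {..<k} P} - {{{..<k}}})"
    by (rule sum.remove[OF fin top])
  also have "{P. partition_on {..<k} P} - {{{..<k}}} =
      {P. partition_on {..<k} P \<and> P \<noteq> {{..<k}}}"
    by auto
  also have "?f {{..<k}} = cumulant p k z"
    by (simp add: subtuple_lessThan[OF assms(2)])
  finally show ?thesis
    using assms(1) by (simp add: cumulant.simps[of p k z])
qed

definition coverage_reweighted_moment_stationary ::
    "'w measure \<Rightarrow> ('w \<Rightarrow> ('a::euclidean_space \<times> label) measure) \<Rightarrow>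
     (nat \<Rightarrow> (nat \<Rightarrow> 'a \<times> label) measure) \<Rightarrow>
     (nat \<Rightarrow> (nat \<Rightarrow> 'a \<times> label) \<Rightarrow> real) \<Rightarrow> bool" where
  "coverage_reweighted_moment_stationary M \<Psi> \<mu> p \<longleftrightarrow>
     (\<forall>k\<ge>1. moment_measure M \<Psi> k (\<mu> k) \<and> coverage_function k (\<mu> k) (p k)) \<and>
     (INF z. coverage1 p z) > 0 \<and>
     (\<forall>k\<ge>1. \<forall>a. \<forall>l. AE x in PiM {..<k} (\<lambda>_. lborel).
        cumulant p k (\<lambda>j\<in>{..<k}. (x j + a, l j)) = cumulant p k (\<lambda>j\<in>{..<k}. (x j, l j)))"

text \<open>\<open>\<xi>\<^sub>k\<^sub>+\<^sub>1((0, i), (x\<^sub>1, l\<^sub>1), \<dots>, (x\<^sub>k, l\<^sub>k))\<close> as a function of \<open>x\<close>. The point \<open>0\<close> is not substituted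
  into \<^const>\<open>cumulant\<close>, which is determined only almost everywhere.\<close>

definition cumulant_origin ::
    "(nat \<Rightarrow> (nat \<Rightarrow> 'a::euclidean_space \<times> label) \<Rightarrow> real) \<Rightarrow> nat \<Rightarrow> label \<Rightarrow> (nat \<Rightarrow> label) \<Rightarrow>
     (nat \<Rightarrow> 'a) \<Rightarrow> real" where
  "cumulant_origin p k i l =
     (SOME g. g \<in> borel_measurable (PiM {..<k} (\<lambda>_. lborel)) \<and>
        (AE (a, x) in lborel \<Otimes>\<^sub>M PiM {..<k} (\<lambda>_. lborel).
           g x = cumulant p (Suc k)
             (\<lambda>j\<in>{..<Suc k}. case j of 0 \<Rightarrow> (a, i) | Suc j' \<Rightarrow> (a + x j', l j'))))"


section \<open>The cross \<open>J\<close>-function\<close>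

definition J12k ::
    "(nat \<Rightarrow> (nat \<Rightarrow> 'a::euclidean_space \<times> label) \<Rightarrow> real) \<Rightarrow> nat \<Rightarrow> real \<Rightarrow> real" where
  "J12k p k t =
     set_lebesgue_integral (PiM {..<k} (\<lambda>_. lborel)) (\<Pi>\<^sub>E j\<in>{..<k}. cball 0 t)
       (cumulant_origin p k L1 (\<lambda>_. L2))"

definition J12_term ::
    "(nat \<Rightarrow> (nat \<Rightarrow> 'a::euclidean_space \<times> label) \<Rightarrow> real) \<Rightarrow> real \<Rightarrow> nat \<Rightarrow> real" where
  "J12_term p t k = (- 1) ^ k / fact k * J12k p k t"

definition J12 ::
    "(nat \<Rightarrow> (nat \<Rightarrow> 'a::euclidean_space \<times> label) \<Rightarrow> real) \<Rightarrow> real \<Rightarrow> real" where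
  "J12 p t = 1 + (\<Sum>k. J12_term p t (Suc k))"


section \<open>Laplace functional and Palm distributions\<close>

definition laplace ::
    "'w measure \<Rightarrow> ('w \<Rightarrow> ('a::euclidean_space \<times> label) measure) \<Rightarrow> ('a \<times> label \<Rightarrow> real) \<Rightarrow> real" where
  "laplace M \<Psi> u =
     (\<integral>\<omega>. exp (- (\<Sum>i\<in>UNIV. \<integral>x. u (x, i) \<partial>component (\<Psi> \<omega>) i)) \<partial>M)"

definition laplace_term ::
    "(nat \<Rightarrow> (nat \<Rightarrow> 'a::euclidean_space \<times> label) measure) \<Rightarrow> ('a \<times> label \<Rightarrow> real) \<Rightarrow> nat \<Rightarrow> real" where
  "laplace_term \<mu> u k = (- 1) ^ k / fact k * (\<integral>z. (\<Prod>j<k. u (z j)) \<partial>\<mu> k)"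

definition u_ball ::
    "(nat \<Rightarrow> (nat \<Rightarrow> 'a::euclidean_space \<times> label) \<Rightarrow> real) \<Rightarrow> real \<Rightarrow> 'a \<Rightarrow> 'a \<times> label \<Rightarrow> real" where
  "u_ball p t a z = indicator (cball a t \<times> {L2}) z / coverage1 p z"

text \<open>\<open>P z\<close> is a distribution on the space of locally finite measures; \<open>\<mu>1\<close> is the first order
  moment measure, living on 1-tuples.\<close>

definition palm_distribution ::
    "'w measure \<Rightarrow> ('w \<Rightarrow> ('a::euclidean_space \<times> label) measure) \<Rightarrow>
     (nat \<Rightarrow> 'a \<times> label) measure \<Rightarrow>
     ('a \<times> label \<Rightarrow> ('a \<times> label) measure measure) \<Rightarrow> bool" where
  "palm_distribution M \<Psi> \<mu>1 P \<longleftrightarrow>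
     P \<in> measurable ref_measure (prob_algebra lf_measures) \<and>
     (\<forall>g :: ('a \<times> label) \<times> ('a \<times> label) measure \<Rightarrow> ennreal.
        g \<in> borel_measurable (ref_measure \<Otimes>\<^sub>M lf_measures) \<longrightarrow>
        (\<integral>\<^sup>+\<omega>. (\<Sum>i\<in>UNIV. \<integral>\<^sup>+x. g ((x, i), \<Psi> \<omega>) \<partial>component (\<Psi> \<omega>) i) \<partial>M) =
        (\<integral>\<^sup>+z. (\<integral>\<^sup>+N. g (z 0, N) \<partial>P (z 0)) \<partial>\<mu>1))"

end

theory Submission
  imports Defs
begin

text \<open>
  Write \<open>X\<close> for the mass that \<open>u\<^sub>t\<^sup>a\<close> picks up from the random measure, so that \<open>L(u\<^sub>t\<^sup>a)\<close> and
  \<open>L\<^sup>(\<^sup>a\<^sup>,\<^sup>1\<^sup>)(u\<^sub>t\<^sup>a)\<close> are the expectations of \<open>exp (-X)\<close> under the distribution of \<open>\<Psi>\<close> and under its Palm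
  distribution at \<open>(a, 1)\<close>. The theorem is a product formula for exponential generating functions of
  moments.

  Let \<open>g\<^sub>k\<close> and \<open>q\<^sub>k\<close> be the \<open>k\<close>-th moments of \<open>X\<close> under these two distributions. The weight
  \<open>1 / p\<^sub>1\<close> in \<open>u\<^sub>t\<^sup>a\<close> turns coverage functions into normalised ones. By Campbell's formula \<open>g\<^sub>k\<close> is the
  integral over \<open>B(a, t)\<^sup>k\<close> of the normalised \<open>k\<close>-point function (\<open>nn_integral_ball_mass_power\<close>). By
  the same formula and the characterisation of Palm distributions, for almost every \<open>a\<close>, \<open>q\<^sub>k\<close> is the
  integral over \<open>B(a, t)\<^sup>k\<close> of the normalised \<open>(k+1)\<close>-point function whose first argument is \<open>(a, 1)\<close>
  (\<open>AE_palm_ball_mass_power\<close>).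

  The normalised \<open>(k+1)\<close>-point function is a sum over partitions. Sorting the partitions by the block
  containing the point \<open>(a, 1)\<close> leaves, for each set \<open>D\<close> of companions of that point, one cumulant
  density times the normalised coverage function of the points outside \<open>D\<close>
  (\<open>correlation_case_nat\<close>). The two factors involve disjoint sets of variables, so integration gives
  \<open>q\<^sub>k = (\<Sum>n\<le>k. (k choose n) * c\<^sub>n * g\<^sub>k\<^sub>-\<^sub>n)\<close>, where \<open>c\<^sub>n\<close> is the integral over \<open>B(a, t)\<^sup>n\<close> of the
  cumulant density rooted at \<open>(a, 1)\<close> (\<open>palm_moment_binomial\<close>). By translation invariance \<open>c\<^sub>n\<close> is
  \<open>J\<^sub>1\<^sub>2\<^sup>(\<^sup>n\<^sup>)(t)\<close> for almost every \<open>a\<close> (\<open>AE_J12k_eq\<close>, based on \<open>cumulant_origin_exists\<close>).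

  Hence the alternating series of the \<open>q\<^sub>k / k!\<close> is the Cauchy product of those of the \<open>c\<^sub>n / n!\<close> and of
  the \<open>g\<^sub>m / m!\<close>, that is, of \<open>J\<^sub>1\<^sub>2(t)\<close> and \<open>L(u\<^sub>t\<^sup>a)\<close>. Both factors converge absolutely, hence so does
  the product, and its sum is \<open>L\<^sup>(\<^sup>a\<^sup>,\<^sup>1\<^sup>)(u\<^sub>t\<^sup>a)\<close> (\<open>integral_exp_neg_eq_moment_series\<close>).

  Coverage functions and cumulant densities are determined almost everywhere only, so identities
  between integrals come first, and statements about a single base point \<open>a\<close> are extracted from them
  by Fubini's theorem or by uniqueness of densities.
\<close>

section \<open>Sums over set partitions\<close>

definition partition_sum :: "('b set \<Rightarrow> real) \<Rightarrow> 'b set \<Rightarrow> real" where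
  "partition_sum f A = (\<Sum>P | partition_on A P. \<Prod>D\<in>P. f D)"

lemma partition_sum_empty: "partition_sum f {} = 1"
proof -
  have "{P. partition_on {} P} = {{} :: 'a set set}"
    by (auto simp: partition_on_def)
  then show ?thesis
    by (simp add: partition_sum_def)
qed

text \<open>The block of \<open>a\<close> in a partition of \<open>insert a A\<close> is \<open>insert a D\<close> for a unique \<open>D \<subseteq> A\<close>, and the
  other blocks form an arbitrary partition of \<open>A - D\<close>. This is how one distinguished point, later
  the Palm point, is separated from the rest.\<close>

lemma partition_sum_insert:
  assumes A: "finite A" and a: "a \<notin> A"
  shows "partition_sum f (insert a A) = (\<Sum>D\<in>Pow A. f (insert a D) * partition_sum f (A - D))"
proof -
  define blk where "blk P = (THE D. D \<in> P \<and> a \<in> D)" for P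
  have blk: "blk P \<in> P" "a \<in> blk P" "\<And>D. D \<in> P \<Longrightarrow> a \<in> D \<Longrightarrow> D = blk P"
    if P: "partition_on (insert a A) P" for P
  proof -
    have "a \<in> \<Union>P" "disjoint P"
      using P by (auto simp: partition_on_def)
    then have "\<exists>!D. D \<in> P \<and> a \<in> D"
      by (auto simp: disjoint_def)
    from theI'[OF this] this show "blk P \<in> P" "a \<in> blk P" "\<And>D. D \<in> P \<Longrightarrow> a \<in> D \<Longrightarrow> D = blk P"
      unfolding blk_def by auto
  qed
  have ins: "partition_on (insert a A) (insert (insert a D) P) \<and> insert a D \<notin> P"
    if "D \<subseteq> A" "partition_on (A - D) P" for D P
  proof -
    have "disjnt (insert a D) (\<Union>P)"
      using that a by (auto simp: partition_on_def disjnt_def)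
    note iff = partition_on_insert[OF this, of "insert a A"]
    have eq: "insert a A - insert a D = A - D"
      using a by auto
    have "partition_on (insert a A) (insert (insert a D) P)"
      by (rule iff[THEN iffD2]) (use that(1) in \<open>simp add: eq that(2) subset_insertI2\<close>)
    moreover have "insert a D \<notin> P"
      using partition_onD1[OF that(2)] a by blast
    ultimately show ?thesis ..
  qed
  have "partition_sum f (insert a A) =
      (\<Sum>(D, P)\<in>Sigma (Pow A) (\<lambda>D. {P. partition_on (A - D) P}). f (insert a D) * (\<Prod>D\<in>P. f D))"
    unfolding partition_sum_def
  proof (rule sum.reindex_bij_witness[where
        i = "\<lambda>(D, P). insert (insert a D) P" and j = "\<lambda>P. (blk P - {a}, P - {blk P})"])
    fix P assume "P \<in> {P. partition_on (insert a A) P}"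
    then have P: "partition_on (insert a A) P" by simp
    note b = blk[OF P]
    have fin: "finite P" using P A by (meson finite.insertI finite_elements)
    have ia: "insert a (blk P - {a}) = blk P" using b(2) by auto
    then show "(\<lambda>(D, P). insert (insert a D) P) (blk P - {a}, P - {blk P}) = P"
      using b(1) by auto
    have "partition_on (insert a A - blk P) (P - {blk P})"
    proof -
      have "disjnt (blk P) (\<Union>(P - {blk P}))"
        using partition_onD2[OF P] b(1) by (auto simp: disjnt_def disjoint_def)
      moreover have "insert (blk P) (P - {blk P}) = P" using b(1) by auto
      ultimately show ?thesis
        using partition_on_insert[of "blk P" "P - {blk P}" "insert a A"] P by simp
    qed
    moreover have "insert a A - blk P = A - (blk P - {a})" using a b(2) by auto
    moreover have "blk P \<subseteq> insert a A" using P b(1) by (auto simp: partition_on_def)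
    ultimately show "(blk P - {a}, P - {blk P}) \<in> Sigma (Pow A) (\<lambda>D. {P. partition_on (A - D) P})"
      by auto
    show "(case (blk P - {a}, P - {blk P}) of (D, P) \<Rightarrow> f (insert a D) * prod f P) = prod f P"
      by (simp add: insert_absorb[OF b(2)] prod.remove[OF fin b(1)])
  next
    fix DP assume "DP \<in> Sigma (Pow A) (\<lambda>D. {P. partition_on (A - D) P})"
    then obtain D P where DP: "DP = (D, P)" "D \<subseteq> A" "partition_on (A - D) P" by auto
    note i = ins[OF DP(2,3)]
    have "blk (insert (insert a D) P) = insert a D"
      using blk(3)[OF conjunct1[OF i], of "insert a D"] by simp
    then show "(\<lambda>P. (blk P - {a}, P - {blk P})) ((\<lambda>(D, P). insert (insert a D) P) DP) = DP"
      using i DP(1,2) a by (simp add: insert_absorb Diff_insert_absorb) blast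
    show "(\<lambda>(D, P). insert (insert a D) P) DP \<in> {P. partition_on (insert a A) P}"
      using i DP by simp
  qed
  also have "\<dots> = (\<Sum>D\<in>Pow A. \<Sum>P | partition_on (A - D) P. f (insert a D) * (\<Prod>D\<in>P. f D))"
    using A by (subst sum.Sigma) (auto intro: finitely_many_partition_on)
  finally show ?thesis
    by (simp add: partition_sum_def sum_distrib_left)
qed

lemma partition_on_image:
  assumes "partition_on A P" "inj_on e A"
  shows "partition_on (e ` A) (image e ` P)"
proof -
  have "image e ` P - {{}} = image e ` P"
    using partition_onD3[OF assms(1)] by auto
  then show ?thesis
    using partition_on_inj_image[OF assms] by simp
qed

lemma partition_sum_reindex:
  assumes e: "inj_on e A"
  shows "partition_sum f (e ` A) = partition_sum (\<lambda>D. f (e ` D)) A"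
  unfolding partition_sum_def
proof (rule sum.reindex_bij_witness[where i = "image (image e)" and j = "image (image (inv_into A e))"])
  fix Q assume "Q \<in> {P. partition_on (e ` A) P}"
  then have Q: "partition_on (e ` A) Q" by simp
  have eD: "e ` inv_into A e ` D = D" if "D \<in> Q" for D
    using that Q by (intro image_inv_into_cancel[OF refl]) (auto simp: partition_on_def)
  then show *: "image e ` image (inv_into A e) ` Q = Q"
    by (auto simp: image_image)
  show "image (inv_into A e) ` Q \<in> {P. partition_on A P}"
    using partition_on_image[OF Q, of "inv_into A e"] e by (simp add: inj_on_inv_into)
  have "inj_on (image (inv_into A e)) Q"
    by (metis eD inj_onI)
  then show "(\<Prod>D\<in>image (inv_into A e) ` Q. f (e ` D)) = prod f Q"
    by (subst prod.reindex) (auto simp: eD)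
next
  fix P assume "P \<in> {P. partition_on A P}"
  then have P: "partition_on A P" by simp
  have "inv_into A e ` e ` D = D" if "D \<in> P" for D
    using that P e by (intro inv_into_image_cancel) (auto simp: partition_on_def)
  then show "image (inv_into A e) ` image e ` P = P"
    by (auto simp: image_image)
  show "image e ` P \<in> {P. partition_on (e ` A) P}"
    using partition_on_image[OF P e] by simp
qed

lemma sum_Pow_card:
  assumes "finite A"
  shows "(\<Sum>D\<in>Pow A. h (card D)) = (\<Sum>n\<le>card A. real (card A choose n) * h n)"
proof -
  have "(\<Sum>D\<in>Pow A. h (card D)) = (\<Sum>n\<le>card A. \<Sum>D | D \<in> Pow A \<and> card D = n. h (card D))"
    using assms by (subst sum.group) (auto intro: card_mono)
  also have "\<dots> = (\<Sum>n\<le>card A. real (card A choose n) * h n)"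
    using n_subsets[OF assms] by (intro sum.cong) auto
  finally show ?thesis .
qed

section \<open>Subtuples and the expansion around a distinguished point\<close>

lemma enum_bij:
  assumes "finite D"
  shows "bij_betw (\<lambda>j. sorted_list_of_set D ! j) {..<card D} D"
  using assms by (intro bij_betw_nth) auto

text \<open>An increasing reindexing carries the ordered list of a block to the ordered list of its image. All
  reindexings below are increasing, so they preserve the order of the arguments of the cumulant
  densities.\<close>

lemma sorted_list_of_set_image_mono:
  fixes e :: "nat \<Rightarrow> nat"
  assumes "finite D" "strict_mono_on D e"
  shows "sorted_list_of_set (e ` D) = map e (sorted_list_of_set D)"
proof (rule strict_sorted_equal)
  have "sorted_wrt (\<lambda>x y. e x < e y) (sorted_list_of_set D)"
    by (rule sorted_wrt_mono_rel[OF _ strict_sorted_list_of_set])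
      (use assms in \<open>auto dest: strict_mono_onD\<close>)
  then show "sorted_wrt (<) (map e (sorted_list_of_set D))"
    by (simp add: sorted_wrt_map)
qed (use assms in auto)

lemma subtuple_image_mono:
  assumes D: "finite D" "strict_mono_on D e"
  shows "subtuple z (e ` D) = subtuple (\<lambda>j. z (e j)) D"
proof -
  have "card (e ` D) = card D"
    using D by (auto intro!: card_image strict_mono_on_imp_inj_on)
  then show ?thesis
    using D by (auto simp: subtuple_def sorted_list_of_set_image_mono fun_eq_iff)
qed

lemma subtuple_cong:
  assumes "finite D" "\<And>j. j \<in> D \<Longrightarrow> z j = w j"
  shows "subtuple z D = subtuple w D"
  using assms enum_bij[OF assms(1)] by (auto simp: subtuple_def fun_eq_iff bij_betw_def)

lemma strict_mono_on_enum:
  "strict_mono_on {..<card R} (\<lambda>j. sorted_list_of_set R ! j)"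
  by (rule strict_mono_onI)
    (auto intro!: sorted_wrt_nth_less[OF strict_sorted_list_of_set])

lemma subtuple_subtuple:
  assumes D: "D \<subseteq> {..<card R}"
  shows "subtuple z ((\<lambda>j. sorted_list_of_set R ! j) ` D) = subtuple (subtuple z R) D"
proof -
  have fin: "finite D" using D finite_subset by blast
  have "subtuple z ((\<lambda>j. sorted_list_of_set R ! j) ` D) = subtuple (\<lambda>j. z (sorted_list_of_set R ! j)) D"
    by (rule subtuple_image_mono[OF fin monotone_on_subset[OF strict_mono_on_enum D]])
  also have "\<dots> = subtuple (subtuple z R) D"
    by (rule subtuple_cong[OF fin]) (use D in \<open>auto simp: subtuple_def\<close>)
  finally show ?thesis .
qed

lemma subtuple_case_nat_Suc:
  "finite D \<Longrightarrow> subtuple (case_nat b w) (Suc ` D) = subtuple w D"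
  by (subst subtuple_image_mono) (auto intro: strict_mono_onI)

lemma sorted_list_of_set_insert_0:
  assumes "finite D"
  shows "sorted_list_of_set (insert 0 (Suc ` D)) = 0 # map Suc (sorted_list_of_set D)"
proof (rule strict_sorted_equal)
  have "sorted_wrt (<) (map Suc (sorted_list_of_set D))"
    by (simp add: sorted_wrt_map strict_sorted_list_of_set)
  then show "sorted_wrt (<) (0 # map Suc (sorted_list_of_set D))"
    by auto
  show "set (sorted_list_of_set (insert 0 (Suc ` D))) = set (0 # map Suc (sorted_list_of_set D))"
    using assms by (subst set_sorted_list_of_set) auto
qed (rule strict_sorted_list_of_set)

lemma subtuple_case_nat_insert_0:
  assumes "finite D"
  shows "subtuple (case_nat b w) (insert 0 (Suc ` D)) = case_nat b (subtuple w D)"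
proof -
  have "card (insert 0 (Suc ` D)) = Suc (card D)"
    using assms by (simp add: card_image)
  then show ?thesis
    unfolding subtuple_def sorted_list_of_set_insert_0[OF assms]
    by (auto simp: fun_eq_iff restrict_def split: nat.split)
qed

text \<open>The partition sum over subsets of an index set \<open>A\<close>. On \<open>{..<k}\<close> it is the normalised coverage
  function \<open>p k z / (\<Prod>j<k. coverage1 p (z j))\<close>, but it equals \<open>1\<close> for \<open>k = 0\<close>, where \<open>p 0\<close>
  is arbitrary.\<close>

definition correlation ::
    "(nat \<Rightarrow> (nat \<Rightarrow> 'a \<times> label) \<Rightarrow> real) \<Rightarrow> (nat \<Rightarrow> 'a \<times> label) \<Rightarrow> nat set \<Rightarrow> real" where
  "correlation p z A = partition_sum (\<lambda>D. cumulant p (card D) (subtuple z D)) A"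

lemma correlation_subtuple:
  assumes "finite R"
  shows "correlation p z R = correlation p (subtuple z R) {..<card R}"
proof -
  let ?e = "\<lambda>j. sorted_list_of_set R ! j"
  have inj: "inj_on ?e {..<card R}" and im: "?e ` {..<card R} = R"
    using enum_bij[OF assms] by (auto simp: bij_betw_def)
  have "correlation p z R = correlation p z (?e ` {..<card R})"
    by (simp add: im)
  also have "\<dots> = partition_sum (\<lambda>D. cumulant p (card (?e ` D)) (subtuple z (?e ` D))) {..<card R}"
    unfolding correlation_def by (rule partition_sum_reindex[OF inj])
  also have "\<dots> = correlation p (subtuple z R) {..<card R}"
    unfolding correlation_def partition_sum_def
  proof (intro sum.cong prod.cong refl)
    fix P D assume "P \<in> {P. partition_on {..<card R} P}" "D \<in> P"
    then have D: "D \<subseteq> {..<card R}" by (auto simp: partition_on_def)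
    then have "card (?e ` D) = card D"
      using inj by (auto intro!: card_image intro: inj_on_subset)
    then show "cumulant p (card (?e ` D)) (subtuple z (?e ` D)) =
        cumulant p (card D) (subtuple (subtuple z R) D)"
      by (simp add: subtuple_subtuple[OF D])
  qed
  finally show ?thesis .
qed

text \<open>The combinatorial core. Sorting the partitions of the \<open>k + 1\<close> indices by the block that contains
  the point \<open>b\<close> yields one cumulant factor with \<open>b\<close>, times normalised coverage functions of the
  remaining points, in which \<open>b\<close> no longer occurs.\<close>

lemma correlation_case_nat:
  "correlation p (case_nat b w) {..<Suc k} =
    (\<Sum>D\<in>Pow {..<k}. cumulant p (Suc (card D)) (case_nat b (subtuple w D)) *
       correlation p (subtuple w ({..<k} - D)) {..<k - card D})"
proof -
  let ?f = "\<lambda>D. cumulant p (card D) (subtuple (case_nat b w) D)"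
  have "correlation p (case_nat b w) {..<Suc k} = partition_sum ?f (insert 0 (Suc ` {..<k}))"
    by (simp add: correlation_def lessThan_Suc_eq_insert_0)
  also have "\<dots> = (\<Sum>D\<in>Pow (Suc ` {..<k}). ?f (insert 0 D) * partition_sum ?f (Suc ` {..<k} - D))"
    by (rule partition_sum_insert) auto
  also have "Pow (Suc ` {..<k}) = image Suc ` Pow {..<k}"
    by (simp add: image_Pow_surj)
  also have "(\<Sum>D\<in>image Suc ` Pow {..<k}. ?f (insert 0 D) * partition_sum ?f (Suc ` {..<k} - D)) =
      (\<Sum>D\<in>Pow {..<k}. ?f (insert 0 (Suc ` D)) * partition_sum ?f (Suc ` {..<k} - Suc ` D))"
    by (subst sum.reindex) (auto simp: image_set_diff[OF inj_Suc] intro!: inj_onI dest: inj_image_eq_iff[OF inj_Suc, THEN iffD1])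
  also have "\<dots> = (\<Sum>D\<in>Pow {..<k}. cumulant p (Suc (card D)) (case_nat b (subtuple w D)) *
       correlation p (subtuple w ({..<k} - D)) {..<k - card D})"
  proof (intro sum.cong refl arg_cong2[where f = "(*)"])
    fix D assume "D \<in> Pow {..<k}"
    then have D: "D \<subseteq> {..<k}" "finite D" by (auto intro: finite_subset)
    show "?f (insert 0 (Suc ` D)) = cumulant p (Suc (card D)) (case_nat b (subtuple w D))"
      using D by (simp add: subtuple_case_nat_insert_0 card_image)
    have R: "Suc ` {..<k} - Suc ` D = Suc ` ({..<k} - D)" "card ({..<k} - D) = k - card D"
      using D by (auto simp: card_Diff_subset)
    have "partition_sum ?f (Suc ` {..<k} - Suc ` D) = correlation p (case_nat b w) (Suc ` ({..<k} - D))"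
      by (simp only: R correlation_def)
    also have "\<dots> = correlation p (subtuple w ({..<k} - D)) {..<k - card D}"
      by (subst correlation_subtuple) (simp_all add: subtuple_case_nat_Suc card_image R)
    finally show "partition_sum ?f (Suc ` {..<k} - Suc ` D) =
      correlation p (subtuple w ({..<k} - D)) {..<k - card D}" .
  qed
  finally show ?thesis .
qed

text \<open>For \<open>k \<ge> 2\<close> this is the recursion defining the cumulants. For \<open>k = 1\<close> both sides are \<open>1\<close>, the right
  one because it is \<open>coverage1 p (z 0)\<close> divided by itself.\<close>

lemma correlation_eq_ratio:
  assumes k: "k \<ge> 1" and z: "z \<in> extensional {..<k}" and pos: "coverage1 p (z 0) \<noteq> 0"
  shows "correlation p z {..<k} = p k z / (\<Prod>j<k. coverage1 p (z j))"
proof (cases "k = 1")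
  case True
  have "{..<1::nat} = {0}" by auto
  have "(\<lambda>_\<in>{..<1}. z 0) = z"
    using z True by (auto simp: fun_eq_iff extensional_def)
  then have c: "coverage1 p (z 0) = p 1 z"
    by (simp add: coverage1_def)
  have "correlation p z {..<1} = partition_sum (\<lambda>D. cumulant p (card D) (subtuple z D)) (insert 0 {})"
    by (simp only: correlation_def \<open>{..<1::nat} = {0}\<close>)
  also have "\<dots> = 1"
    by (subst partition_sum_insert) (simp_all add: partition_sum_empty cumulant.simps)
  finally show ?thesis
    using True pos c by simp
next
  case False
  then show ?thesis
    using cumulant_partition_sum[of k z p] k z by (simp add: correlation_def partition_sum_def)
qed

section \<open>Splitting finite powers of a measure\<close>

lemma measurable_case_nat_PiM [measurable (raw)]:
  assumes f: "f \<in> measurable N (M 0)"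
    and g: "g \<in> measurable N (PiM {..<k} (\<lambda>j. M (Suc j)))"
  shows "(\<lambda>w. case_nat (f w) (g w)) \<in> measurable N (PiM {..<Suc k} M)"
proof (rule measurable_PiM_single')
  fix i assume i: "i \<in> {..<Suc k}"
  show "(\<lambda>w. case_nat (f w) (g w) i) \<in> measurable N (M i)"
    using f i by (cases i) (auto intro: measurable_compose[OF g measurable_component_singleton])
next
  show "(\<lambda>w. case_nat (f w) (g w)) \<in> space N \<rightarrow> (\<Pi>\<^sub>E i\<in>{..<Suc k}. space (M i))"
  proof
    fix w assume w: "w \<in> space N"
    have "f w \<in> space (M 0)" "g w \<in> (\<Pi>\<^sub>E i\<in>{..<k}. space (M (Suc i)))"
      using measurable_space[OF f w] measurable_space[OF g w] by (simp_all add: space_PiM)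
    then show "case_nat (f w) (g w) \<in> (\<Pi>\<^sub>E i\<in>{..<Suc k}. space (M i))"
      unfolding PiE_iff lessThan_Suc_eq_insert_0 by (auto simp: extensional_def split: nat.split)
  qed
qed

text \<open>Prepending a coordinate to an extensional tuple with \<^const>\<open>case_nat\<close> gives an extensional tuple,
  and the preimage of a rectangle is a rectangle.\<close>

lemma distr_case_nat_PiM:
  assumes "product_sigma_finite M"
  shows "distr (M 0 \<Otimes>\<^sub>M PiM {..<k} (\<lambda>j. M (Suc j))) (PiM {..<Suc k} M) (\<lambda>(a, x). case_nat a x) =
    PiM {..<Suc k} M" (is "?D = _")
proof -
  interpret M: product_sigma_finite M by fact
  interpret S: product_sigma_finite "\<lambda>j. M (Suc j)"
    using M.sigma_finite_measures by (simp add: product_sigma_finite_def)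
  interpret F: finite_product_sigma_finite "\<lambda>j. M (Suc j)" "{..<k}" by standard simp
  have m: "(\<lambda>(a, x). case_nat a x) \<in>
      measurable (M 0 \<Otimes>\<^sub>M PiM {..<k} (\<lambda>j. M (Suc j))) (PiM {..<Suc k} M)"
    unfolding case_prod_beta by (rule measurable_case_nat_PiM) measurable
  show ?thesis
  proof (rule M.PiM_eqI)
    fix A assume A: "\<And>i. i \<in> {..<Suc k} \<Longrightarrow> A i \<in> sets (M i)"
    have A0: "A 0 \<in> sets (M 0)" and AS: "PiE {..<k} (\<lambda>j. A (Suc j)) \<in> sets (PiM {..<k} (\<lambda>j. M (Suc j)))"
      using A by (auto intro!: sets_PiM_I_finite)
    have "case_nat a x \<in> PiE {..<Suc k} A \<longleftrightarrow> a \<in> A 0 \<and> x \<in> PiE {..<k} (\<lambda>j. A (Suc j))"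
      if "x \<in> extensional {..<k}" for a x
      using that unfolding PiE_iff lessThan_Suc_eq_insert_0
      by (auto simp: extensional_def split: nat.split)
    then have "(\<lambda>(a, x). case_nat a x) -` PiE {..<Suc k} A \<inter> space (M 0 \<Otimes>\<^sub>M PiM {..<k} (\<lambda>j. M (Suc j))) =
        A 0 \<times> PiE {..<k} (\<lambda>j. A (Suc j))"
      using sets.sets_into_space[OF A0] sets.sets_into_space[OF AS]
      by (auto simp: space_pair_measure space_PiM PiE_iff[of _ "{..<k}"])
    then have "emeasure ?D (PiE {..<Suc k} A) =
        emeasure (M 0 \<Otimes>\<^sub>M PiM {..<k} (\<lambda>j. M (Suc j))) (A 0 \<times> PiE {..<k} (\<lambda>j. A (Suc j)))"
      using A by (subst emeasure_distr[OF m]) (auto intro!: sets_PiM_I_finite)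
    also have "\<dots> = emeasure (M 0) (A 0) * (\<Prod>j<k. emeasure (M (Suc j)) (A (Suc j)))"
      using A by (subst F.emeasure_pair_measure_Times[OF A0 AS], subst S.emeasure_PiM) auto
    also have "\<dots> = (\<Prod>i<Suc k. emeasure (M i) (A i))"
      by (rule prod.lessThan_Suc_shift[symmetric])
    finally show "emeasure ?D (PiE {..<Suc k} A) = (\<Prod>i<Suc k. emeasure (M i) (A i))" .
  qed simp_all
qed

lemma nn_integral_PiM_Suc:
  assumes "product_sigma_finite M" and f: "f \<in> borel_measurable (PiM {..<Suc k} M)"
  shows "(\<integral>\<^sup>+z. f z \<partial>PiM {..<Suc k} M) =
    (\<integral>\<^sup>+a. \<integral>\<^sup>+x. f (case_nat a x) \<partial>PiM {..<k} (\<lambda>j. M (Suc j)) \<partial>M 0)"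
proof -
  interpret M: product_sigma_finite M by fact
  interpret S: product_sigma_finite "\<lambda>j. M (Suc j)"
    using M.sigma_finite_measures by (simp add: product_sigma_finite_def)
  interpret F: finite_product_sigma_finite "\<lambda>j. M (Suc j)" "{..<k}" by standard simp
  have m: "(\<lambda>(a, x). case_nat a x) \<in>
      measurable (M 0 \<Otimes>\<^sub>M PiM {..<k} (\<lambda>j. M (Suc j))) (PiM {..<Suc k} M)"
    unfolding case_prod_beta by (rule measurable_case_nat_PiM) measurable
  have "(\<integral>\<^sup>+z. f z \<partial>PiM {..<Suc k} M) =
      (\<integral>\<^sup>+w. f (case w of (a, x) \<Rightarrow> case_nat a x) \<partial>(M 0 \<Otimes>\<^sub>M PiM {..<k} (\<lambda>j. M (Suc j))))"
    by (subst distr_case_nat_PiM[OF assms(1), symmetric]) (rule nn_integral_distr[OF m], use f in simp)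
  also have "\<dots> = (\<integral>\<^sup>+a. \<integral>\<^sup>+x. f (case_nat a x) \<partial>PiM {..<k} (\<lambda>j. M (Suc j)) \<partial>M 0)"
    by (subst F.nn_integral_fst[symmetric]) (use measurable_compose[OF m f] in simp_all)
  finally show ?thesis .
qed

lemma measurable_subtuple:
  assumes "D \<subseteq> {..<k}"
  shows "(\<lambda>x. subtuple x D) \<in> measurable (PiM {..<k} (\<lambda>_. N)) (PiM {..<card D} (\<lambda>_. N))"
  unfolding subtuple_def
proof (rule measurable_restrict)
  fix j assume j: "j \<in> {..<card D}"
  have "finite D" using assms finite_subset by blast
  then have "sorted_list_of_set D ! j \<in> {..<k}"
    using enum_bij[of D] j assms by (auto simp: bij_betw_def)
  then show "(\<lambda>x. x (sorted_list_of_set D ! j)) \<in> measurable (PiM {..<k} (\<lambda>_. N)) N"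
    by (rule measurable_component_singleton)
qed

text \<open>The inverse of the splitting map merges two tuples along the increasing enumerations of \<open>D\<close> and of
  its complement. It pulls rectangles back to products of rectangles, so it preserves the product
  measures, and hence so does the splitting map.\<close>

lemma distr_subtuple_PiM:
  assumes N: "sigma_finite_measure N" and D: "D \<subseteq> {..<k}"
  defines "R \<equiv> {..<k} - D"
  shows "distr (PiM {..<k} (\<lambda>_. N)) (PiM {..<card D} (\<lambda>_. N) \<Otimes>\<^sub>M PiM {..<card R} (\<lambda>_. N))
      (\<lambda>x. (subtuple x D, subtuple x R)) =
    PiM {..<card D} (\<lambda>_. N) \<Otimes>\<^sub>M PiM {..<card R} (\<lambda>_. N)"
proof -
  interpret M: product_sigma_finite "\<lambda>_::nat. N"
    using N by (simp add: product_sigma_finite_def)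
  let ?PD = "PiM {..<card D} (\<lambda>_. N)" and ?PR = "PiM {..<card R} (\<lambda>_. N)"
    and ?P = "PiM {..<k} (\<lambda>_. N)"
  interpret FD: finite_product_sigma_finite "\<lambda>_. N" "{..<card D}" by standard simp
  interpret FR: finite_product_sigma_finite "\<lambda>_. N" "{..<card R}" by standard simp
  have fin: "finite D" "finite R" using D finite_subset by (auto simp: R_def)
  define eD where "eD j = sorted_list_of_set D ! j" for j
  define eR where "eR j = sorted_list_of_set R ! j" for j
  have bij: "bij_betw eD {..<card D} D" "bij_betw eR {..<card R} R"
    unfolding eD_def eR_def by (intro enum_bij fin)+
  define dD where "dD = the_inv_into {..<card D} eD"
  define dR where "dR = the_inv_into {..<card R} eR"
  have dD: "dD (eD i) = i" "eD i \<in> D" if "i < card D" for i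
    unfolding dD_def using bij(1) that by (auto simp: bij_betw_def the_inv_into_f_f)
  have dR: "dR (eR i) = i" "eR i \<in> R" if "i < card R" for i
    unfolding dR_def using bij(2) that by (auto simp: bij_betw_def the_inv_into_f_f)
  have dD': "dD j < card D" "eD (dD j) = j" if "j \<in> D" for j
    unfolding dD_def using bij(1) that
    by (auto simp: bij_betw_def f_the_inv_into_f dest: the_inv_into_into[of eD _ _ "{..<card D}"])
  have dR': "dR j < card R" "eR (dR j) = j" if "j \<in> R" for j
    unfolding dR_def using bij(2) that
    by (auto simp: bij_betw_def f_the_inv_into_f dest: the_inv_into_into[of eR _ _ "{..<card R}"])
  \<comment> \<open>The merging map, inverse to splitting a tuple.\<close>
  define \<Phi> where "\<Phi> w = (\<lambda>j\<in>{..<k}. if j \<in> D then fst w (dD j) else snd w (dR j))"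
    for w :: "(nat \<Rightarrow> 'a) \<times> (nat \<Rightarrow> 'a)"
  have m\<Phi>: "\<Phi> \<in> measurable (?PD \<Otimes>\<^sub>M ?PR) ?P"
    unfolding \<Phi>_def
  proof (rule measurable_restrict)
    fix j assume "j \<in> {..<k}"
    then consider "j \<in> D" | "j \<notin> D" "j \<in> R" by (auto simp: R_def)
    then show "(\<lambda>w. if j \<in> D then fst w (dD j) else snd w (dR j)) \<in> measurable (?PD \<Otimes>\<^sub>M ?PR) N"
      by cases (auto simp: dD' dR'
          intro!: measurable_compose[OF measurable_fst measurable_component_singleton]
            measurable_compose[OF measurable_snd measurable_component_singleton])
  qed
  have R: "j < k" "j \<notin> D" if "j \<in> R" for j
    using that by (auto simp: R_def)
  have split: "(subtuple (\<Phi> w) D, subtuple (\<Phi> w) R) = w" if "w \<in> space (?PD \<Otimes>\<^sub>M ?PR)" for w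
  proof -
    have w: "fst w \<in> extensional {..<card D}" "snd w \<in> extensional {..<card R}"
      using that by (auto simp: space_pair_measure space_PiM PiE_def)
    have "subtuple (\<Phi> w) D = fst w"
    proof
      fix i show "subtuple (\<Phi> w) D i = fst w i"
        using w dD[of i] D by (cases "i < card D")
          (auto simp: subtuple_def \<Phi>_def eD_def[symmetric] extensional_def)
    qed
    moreover have "subtuple (\<Phi> w) R = snd w"
    proof
      fix i show "subtuple (\<Phi> w) R i = snd w i"
        using w dR[of i] R by (cases "i < card R")
          (auto simp: subtuple_def \<Phi>_def eR_def[symmetric] extensional_def)
    qed
    ultimately show ?thesis by simp
  qed
  have "distr (?PD \<Otimes>\<^sub>M ?PR) ?P \<Phi> = ?P"
  proof (rule M.PiM_eqI)
    fix A assume A: "\<And>i. i \<in> {..<k} \<Longrightarrow> A i \<in> sets N"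
    have AD: "PiE {..<card D} (\<lambda>i. A (eD i)) \<in> sets ?PD"
      using A dD D by (intro sets_PiM_I_finite) auto
    have AR: "PiE {..<card R} (\<lambda>i. A (eR i)) \<in> sets ?PR"
      using A dR by (intro sets_PiM_I_finite) (auto simp: R_def)
    have mem: "\<Phi> w \<in> PiE {..<k} A \<longleftrightarrow> fst w \<in> PiE {..<card D} (\<lambda>i. A (eD i)) \<and> snd w \<in> PiE {..<card R} (\<lambda>i. A (eR i))"
      if w: "w \<in> space (?PD \<Otimes>\<^sub>M ?PR)" for w
    proof -
      have ext: "fst w \<in> extensional {..<card D}" "snd w \<in> extensional {..<card R}"
        using w by (auto simp: space_pair_measure space_PiM PiE_def)
      have "\<Phi> w \<in> PiE {..<k} A \<longleftrightarrow> (\<forall>j\<in>D. fst w (dD j) \<in> A j) \<and> (\<forall>j\<in>R. snd w (dR j) \<in> A j)"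
        using D by (auto simp: \<Phi>_def R_def PiE_iff)
      also have "(\<forall>j\<in>D. fst w (dD j) \<in> A j) \<longleftrightarrow> (\<forall>i<card D. fst w i \<in> A (eD i))"
        using dD dD' by metis
      also have "(\<forall>j\<in>R. snd w (dR j) \<in> A j) \<longleftrightarrow> (\<forall>i<card R. snd w i \<in> A (eR i))"
        using dR dR' by metis
      finally show ?thesis using ext by (auto simp: PiE_iff)
    qed
    have "\<Phi> -` PiE {..<k} A \<inter> space (?PD \<Otimes>\<^sub>M ?PR) =
        PiE {..<card D} (\<lambda>i. A (eD i)) \<times> PiE {..<card R} (\<lambda>i. A (eR i))"
    proof (intro set_eqI)
      fix w
      show "w \<in> \<Phi> -` PiE {..<k} A \<inter> space (?PD \<Otimes>\<^sub>M ?PR) \<longleftrightarrow>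
          w \<in> PiE {..<card D} (\<lambda>i. A (eD i)) \<times> PiE {..<card R} (\<lambda>i. A (eR i))"
        using mem[of w] subsetD[OF sets.sets_into_space[OF AD], of "fst w"]
          subsetD[OF sets.sets_into_space[OF AR], of "snd w"]
        unfolding vimage_eq Int_iff mem_Times_iff space_pair_measure by argo
    qed
    then have "emeasure (distr (?PD \<Otimes>\<^sub>M ?PR) ?P \<Phi>) (PiE {..<k} A) =
        emeasure (?PD \<Otimes>\<^sub>M ?PR) (PiE {..<card D} (\<lambda>i. A (eD i)) \<times> PiE {..<card R} (\<lambda>i. A (eR i)))"
      using A by (subst emeasure_distr[OF m\<Phi>]) (auto intro!: sets_PiM_I_finite)
    also have "\<dots> = (\<Prod>i<card D. emeasure N (A (eD i))) * (\<Prod>i<card R. emeasure N (A (eR i)))"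
    proof (subst FR.emeasure_pair_measure_Times[OF AD AR], intro arg_cong2[where f = "(*)"] M.emeasure_PiM)
      show "A (eD i) \<in> sets N" if "i \<in> {..<card D}" for i
        using A[of "eD i"] dD(2)[of i] that D by auto
      show "A (eR i) \<in> sets N" if "i \<in> {..<card R}" for i
        using A[of "eR i"] dR(2)[of i] that R by auto
    qed auto
    also have "(\<Prod>i<card D. emeasure N (A (eD i))) = (\<Prod>j\<in>D. emeasure N (A j))"
      by (rule prod.reindex_bij_betw[OF bij(1)])
    also have "(\<Prod>i<card R. emeasure N (A (eR i))) = (\<Prod>j\<in>R. emeasure N (A j))"
      by (rule prod.reindex_bij_betw[OF bij(2)])
    also have "(\<Prod>j\<in>D. emeasure N (A j)) * (\<Prod>j\<in>R. emeasure N (A j)) = (\<Prod>j<k. emeasure N (A j))"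
      unfolding R_def using D by (subst prod.subset_diff[of D]) (auto simp: mult.commute)
    finally show "emeasure (distr (?PD \<Otimes>\<^sub>M ?PR) ?P \<Phi>) (PiE {..<k} A) = (\<Prod>j<k. emeasure N (A j))" .
  qed simp_all
  then have "distr ?P (?PD \<Otimes>\<^sub>M ?PR) (\<lambda>x. (subtuple x D, subtuple x R)) =
      distr (distr (?PD \<Otimes>\<^sub>M ?PR) ?P \<Phi>) (?PD \<Otimes>\<^sub>M ?PR) (\<lambda>x. (subtuple x D, subtuple x R))"
    by simp
  also have "\<dots> = distr (?PD \<Otimes>\<^sub>M ?PR) (?PD \<Otimes>\<^sub>M ?PR) (\<lambda>w. (subtuple (\<Phi> w) D, subtuple (\<Phi> w) R))"
  proof (subst distr_distr[OF _ m\<Phi>])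
    show "(\<lambda>x. (subtuple x D, subtuple x R)) \<in> measurable ?P (?PD \<Otimes>\<^sub>M ?PR)"
      using D by (intro measurable_Pair measurable_subtuple) (auto simp: R_def)
  qed (simp add: comp_def)
  also have "\<dots> = distr (?PD \<Otimes>\<^sub>M ?PR) (?PD \<Otimes>\<^sub>M ?PR) (\<lambda>w. w)"
    by (rule distr_cong[OF refl refl split])
  finally show ?thesis by (simp add: distr_id)
qed

text \<open>Factors that depend on disjoint sets of coordinates integrate independently; this turns the
  expansion of \<open>correlation_case_nat\<close> into products of integrals.\<close>

lemma integral_PiM_subtuple_mult:
  fixes f g :: "(nat \<Rightarrow> 'a) \<Rightarrow> real"
  assumes N: "sigma_finite_measure N" and D: "D \<subseteq> {..<k}"
  defines "R \<equiv> {..<k} - D"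
  assumes f: "integrable (PiM {..<card D} (\<lambda>_. N)) f" and g: "integrable (PiM {..<card R} (\<lambda>_. N)) g"
  shows "integrable (PiM {..<k} (\<lambda>_. N)) (\<lambda>x. f (subtuple x D) * g (subtuple x R))"
    and "(\<integral>x. f (subtuple x D) * g (subtuple x R) \<partial>PiM {..<k} (\<lambda>_. N)) =
      (\<integral>y. f y \<partial>PiM {..<card D} (\<lambda>_. N)) * (\<integral>y. g y \<partial>PiM {..<card R} (\<lambda>_. N))"
proof -
  interpret M: product_sigma_finite "\<lambda>_::nat. N"
    using N by (simp add: product_sigma_finite_def)
  let ?PD = "PiM {..<card D} (\<lambda>_. N)" and ?PR = "PiM {..<card R} (\<lambda>_. N)"
    and ?P = "PiM {..<k} (\<lambda>_. N)"
  interpret FD: finite_product_sigma_finite "\<lambda>_. N" "{..<card D}" by standard simp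
  interpret FR: finite_product_sigma_finite "\<lambda>_. N" "{..<card R}" by standard simp
  interpret PP: pair_sigma_finite ?PD ?PR ..
  note [measurable] = borel_measurable_integrable[OF f] borel_measurable_integrable[OF g]
  have m: "(\<lambda>x. (subtuple x D, subtuple x R)) \<in> measurable ?P (?PD \<Otimes>\<^sub>M ?PR)"
    using D by (intro measurable_Pair measurable_subtuple) (auto simp: R_def)
  have d: "distr ?P (?PD \<Otimes>\<^sub>M ?PR) (\<lambda>x. (subtuple x D, subtuple x R)) = ?PD \<Otimes>\<^sub>M ?PR"
    using distr_subtuple_PiM[OF N D] by (simp add: R_def)
  have h: "(\<lambda>w. f (fst w) * g (snd w)) \<in> borel_measurable (?PD \<Otimes>\<^sub>M ?PR)"
    by measurable
  have int: "integrable (?PD \<Otimes>\<^sub>M ?PR) (\<lambda>w. f (fst w) * g (snd w))"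
    using f g by (intro PP.Fubini_integrable h) (auto simp: abs_mult)
  show "integrable ?P (\<lambda>x. f (subtuple x D) * g (subtuple x R))"
    using int integrable_distr_eq[OF m h] by (simp add: d)
  have "(\<integral>x. f (subtuple x D) * g (subtuple x R) \<partial>?P) = (\<integral>w. f (fst w) * g (snd w) \<partial>(?PD \<Otimes>\<^sub>M ?PR))"
    using integral_distr[OF m h] by (simp add: d)
  also have "\<dots> = (\<integral>y. (\<integral>z. f y * g z \<partial>?PR) \<partial>?PD)"
    using PP.integral_fst[of "\<lambda>y z. f y * g z"] int by (simp add: case_prod_beta')
  finally show "(\<integral>x. f (subtuple x D) * g (subtuple x R) \<partial>?P) =
      (\<integral>y. f y \<partial>?PD) * (\<integral>y. g y \<partial>?PR)"
    by simp
qed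

lemma PiM_density:
  assumes "product_sigma_finite M" and I: "finite I"
    and f: "\<And>i. f i \<in> borel_measurable (M i)" and fin: "\<And>i x. f i x < \<infinity>"
  shows "density (PiM I M) (\<lambda>x. \<Prod>i\<in>I. f i (x i)) = PiM I (\<lambda>i. density (M i) (f i))"
proof -
  interpret M: product_sigma_finite M by fact
  interpret D: product_sigma_finite "\<lambda>i. density (M i) (f i)"
    unfolding product_sigma_finite_def
    using sigma_finite_measure.sigma_finite_iff_density_finite[OF M.sigma_finite_measures f] fin
    by (auto simp: less_top)
  note [measurable] = f
  show ?thesis
  proof (rule D.PiM_eqI[OF I])
    fix A assume A: "\<And>i. i \<in> I \<Longrightarrow> A i \<in> sets (density (M i) (f i))"
    have "emeasure (density (PiM I M) (\<lambda>x. \<Prod>i\<in>I. f i (x i))) (PiE I A) =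
        (\<integral>\<^sup>+x. (\<Prod>i\<in>I. f i (x i)) * indicator (PiE I A) x \<partial>PiM I M)"
      using A I by (intro emeasure_density) (auto intro!: sets_PiM_I_finite)
    also have "\<dots> = (\<integral>\<^sup>+x. (\<Prod>i\<in>I. f i (x i) * indicator (A i) (x i)) \<partial>PiM I M)"
    proof (rule nn_integral_cong)
      fix x assume "x \<in> space (PiM I M)"
      then have "indicator (PiE I A) x = (\<Prod>i\<in>I. indicator (A i) (x i) :: ennreal)"
        using I by (auto simp: indicator_def prod_zero_iff space_PiM PiE_iff)
      then show "(\<Prod>i\<in>I. f i (x i)) * indicator (PiE I A) x = (\<Prod>i\<in>I. f i (x i) * indicator (A i) (x i))"
        by (simp add: prod.distrib)
    qed
    also have "\<dots> = (\<Prod>i\<in>I. \<integral>\<^sup>+x. f i x * indicator (A i) x \<partial>M i)"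
      using A by (intro M.product_nn_integral_prod I) auto
    also have "\<dots> = (\<Prod>i\<in>I. emeasure (density (M i) (f i)) (A i))"
      using A by (intro prod.cong) (auto simp: emeasure_density)
    finally show "emeasure (density (PiM I M) (\<lambda>x. \<Prod>i\<in>I. f i (x i))) (PiE I A) =
      (\<Prod>i\<in>I. emeasure (density (M i) (f i)) (A i))" .
  qed (simp add: sets_PiM_cong[of I I M "\<lambda>i. density (M i) (f i)"])
qed

section \<open>Lebesgue measure on tuples, balls and translations\<close>

abbreviation lborel_PiM :: "nat \<Rightarrow> (nat \<Rightarrow> 'a::euclidean_space) measure" where
  "lborel_PiM k \<equiv> PiM {..<k} (\<lambda>_. lborel)"

text \<open>Building the ball into the measure keeps indicators of \<open>B(a, t)\<close> out of all integrals over
  \<open>B(a, t)\<^sup>k\<close>, and makes those integrals factorise over subtuples without further ado.\<close>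

definition ball_measure :: "real \<Rightarrow> 'a::euclidean_space \<Rightarrow> 'a measure" where
  "ball_measure t a = density lborel (indicator (cball a t))"

abbreviation ball_PiM :: "real \<Rightarrow> 'a::euclidean_space \<Rightarrow> nat \<Rightarrow> (nat \<Rightarrow> 'a) measure" where
  "ball_PiM t a k \<equiv> PiM {..<k} (\<lambda>_. ball_measure t a)"

lemma borel_measurable_indicator_cball [measurable]:
  "indicator (cball (a :: 'a::euclidean_space) t) \<in> borel_measurable borel"
  by (rule borel_measurable_indicator) simp

lemma sets_ball_measure [simp, measurable_cong]: "sets (ball_measure t a) = sets borel"
  by (simp add: ball_measure_def)

lemma space_ball_measure [simp]: "space (ball_measure t a) = UNIV"
  by (simp add: ball_measure_def)

lemma sets_ball_PiM [measurable_cong]: "sets (ball_PiM t a k) = sets (lborel_PiM k)"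
  by (intro sets_PiM_cong) simp_all

lemma finite_measure_ball_measure: "finite_measure (ball_measure t a)"
proof
  have "emeasure (ball_measure t a) UNIV = emeasure lborel (cball a t)"
    unfolding ball_measure_def by (subst emeasure_density) (auto simp: nn_integral_indicator)
  then show "emeasure (ball_measure t a) (space (ball_measure t a)) \<noteq> \<infinity>"
    using emeasure_lborel_cball_finite[of a t] by simp
qed

lemma sigma_finite_ball_measure: "sigma_finite_measure (ball_measure t a)"
  by (rule finite_measure.axioms(1)[OF finite_measure_ball_measure])

lemma product_sigma_finite_lborel: "product_sigma_finite (\<lambda>_. lborel)"
  by (simp add: product_sigma_finite_def sigma_finite_lborel)

lemma sigma_finite_lborel_PiM: "sigma_finite_measure (lborel_PiM k)"
proof -
  interpret product_sigma_finite "\<lambda>_. lborel :: 'a measure" by (rule product_sigma_finite_lborel)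
  show ?thesis by (rule sigma_finite) simp
qed

lemma ball_PiM_eq_density:
  "ball_PiM t a k = density (lborel_PiM k) (\<lambda>x. \<Prod>j<k. indicator (cball a t) (x j))"
  unfolding ball_measure_def
  by (rule PiM_density[symmetric]) (auto simp: product_sigma_finite_lborel less_top indicator_def)

lemma measurable_add_tuple [measurable]:
  "(\<lambda>x. \<lambda>j\<in>{..<k}. a + x j) \<in> measurable (lborel_PiM k) (lborel_PiM k)"
  by (intro measurable_restrict) simp

lemma distr_translate_PiM:
  fixes a :: "'a::euclidean_space"
  assumes N: "sigma_finite_measure N" "sets N = sets borel"
    and N': "sigma_finite_measure N'" "sets N' = sets borel" and d: "distr N borel ((+) a) = N'"
  shows "distr (PiM {..<k} (\<lambda>_. N)) (lborel_PiM k) (\<lambda>x. \<lambda>j\<in>{..<k}. a + x j) = PiM {..<k} (\<lambda>_. N')"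
proof -
  interpret M: product_sigma_finite "\<lambda>_::nat. N"
    using N by (simp add: product_sigma_finite_def)
  interpret M': product_sigma_finite "\<lambda>_::nat. N'"
    using N' by (simp add: product_sigma_finite_def)
  note [measurable_cong] = N(2) N'(2)
  have spN: "space N = UNIV" using sets_eq_imp_space_eq[OF N(2)] by simp
  have m: "(\<lambda>x. \<lambda>j\<in>{..<k}. a + x j) \<in> measurable (PiM {..<k} (\<lambda>_. N)) (lborel_PiM k)"
    by (intro measurable_restrict) simp
  show ?thesis
  proof (rule M'.PiM_eqI)
    fix A assume A: "\<And>i. i \<in> {..<k} \<Longrightarrow> A i \<in> sets N'"
    then have A': "PiE {..<k} A \<in> sets (lborel_PiM k)"
      using N' by (intro sets_PiM_I_finite) auto
    have "(\<lambda>x. \<lambda>j\<in>{..<k}. a + x j) -` PiE {..<k} A \<inter> space (PiM {..<k} (\<lambda>_. N)) =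
        PiE {..<k} (\<lambda>j. (+) a -` A j)"
      by (auto simp: space_PiM spN PiE_iff)
    moreover have v: "(+) a -` A j \<in> sets N" if "j < k" for j
      using measurable_sets[of "(+) a" N N' "A j"] A[of j] that by (simp add: spN)
    ultimately have "emeasure (distr (PiM {..<k} (\<lambda>_. N)) (lborel_PiM k) (\<lambda>x. \<lambda>j\<in>{..<k}. a + x j)) (PiE {..<k} A) =
        (\<Prod>j<k. emeasure N ((+) a -` A j))"
      by (subst emeasure_distr[OF m A'], elim ssubst, intro M.emeasure_PiM) auto
    also have "\<dots> = (\<Prod>j<k. emeasure N' (A j))"
      using A N' by (intro prod.cong refl, subst d[symmetric], subst emeasure_distr) (auto simp: spN)
    finally show "emeasure (distr (PiM {..<k} (\<lambda>_. N)) (lborel_PiM k) (\<lambda>x. \<lambda>j\<in>{..<k}. a + x j)) (PiE {..<k} A) =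
        (\<Prod>j<k. emeasure N' (A j))" .
  qed (auto intro!: sets_PiM_cong simp: N' simp flip: N'(2))
qed

lemma distr_translate_lborel_PiM:
  "distr (lborel_PiM k) (lborel_PiM k) (\<lambda>x. \<lambda>j\<in>{..<k}. a + x j) = lborel_PiM k"
  by (rule distr_translate_PiM) (auto simp: sigma_finite_lborel lborel_distr_plus)

lemma distr_translate_ball_PiM:
  "distr (ball_PiM t 0 k) (lborel_PiM k) (\<lambda>x. \<lambda>j\<in>{..<k}. a + x j) = ball_PiM t a k"
proof (rule distr_translate_PiM)
  show "distr (ball_measure t 0) borel ((+) a) = ball_measure t a"
  proof (rule measure_eqI)
    fix A assume "A \<in> sets (distr (ball_measure t 0) borel ((+) a))"
    then have A[measurable]: "A \<in> sets borel" by simp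
    have "emeasure (distr (ball_measure t 0) borel ((+) a)) A =
        emeasure (ball_measure t 0) ((+) a -` A)"
      by (subst emeasure_distr) auto
    also have "\<dots> = (\<integral>\<^sup>+x. indicator (cball 0 t) x * indicator A (a + x) \<partial>lborel)"
      unfolding ball_measure_def
      by (subst emeasure_density) (auto simp: indicator_vimage intro!: measurable_sets_borel[OF _ A])
    also have "\<dots> = (\<integral>\<^sup>+x. indicator (cball a t) (a + x) * indicator A (a + x) \<partial>lborel)"
      by (intro nn_integral_cong) (auto simp: indicator_def dist_norm)
    also have "\<dots> = (\<integral>\<^sup>+x. indicator (cball a t) x * indicator A x \<partial>distr lborel borel ((+) a))"
      by (subst nn_integral_distr) auto
    also have "\<dots> = emeasure (ball_measure t a) A"
      unfolding ball_measure_def lborel_distr_plus by (subst emeasure_density) auto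
    finally show "emeasure (distr (ball_measure t 0) borel ((+) a)) A = emeasure (ball_measure t a) A" .
  qed simp
qed (auto simp: sigma_finite_ball_measure)

text \<open>For fixed \<open>a\<close> the shear is a translation of the \<open>k\<close> remaining coordinates.\<close>

lemma distr_shear_lborel_PiM:
  "distr (lborel \<Otimes>\<^sub>M lborel_PiM k) (lborel \<Otimes>\<^sub>M lborel_PiM k) (\<lambda>(a, x). (a, \<lambda>j\<in>{..<k}. a + x j)) =
    (lborel \<Otimes>\<^sub>M lborel_PiM k :: ('a::euclidean_space \<times> (nat \<Rightarrow> 'a)) measure)" (is "distr ?P ?P ?S = ?P")
proof (rule measure_eqI)
  interpret L: sigma_finite_measure "lborel_PiM k :: (nat \<Rightarrow> 'a) measure"
    by (rule sigma_finite_lborel_PiM)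
  have S[measurable]: "?S \<in> measurable ?P ?P"
    unfolding case_prod_beta by (intro measurable_Pair measurable_fst measurable_restrict) measurable
  fix A assume "A \<in> sets (distr ?P ?P ?S)"
  then have A[measurable]: "A \<in> sets ?P" by simp
  have i: "(\<lambda>w. indicator A w :: ennreal) \<in> borel_measurable ?P"
    by (rule borel_measurable_indicator[OF A])
  have tr: "(\<integral>\<^sup>+x. indicator A (a, \<lambda>j\<in>{..<k}. a + x j) \<partial>lborel_PiM k) =
      (\<integral>\<^sup>+x. indicator A (a, x) \<partial>lborel_PiM k)" for a
  proof -
    have "(\<lambda>x. indicator A (a, x) :: ennreal) \<in> borel_measurable (lborel_PiM k)"
      by (rule measurable_compose[OF measurable_Pair1' i]) simp
    then have "(\<integral>\<^sup>+x. indicator A (a, x) \<partial>distr (lborel_PiM k) (lborel_PiM k) (\<lambda>x. \<lambda>j\<in>{..<k}. a + x j)) =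
        (\<integral>\<^sup>+x. indicator A (a, \<lambda>j\<in>{..<k}. a + x j) \<partial>lborel_PiM k)"
      by (intro nn_integral_distr measurable_add_tuple) simp
    then show ?thesis by (simp only: distr_translate_lborel_PiM)
  qed
  have "emeasure (distr ?P ?P ?S) A = (\<integral>\<^sup>+w. indicator A w \<partial>distr ?P ?P ?S)"
    using A by simp
  also have "\<dots> = (\<integral>\<^sup>+w. indicator A (?S w) \<partial>?P)"
    using i by (intro nn_integral_distr S) simp
  also have "\<dots> = (\<integral>\<^sup>+a. \<integral>\<^sup>+x. indicator A (?S (a, x)) \<partial>lborel_PiM k \<partial>lborel)"
    by (rule L.nn_integral_fst[OF measurable_compose[OF S i], symmetric])
  also have "\<dots> = (\<integral>\<^sup>+a. \<integral>\<^sup>+x. indicator A (a, x) \<partial>lborel_PiM k \<partial>lborel)"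
    by (simp only: tr prod.case)
  also have "\<dots> = (\<integral>\<^sup>+w. indicator A w \<partial>?P)"
    by (rule L.nn_integral_fst[OF i])
  also have "\<dots> = emeasure ?P A"
    using A by simp
  finally show "emeasure (distr ?P ?P ?S) A = emeasure ?P A" .
qed simp

text \<open>Passes from almost all \<open>(k+1)\<close>-tuples to almost all pairs of a base point \<open>a\<close> and positions
  relative to \<open>a\<close>, the form in which the cumulant densities rooted at the origin are given.\<close>

lemma AE_lborel_PiM_Suc_shear:
  assumes "AE z in lborel_PiM (Suc k). Q z"
  shows "AE (a, x) in lborel \<Otimes>\<^sub>M lborel_PiM k. Q (case_nat a (\<lambda>j\<in>{..<k}. a + x j))"
proof -
  let ?P = "lborel \<Otimes>\<^sub>M lborel_PiM k :: ('a \<times> (nat \<Rightarrow> 'a)) measure"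
  have m: "(\<lambda>(a, x). case_nat a x) \<in> measurable ?P (lborel_PiM (Suc k))"
    unfolding case_prod_beta by measurable
  have S: "(\<lambda>(a, x). (a, \<lambda>j\<in>{..<k}. a + x j)) \<in> measurable ?P ?P"
    unfolding case_prod_beta by (intro measurable_Pair measurable_fst measurable_restrict) measurable
  have "AE z in distr ?P (lborel_PiM (Suc k)) (\<lambda>(a, x). case_nat a x). Q z"
    using assms by (simp only: distr_case_nat_PiM[OF product_sigma_finite_lborel])
  from AE_distrD[OF m this] have "AE w in distr ?P ?P (\<lambda>(a, x). (a, \<lambda>j\<in>{..<k}. a + x j)).
      Q (case w of (a, x) \<Rightarrow> case_nat a x)"
    unfolding distr_shear_lborel_PiM .
  from AE_distrD[OF S this] show ?thesis
    by (auto simp: case_prod_beta)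
qed

lemma AE_lborel_translate:
  assumes "AE b in lborel. Q (a + b :: 'a::euclidean_space)"
  shows "AE b in lborel. Q b"
proof -
  have "AE b in distr lborel borel ((+) (- a)). Q (a + b)"
    using assms by (simp only: lborel_distr_plus)
  from AE_distrD[OF _ this] show ?thesis by simp
qed

lemma AE_ball_PiM:
  assumes "AE x in lborel_PiM k. Q x"
  shows "AE x in ball_PiM t a k. Q x"
proof -
  have [measurable]: "(\<lambda>x. \<Prod>j<k. indicator (cball a t) (x j) :: ennreal) \<in> borel_measurable (lborel_PiM k)"
    by measurable
  show ?thesis
    unfolding ball_PiM_eq_density by (subst AE_density) (use assms in auto)
qed

section \<open>Locally finite measures as kernels\<close>

lemma sets_component [simp, measurable_cong]: "sets (component N i) = sets borel"
  by (simp add: component_def)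

lemma space_component [simp]: "space (component N i) = UNIV"
  by (simp add: component_def)

lemma emeasure_component_bounded:
  assumes "N \<in> space lf_measures" "B \<in> sets borel" "bounded B"
  shows "emeasure (component N i) B < \<infinity>"
  using assms by (auto simp: space_lf_measures locally_finite_measure_def)

lemma sigma_finite_component:
  assumes "N \<in> space lf_measures"
  shows "sigma_finite_measure (component N i)"
proof
  show "\<exists>A. countable A \<and> A \<subseteq> sets (component N i) \<and> \<Union>A = space (component N i) \<and>
      (\<forall>a\<in>A. emeasure (component N i) a \<noteq> \<infinity>)"
  proof (intro exI conjI)
    show "countable (range (\<lambda>n. cball (0 :: 'a) (real n)))" by simp
    show "\<Union>(range (\<lambda>n. cball (0 :: 'a) (real n))) = space (component N i)"
      by (auto intro: real_arch_simple)
    show "\<forall>a\<in>range (\<lambda>n. cball (0 :: 'a) (real n)). emeasure (component N i) a \<noteq> \<infinity>"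
      using emeasure_component_bounded[OF assms, of "cball 0 _" i] by (auto simp: less_top)
  qed auto
qed

lemma product_sigma_finite_component:
  assumes "N \<in> space lf_measures"
  shows "product_sigma_finite (\<lambda>j. component N (l j))"
  using sigma_finite_component[OF assms] by (simp add: product_sigma_finite_def)

text \<open>Locally finite measures are not subprobabilities, so integration against them is reduced to
  subprobability kernels: restrict to the ball of radius \<open>n\<close>, normalise by its mass plus one
  (which keeps the divisor positive), and take the supremum over \<open>n\<close>.\<close>

lemma measurable_nn_integral_component:
  fixes f :: "'s \<Rightarrow> 'a::euclidean_space \<Rightarrow> ennreal"
  assumes K: "K \<in> measurable S lf_measures"
    and f: "(\<lambda>(s, x). f s x) \<in> borel_measurable (S \<Otimes>\<^sub>M borel)"
  shows "(\<lambda>s. \<integral>\<^sup>+x. f s x \<partial>component (K s) i) \<in> borel_measurable S"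
proof -
  define B where "B n = cball (0 :: 'a) (real n)" for n
  define c where "c n s = emeasure (component (K s) i) (B n) + 1" for n s
  define L where "L n s = density (component (K s) i) (\<lambda>x. indicator (B n) x / c n s)" for n s
  have Ks: "K s \<in> space lf_measures" if "s \<in> space S" for s
    using K that by (rule measurable_space)
  have B[measurable]: "B n \<in> sets borel" for n by (simp add: B_def)
  have em: "(\<lambda>s. emeasure (component (K s) i) A) \<in> borel_measurable S"
    if "A \<in> sets borel" "bounded A" for A
    by (rule measurable_compose[OF K measurable_emeasure_component[OF that]])
  have c[measurable]: "c n \<in> borel_measurable S" for n
    unfolding c_def by (intro borel_measurable_add em borel_measurable_const) (auto simp: B_def)
  have c0: "c n s \<noteq> 0" for n s by (simp add: c_def)
  have c1: "c n s \<noteq> \<infinity>" if "s \<in> space S" for n s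
    using emeasure_component_bounded[OF Ks[OF that], of "B n" i] by (simp add: c_def B_def less_top[symmetric])
  have L_eq: "emeasure (L n s) A = emeasure (component (K s) i) (A \<inter> B n) / c n s"
    if "A \<in> sets borel" for n s A
  proof -
    have "emeasure (L n s) A = (\<integral>\<^sup>+x. indicator (A \<inter> B n) x / c n s \<partial>component (K s) i)"
      unfolding L_def using that
      by (subst emeasure_density) (auto simp: indicator_def intro!: nn_integral_cong)
    also have "\<dots> = emeasure (component (K s) i) (A \<inter> B n) / c n s"
      using that by (subst nn_integral_divide) auto
    finally show ?thesis .
  qed
  have L: "L n \<in> measurable S (subprob_algebra borel)" for n
  proof (rule measurable_subprob_algebra)
    fix s assume s: "s \<in> space S"
    show "sets (L n s) = sets borel" by (simp add: L_def)
    show "subprob_space (L n s)"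
    proof (rule subprob_spaceI)
      have "emeasure (L n s) UNIV = emeasure (component (K s) i) (B n) / c n s"
        by (simp add: L_eq)
      also have "\<dots> \<le> c n s / c n s"
        by (intro divide_right_mono_ennreal) (simp add: c_def)
      also have "\<dots> = 1"
        using c0 c1[OF s] by (simp add: ennreal_divide_self less_top)
      finally show "emeasure (L n s) (space (L n s)) \<le> 1" by (simp add: L_def)
    qed (simp add: L_def)
  next
    fix A :: "'a set" assume A: "A \<in> sets borel"
    have "(\<lambda>s. emeasure (component (K s) i) (A \<inter> B n)) \<in> borel_measurable S"
      using A by (intro em) (auto simp: B_def intro: bounded_subset[OF bounded_cball])
    then show "(\<lambda>s. emeasure (L n s) A) \<in> borel_measurable S"
      by (simp add: L_eq[OF A])
  qed
  have fs: "f s \<in> borel_measurable borel" if "s \<in> space S" for s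
    using measurable_compose[OF measurable_Pair1'[OF that] f] by simp
  have "(\<integral>\<^sup>+x. f s x \<partial>component (K s) i) = (SUP n. c n s * (\<integral>\<^sup>+x. f s x \<partial>L n s))"
    if s: "s \<in> space S" for s
  proof -
    note [measurable] = fs[OF s]
    have "(\<integral>\<^sup>+x. f s x \<partial>component (K s) i) = (\<integral>\<^sup>+x. (SUP n. f s x * indicator (B n) x) \<partial>component (K s) i)"
    proof (rule nn_integral_cong)
      fix x :: 'a
      obtain n where "norm x \<le> real n" using real_arch_simple by blast
      then have "f s x = f s x * indicator (B n) x" by (simp add: B_def)
      then have "f s x \<le> (SUP n. f s x * indicator (B n) x)"
        by (metis SUP_upper UNIV_I)
      moreover have "(SUP n. f s x * indicator (B n) x) \<le> f s x"
        by (intro SUP_least) (auto simp: indicator_def)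
      ultimately show "f s x = (SUP n. f s x * indicator (B n) x)" by (rule antisym)
    qed
    also have "\<dots> = (SUP n. \<integral>\<^sup>+x. f s x * indicator (B n) x \<partial>component (K s) i)"
    proof (rule nn_integral_monotone_convergence_SUP)
      show "incseq (\<lambda>n x. f s x * indicator (B n) x)"
        by (auto simp: incseq_def le_fun_def indicator_def B_def)
    qed measurable
    also have "\<dots> = (SUP n. c n s * (\<integral>\<^sup>+x. f s x \<partial>L n s))"
    proof (rule SUP_cong[OF refl])
      fix n
      have "c n s * (\<integral>\<^sup>+x. f s x \<partial>L n s) =
          c n s * (\<integral>\<^sup>+x. indicator (B n) x / c n s * f s x \<partial>component (K s) i)"
        unfolding L_def by (subst nn_integral_density) auto
      also have "\<dots> = (\<integral>\<^sup>+x. c n s * (indicator (B n) x / c n s * f s x) \<partial>component (K s) i)"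
        by (rule nn_integral_cmult[symmetric]) measurable
      also have "\<dots> = (\<integral>\<^sup>+x. f s x * indicator (B n) x \<partial>component (K s) i)"
      proof (rule nn_integral_cong)
        fix x
        have "c n s * (1 / c n s) = 1"
          using c0 c1[OF s] by (simp add: ennreal_times_divide ennreal_divide_self less_top)
        then show "c n s * (indicator (B n) x / c n s * f s x) = f s x * indicator (B n) x"
          by (simp add: indicator_def mult.assoc[symmetric])
      qed
      finally show "(\<integral>\<^sup>+x. f s x * indicator (B n) x \<partial>component (K s) i) = c n s * (\<integral>\<^sup>+x. f s x \<partial>L n s)" ..
    qed
    finally show ?thesis .
  qed
  moreover have "(\<lambda>s. SUP n. c n s * (\<integral>\<^sup>+x. f s x \<partial>L n s)) \<in> borel_measurable S"
    by (intro borel_measurable_SUP borel_measurable_times_ennreal c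
        nn_integral_measurable_subprob_algebra2[OF f L]) simp
  ultimately show ?thesis
    by (subst measurable_cong) auto
qed

lemma sets_PiM_component [measurable_cong]:
  "sets (PiM {..<k} (\<lambda>j. component N (l j))) = sets (PiM {..<k} (\<lambda>_. borel))"
  by (intro sets_PiM_cong) simp_all

text \<open>Integrates out the last coordinate first: its integral is a function of the parameter and the
  remaining tuple, so the induction never changes the parameter space.\<close>

lemma measurable_nn_integral_PiM_component:
  fixes f :: "'s \<Rightarrow> (nat \<Rightarrow> 'a::euclidean_space) \<Rightarrow> ennreal"
  assumes K: "K \<in> measurable S lf_measures"
    and f: "(\<lambda>(s, x). f s x) \<in> borel_measurable (S \<Otimes>\<^sub>M PiM {..<k} (\<lambda>_. borel))"
  shows "(\<lambda>s. \<integral>\<^sup>+x. f s x \<partial>PiM {..<k} (\<lambda>j. component (K s) (l j))) \<in> borel_measurable S"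
  using f
proof (induction k arbitrary: f)
  case 0
  have "(\<lambda>s. f s (\<lambda>_. undefined)) \<in> borel_measurable S"
    using measurable_compose[OF _ 0, of "\<lambda>s. (s, \<lambda>_. undefined)" S] by (simp add: space_PiM)
  then show ?case by (simp add: PiM_empty nn_integral_count_space_finite)
next
  case (Suc k)
  have Ks: "K s \<in> space lf_measures" if "s \<in> space S" for s
    using K that by (rule measurable_space)
  have ins: "{..<Suc k} = insert k {..<k}" by auto
  have upd: "(\<lambda>(sx, y). (fst sx, (snd sx)(k := y))) \<in>
      measurable ((S \<Otimes>\<^sub>M PiM {..<k} (\<lambda>_. borel :: 'a measure)) \<Otimes>\<^sub>M borel)
        (S \<Otimes>\<^sub>M PiM {..<Suc k} (\<lambda>_. borel))"
    unfolding case_prod_beta ins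
    by (intro measurable_Pair measurable_fun_upd[where J = "{..<k}"]) auto
  have "(\<lambda>sx. \<integral>\<^sup>+y. f (fst sx) ((snd sx)(k := y)) \<partial>component (K (fst sx)) (l k))
      \<in> borel_measurable (S \<Otimes>\<^sub>M PiM {..<k} (\<lambda>_. borel))"
    by (rule measurable_nn_integral_component[OF measurable_compose[OF measurable_fst K]])
      (use measurable_compose[OF upd Suc.prems] in \<open>simp add: case_prod_beta\<close>)
  then have "(\<lambda>s. \<integral>\<^sup>+x. (\<integral>\<^sup>+y. f s (x(k := y)) \<partial>component (K s) (l k)) \<partial>PiM {..<k} (\<lambda>j. component (K s) (l j)))
      \<in> borel_measurable S"
    by (intro Suc.IH) (simp only: case_prod_beta)
  moreover have "(\<integral>\<^sup>+x. f s x \<partial>PiM {..<Suc k} (\<lambda>j. component (K s) (l j))) =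
      (\<integral>\<^sup>+x. (\<integral>\<^sup>+y. f s (x(k := y)) \<partial>component (K s) (l k)) \<partial>PiM {..<k} (\<lambda>j. component (K s) (l j)))"
    if s: "s \<in> space S" for s
  proof -
    interpret C: product_sigma_finite "\<lambda>j. component (K s) (l j)"
      by (rule product_sigma_finite_component[OF Ks[OF s]])
    have "f s \<in> borel_measurable (PiM {..<Suc k} (\<lambda>_. borel))"
      using measurable_compose[OF measurable_Pair1'[OF s] Suc.prems] by simp
    then have "f s \<in> borel_measurable (PiM (insert k {..<k}) (\<lambda>j. component (K s) (l j)))"
      unfolding ins[symmetric] by (simp cong: measurable_cong_sets add: sets_PiM_component)
    then show ?thesis
      unfolding ins by (intro C.product_nn_integral_insert) auto
  qed
  ultimately show ?case
    by (subst measurable_cong) auto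
qed

text \<open>The mixture gives \<open>A\<close> the integral over \<open>\<omega>\<close> of the mass \<open>\<kappa> \<omega>\<close> gives to \<open>A\<close>. The measures \<open>\<kappa> \<omega>\<close> may be
  infinite, as the powers of a random measure are; countable additivity is monotone convergence.\<close>

lemma mixture_measure_exists:
  assumes sets: "\<And>\<omega>. \<omega> \<in> space M \<Longrightarrow> sets (\<kappa> \<omega>) = sets N"
    and meas: "\<And>A. A \<in> sets N \<Longrightarrow> (\<lambda>\<omega>. emeasure (\<kappa> \<omega>) A) \<in> borel_measurable M"
  obtains Q where "sets Q = sets N"
    "\<And>f. f \<in> borel_measurable N \<Longrightarrow> (\<integral>\<^sup>+x. f x \<partial>Q) = (\<integral>\<^sup>+\<omega>. (\<integral>\<^sup>+x. f x \<partial>\<kappa> \<omega>) \<partial>M)"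
proof
  define Q where "Q = measure_of (space N) (sets N) (\<lambda>A. \<integral>\<^sup>+\<omega>. emeasure (\<kappa> \<omega>) A \<partial>M)"
  show sQ: "sets Q = sets N" by (simp add: Q_def)
  have eQ: "emeasure Q A = (\<integral>\<^sup>+\<omega>. emeasure (\<kappa> \<omega>) A \<partial>M)" if A: "A \<in> sets N" for A
    unfolding Q_def
  proof (rule emeasure_measure_of_sigma)
    show "sigma_algebra (space N) (sets N)" by (rule sets.sigma_algebra_axioms)
    show "positive (sets N) (\<lambda>A. \<integral>\<^sup>+\<omega>. emeasure (\<kappa> \<omega>) A \<partial>M)" by (simp add: positive_def)
    show "countably_additive (sets N) (\<lambda>A. \<integral>\<^sup>+\<omega>. emeasure (\<kappa> \<omega>) A \<partial>M)"
    proof (rule countably_additiveI)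
      fix A :: "nat \<Rightarrow> _" assume A: "range A \<subseteq> sets N" "disjoint_family A" "\<Union>(range A) \<in> sets N"
      have "(\<Sum>n. \<integral>\<^sup>+\<omega>. emeasure (\<kappa> \<omega>) (A n) \<partial>M) = (\<integral>\<^sup>+\<omega>. (\<Sum>n. emeasure (\<kappa> \<omega>) (A n)) \<partial>M)"
        using A meas by (intro nn_integral_suminf[symmetric]) auto
      also have "\<dots> = (\<integral>\<^sup>+\<omega>. emeasure (\<kappa> \<omega>) (\<Union>(range A)) \<partial>M)"
        using A sets by (intro nn_integral_cong suminf_emeasure) auto
      finally show "(\<Sum>n. \<integral>\<^sup>+\<omega>. emeasure (\<kappa> \<omega>) (A n) \<partial>M) = (\<integral>\<^sup>+\<omega>. emeasure (\<kappa> \<omega>) (\<Union>(range A)) \<partial>M)" .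
    qed
  qed (rule A)
  have sp: "space Q = space N" by (rule sets_eq_imp_space_eq[OF sQ])
  have sp\<kappa>: "space (\<kappa> \<omega>) = space N" if "\<omega> \<in> space M" for \<omega>
    using sets_eq_imp_space_eq[OF sets[OF that]] .
  have m\<kappa>: "f \<in> borel_measurable (\<kappa> \<omega>)" if "f \<in> borel_measurable N" "\<omega> \<in> space M"
    for f :: "_ \<Rightarrow> ennreal" and \<omega>
    using that by (simp add: measurable_cong_sets[OF sets refl])
  have mQ: "f \<in> borel_measurable Q" if "f \<in> borel_measurable N" for f :: "_ \<Rightarrow> ennreal"
    using that by (simp add: measurable_cong_sets[OF sQ refl])
  fix f :: "_ \<Rightarrow> ennreal" assume "f \<in> borel_measurable N"
  then have "(\<lambda>\<omega>. \<integral>\<^sup>+x. f x \<partial>\<kappa> \<omega>) \<in> borel_measurable M \<and>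
      (\<integral>\<^sup>+x. f x \<partial>Q) = (\<integral>\<^sup>+\<omega>. (\<integral>\<^sup>+x. f x \<partial>\<kappa> \<omega>) \<partial>M)"
  proof (induction rule: borel_measurable_induct)
    case (cong f g)
    have "(\<integral>\<^sup>+x. f x \<partial>\<kappa> \<omega>) = (\<integral>\<^sup>+x. g x \<partial>\<kappa> \<omega>)" if "\<omega> \<in> space M" for \<omega>
      using cong(3) sp\<kappa>[OF that] by (intro nn_integral_cong) auto
    moreover have "(\<integral>\<^sup>+x. f x \<partial>Q) = (\<integral>\<^sup>+x. g x \<partial>Q)"
      using cong(3) sp by (intro nn_integral_cong) auto
    ultimately show ?case
      using cong(4) by (simp cong: measurable_cong nn_integral_cong)
  next
    case (set A)
    have "(\<integral>\<^sup>+x. indicator A x \<partial>\<kappa> \<omega>) = emeasure (\<kappa> \<omega>) A" if "\<omega> \<in> space M" for \<omega>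
      using set sets[OF that] by simp
    then show ?case
      using set meas[OF set] eQ[OF set] sQ by (simp cong: measurable_cong nn_integral_cong)
  next
    case (mult u c)
    have "(\<integral>\<^sup>+x. c * u x \<partial>\<kappa> \<omega>) = c * (\<integral>\<^sup>+x. u x \<partial>\<kappa> \<omega>)" if "\<omega> \<in> space M" for \<omega>
      by (rule nn_integral_cmult[OF m\<kappa>[OF mult(2) that]])
    moreover have "(\<lambda>\<omega>. c * (\<integral>\<^sup>+x. u x \<partial>\<kappa> \<omega>)) \<in> borel_measurable M"
      by (intro borel_measurable_times_ennreal borel_measurable_const conjunct1[OF mult(4)])
    ultimately show ?case
      using mult nn_integral_cmult[OF mQ[OF mult(2)], of c]
      by (simp add: nn_integral_cmult cong: measurable_cong nn_integral_cong)
  next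
    case (add u v)
    have "(\<integral>\<^sup>+x. v x + u x \<partial>\<kappa> \<omega>) = (\<integral>\<^sup>+x. v x \<partial>\<kappa> \<omega>) + (\<integral>\<^sup>+x. u x \<partial>\<kappa> \<omega>)" if "\<omega> \<in> space M" for \<omega>
      by (rule nn_integral_add[OF m\<kappa>[OF \<open>v \<in> borel_measurable N\<close> that] m\<kappa>[OF \<open>u \<in> borel_measurable N\<close> that]])
    moreover have "(\<lambda>\<omega>. (\<integral>\<^sup>+x. v x \<partial>\<kappa> \<omega>) + (\<integral>\<^sup>+x. u x \<partial>\<kappa> \<omega>)) \<in> borel_measurable M"
      using add by (intro borel_measurable_add) auto
    ultimately show ?case
      using add nn_integral_add[OF mQ[OF \<open>v \<in> borel_measurable N\<close>] mQ[OF \<open>u \<in> borel_measurable N\<close>]]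
      by (simp add: nn_integral_add cong: measurable_cong nn_integral_cong)
  next
    case (seq U)
    have "(\<integral>\<^sup>+x. (SUP n. U n x) \<partial>\<kappa> \<omega>) = (SUP n. \<integral>\<^sup>+x. U n x \<partial>\<kappa> \<omega>)" if "\<omega> \<in> space M" for \<omega>
      by (rule nn_integral_monotone_convergence_SUP[OF seq(3) m\<kappa>[OF seq(1) that]])
    moreover have "(\<integral>\<^sup>+x. (SUP n. U n x) \<partial>Q) = (SUP n. \<integral>\<^sup>+x. U n x \<partial>Q)"
      by (rule nn_integral_monotone_convergence_SUP[OF seq(3) mQ[OF seq(1)]])
    moreover have "(\<integral>\<^sup>+\<omega>. (SUP n. \<integral>\<^sup>+x. U n x \<partial>\<kappa> \<omega>) \<partial>M) = (SUP n. \<integral>\<^sup>+\<omega>. (\<integral>\<^sup>+x. U n x \<partial>\<kappa> \<omega>) \<partial>M)"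
      using seq(3,5) by (intro nn_integral_monotone_convergence_SUP)
        (auto simp: incseq_def le_fun_def intro!: nn_integral_mono)
    moreover have "(SUP n. U n) = (\<lambda>x. SUP n. U n x)"
      by (simp add: fun_eq_iff image_comp)
    moreover have "(\<lambda>\<omega>. SUP n. \<integral>\<^sup>+x. U n x \<partial>\<kappa> \<omega>) \<in> borel_measurable M"
      using seq(5) by (intro borel_measurable_SUP) auto
    ultimately show ?case
      using seq(4,5) by (simp cong: measurable_cong nn_integral_cong)
  qed
  then show "(\<integral>\<^sup>+x. f x \<partial>Q) = (\<integral>\<^sup>+\<omega>. (\<integral>\<^sup>+x. f x \<partial>\<kappa> \<omega>) \<partial>M)" ..
qed

section \<open>Tuples of labelled points\<close>

text \<open>Attaches the labels \<open>l\<close> to a tuple of points; integrals over tuples of labelled points are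
  thereby split into integrals over \<open>(\<real>\<^sup>d)\<^sup>k\<close>, one for each choice of labels.\<close>

definition labelled :: "nat \<Rightarrow> (nat \<Rightarrow> label) \<Rightarrow> (nat \<Rightarrow> 'a) \<Rightarrow> nat \<Rightarrow> 'a \<times> label" where
  "labelled k l x = (\<lambda>j\<in>{..<k}. (x j, l j))"

abbreviation ref_PiM :: "nat \<Rightarrow> (nat \<Rightarrow> 'a::euclidean_space \<times> label) measure" where
  "ref_PiM k \<equiv> PiM {..<k} (\<lambda>_. ref_measure)"

lemma space_ref_measure [simp]: "space ref_measure = UNIV"
  by (simp add: ref_measure_def space_pair_measure)

lemma measurable_Pair_ref_measure [measurable]: "(\<lambda>x. (x, i)) \<in> measurable borel ref_measure"
proof -
  have "(\<lambda>x. (x, i)) \<in> measurable borel (borel \<Otimes>\<^sub>M count_space UNIV)"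
    by measurable
  then show ?thesis
    by (simp add: measurable_cong_sets[OF refl sets_ref_measure])
qed

lemma measurable_labelled [measurable]: "labelled k l \<in> measurable (lborel_PiM k) (ref_PiM k)"
proof -
  have "(\<lambda>x. (x j, l j)) \<in> measurable (lborel_PiM k) ref_measure" if "j \<in> {..<k}" for j
    by (rule measurable_compose[OF measurable_component_singleton[OF that]]) simp
  then show ?thesis
    unfolding labelled_def[abs_def] by (intro measurable_restrict)
qed

lemma sigma_finite_ref_measure: "sigma_finite_measure (ref_measure :: ('a::euclidean_space \<times> label) measure)"
proof -
  interpret C: sigma_finite_measure "count_space (UNIV :: label set)"
    by (rule sigma_finite_measure_count_space_countable) (simp add: countable_finite)
  interpret pair_sigma_finite "lborel :: 'a measure" "count_space (UNIV :: label set)" ..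
  show ?thesis
    unfolding ref_measure_def by (rule sigma_finite_measure_axioms)
qed

lemma label_set_in_sets_ref_measure [measurable]: "UNIV \<times> {i} \<in> sets ref_measure"
  unfolding sets_ref_measure by (intro pair_measureI) auto

lemma emeasure_ref_measure_label:
  assumes A: "A \<in> sets ref_measure"
  shows "emeasure (density ref_measure (indicator (UNIV \<times> {i}))) A = emeasure lborel ((\<lambda>x. (x, i)) -` A)"
proof -
  interpret C: sigma_finite_measure "count_space (UNIV :: label set)"
    by (rule sigma_finite_measure_count_space_countable) (simp add: countable_finite)
  have v: "(\<lambda>x. (x, i)) -` A \<in> sets borel"
    using measurable_sets[OF measurable_Pair_ref_measure A] by simp
  have "emeasure (density ref_measure (indicator (UNIV \<times> {i}))) A = emeasure ref_measure ((UNIV \<times> {i}) \<inter> A)"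
    using A by (subst emeasure_density)
      (auto simp flip: indicator_inter_arith intro!: borel_measurable_indicator)
  also have "(UNIV \<times> {i}) \<inter> A = ((\<lambda>x. (x, i)) -` A) \<times> {i}" by auto
  also have "emeasure ref_measure \<dots> = emeasure lborel ((\<lambda>x. (x, i)) -` A) * emeasure (count_space UNIV) {i}"
    unfolding ref_measure_def by (rule C.emeasure_pair_measure_Times) (use v in auto)
  finally show ?thesis by simp
qed

text \<open>Attaching fixed labels embeds \<open>k\<close>-fold Lebesgue measure as the part of the \<open>k\<close>-fold reference
  measure that has these labels: both measures are the product of the one-point embeddings.\<close>

lemma distr_labelled:
  "distr (lborel_PiM k) (ref_PiM k) (labelled k l) =
    density (ref_PiM k) (\<lambda>z. \<Prod>j<k. indicator (UNIV \<times> {l j}) (z j))"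
proof -
  let ?N = "\<lambda>j. density ref_measure (indicator (UNIV \<times> {l j})) :: ('a \<times> label) measure"
  interpret L: product_sigma_finite "\<lambda>_::nat. lborel :: 'a measure"
    by (rule product_sigma_finite_lborel)
  interpret R: product_sigma_finite "\<lambda>_::nat. ref_measure :: ('a \<times> label) measure"
    by (simp add: product_sigma_finite_def sigma_finite_ref_measure)
  have m: "indicator (UNIV \<times> {i}) \<in> borel_measurable (ref_measure :: ('a \<times> label) measure)" for i
    by (rule borel_measurable_indicator) simp
  interpret N: product_sigma_finite ?N
    unfolding product_sigma_finite_def
    using sigma_finite_measure.sigma_finite_iff_density_finite[OF sigma_finite_ref_measure m]
    by (auto simp: indicator_def)
  have "distr (lborel_PiM k) (ref_PiM k) (labelled k l) = PiM {..<k} ?N"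
  proof (rule N.PiM_eqI)
    fix A assume A: "\<And>i. i \<in> {..<k} \<Longrightarrow> A i \<in> sets (?N i)"
    have "labelled k l -` PiE {..<k} A \<inter> space (lborel_PiM k) = PiE {..<k} (\<lambda>j. (\<lambda>x. (x, l j)) -` A j)"
      by (auto simp: labelled_def space_PiM PiE_iff)
    moreover have v: "(\<lambda>x. (x, l j)) -` A j \<in> sets borel" if "j < k" for j
      using measurable_sets[OF measurable_Pair_ref_measure, of "A j" "l j"] A[of j] that by simp
    ultimately have "emeasure (distr (lborel_PiM k) (ref_PiM k) (labelled k l)) (PiE {..<k} A) =
        emeasure (lborel_PiM k) (PiE {..<k} (\<lambda>j. (\<lambda>x. (x, l j)) -` A j))"
      using A by (subst emeasure_distr) (auto intro!: sets_PiM_I_finite)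
    also have "\<dots> = (\<Prod>j<k. emeasure lborel ((\<lambda>x. (x, l j)) -` A j))"
      by (intro L.emeasure_PiM) (use v in auto)
    also have "\<dots> = (\<Prod>j<k. emeasure (?N j) (A j))"
      using A by (intro prod.cong refl emeasure_ref_measure_label[symmetric]) auto
    finally show "emeasure (distr (lborel_PiM k) (ref_PiM k) (labelled k l)) (PiE {..<k} A) =
      (\<Prod>j<k. emeasure (?N j) (A j))" .
  qed (simp_all add: sets_PiM_cong[of "{..<k}" "{..<k}" ?N "\<lambda>_. ref_measure"])
  also have "\<dots> = density (ref_PiM k) (\<lambda>z. \<Prod>j<k. indicator (UNIV \<times> {l j}) (z j))"
    by (rule PiM_density[symmetric]) (auto simp: R.product_sigma_finite_axioms m indicator_def)
  finally show ?thesis .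
qed

lemma nn_integral_labelled:
  assumes f: "f \<in> borel_measurable (ref_PiM k)"
  shows "(\<integral>\<^sup>+x. f (labelled k l x) \<partial>lborel_PiM k) =
    (\<integral>\<^sup>+z. (\<Prod>j<k. indicator (UNIV \<times> {l j}) (z j)) * f z \<partial>ref_PiM k)"
proof -
  have m: "(\<lambda>z. \<Prod>j<k. indicator (UNIV \<times> {l j}) (z j) :: ennreal) \<in> borel_measurable (ref_PiM k)"
    by (intro borel_measurable_prod_ennreal
        measurable_compose[OF measurable_component_singleton borel_measurable_indicator]) auto
  have "(\<integral>\<^sup>+x. f (labelled k l x) \<partial>lborel_PiM k) = (\<integral>\<^sup>+z. f z \<partial>distr (lborel_PiM k) (ref_PiM k) (labelled k l))"
    using f by (intro nn_integral_distr[symmetric]) auto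
  then show ?thesis
    unfolding distr_labelled using f m by (simp add: nn_integral_density)
qed

lemma subtuple_labelled:
  assumes "D \<subseteq> {..<k}"
  shows "subtuple (labelled k (\<lambda>_. i) x) D = labelled (card D) (\<lambda>_. i) (subtuple x D)"
proof
  fix j
  have "finite D" using assms finite_subset by blast
  then have "sorted_list_of_set D ! j \<in> {..<k}" if "j < card D"
    using enum_bij[of D] that assms by (auto simp: bij_betw_def)
  then show "subtuple (labelled k (\<lambda>_. i) x) D j = labelled (card D) (\<lambda>_. i) (subtuple x D) j"
    by (auto simp: subtuple_def labelled_def)
qed

section \<open>Moment series of the Laplace transform\<close>

text \<open>Absolute convergence of the alternating moment series says that \<open>exp Y\<close> is integrable, so the
  exponential series may be integrated term by term.\<close>

lemma integral_exp_neg_eq_moment_series: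
  fixes Y :: "'s \<Rightarrow> ennreal"
  assumes Y: "Y \<in> borel_measurable Q" and fin: "\<And>\<omega>. \<omega> \<in> space Q \<Longrightarrow> Y \<omega> < \<infinity>"
    and m: "\<And>k. (\<integral>\<^sup>+\<omega>. Y \<omega> ^ k \<partial>Q) = ennreal (m k)" and m0: "\<And>k. 0 \<le> m k"
    and s: "summable (\<lambda>k. \<bar>(- 1) ^ k / fact k * m k\<bar>)"
  shows "(\<integral>\<omega>. exp (- enn2real (Y \<omega>)) \<partial>Q) = (\<Sum>k. (- 1) ^ k / fact k * m k)"
proof -
  define y where "y \<omega> = enn2real (Y \<omega>)" for \<omega>
  have y[measurable]: "y \<in> borel_measurable Q"
    using Y unfolding y_def by measurable
  have y0: "0 \<le> y \<omega>" for \<omega> by (simp add: y_def)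
  have nn: "(\<integral>\<^sup>+\<omega>. ennreal (y \<omega> ^ k) \<partial>Q) = ennreal (m k)" for k
    unfolding m[symmetric] y_def
  proof (rule nn_integral_cong)
    fix \<omega> assume "\<omega> \<in> space Q"
    then have "ennreal (enn2real (Y \<omega>)) = Y \<omega>"
      using fin by (intro ennreal_enn2real) simp
    then show "ennreal (enn2real (Y \<omega>) ^ k) = Y \<omega> ^ k"
      by (simp add: ennreal_power[symmetric])
  qed
  have int: "integrable Q (\<lambda>\<omega>. y \<omega> ^ k)" for k
    by (rule integrableI_nonneg) (auto simp: nn y0)
  have val: "(\<integral>\<omega>. y \<omega> ^ k \<partial>Q) = m k" for k
    by (rule integral_eq_nn_integral[THEN trans]) (auto simp: nn y0 m0)
  have "exp (- y \<omega>) = (\<Sum>k. (- 1) ^ k / fact k * y \<omega> ^ k)" for \<omega>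
    unfolding exp_def by (intro suminf_cong) (simp add: power_minus[of "y \<omega>"] field_simps)
  then have "(\<integral>\<omega>. exp (- y \<omega>) \<partial>Q) = (\<integral>\<omega>. (\<Sum>k. (- 1) ^ k / fact k * y \<omega> ^ k) \<partial>Q)"
    by simp
  also have "\<dots> = (\<Sum>k. \<integral>\<omega>. (- 1) ^ k / fact k * y \<omega> ^ k \<partial>Q)"
  proof (rule integral_suminf)
    show "integrable Q (\<lambda>\<omega>. (- 1) ^ k / fact k * y \<omega> ^ k)" for k
      using int by simp
    show "AE \<omega> in Q. summable (\<lambda>k. norm ((- 1) ^ k / fact k * y \<omega> ^ k))"
    proof (rule AE_I2)
      fix \<omega>
      show "summable (\<lambda>k. norm ((- 1) ^ k / fact k * y \<omega> ^ k))"
        using summable_norm_exp[of "y \<omega>"] by (simp add: abs_mult power_abs divide_inverse mult.commute)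
    qed
    show "summable (\<lambda>k. \<integral>\<omega>. norm ((- 1) ^ k / fact k * y \<omega> ^ k) \<partial>Q)"
      using s by (simp add: abs_mult power_abs val y0 m0 flip: power_abs)
  qed
  also have "\<dots> = (\<Sum>k. (- 1) ^ k / fact k * m k)"
    by (simp add: val)
  finally show ?thesis by (simp add: y_def)
qed

section \<open>Moments of the ball mass\<close>

locale reweighted_moment_stationary =
  fixes M :: "'w measure"
    and \<Psi> :: "'w \<Rightarrow> ('a::euclidean_space \<times> label) measure"
    and \<mu> :: "nat \<Rightarrow> (nat \<Rightarrow> 'a \<times> label) measure"
    and p :: "nat \<Rightarrow> (nat \<Rightarrow> 'a \<times> label) \<Rightarrow> real"
  assumes random_measure: "random_measure M \<Psi>"
    and stationary: "coverage_reweighted_moment_stationary M \<Psi> \<mu> p"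
begin

lemma prob_space_M: "prob_space M"
  and measurable_\<Psi>: "\<Psi> \<in> measurable M lf_measures"
  using random_measure by (auto simp: random_measure_def)

lemma moment_measure: "k \<ge> 1 \<Longrightarrow> moment_measure M \<Psi> k (\<mu> k)"
  and coverage_function: "k \<ge> 1 \<Longrightarrow> coverage_function k (\<mu> k) (p k)"
  using stationary by (auto simp: coverage_reweighted_moment_stationary_def)

lemma measurable_p: "k \<ge> 1 \<Longrightarrow> p k \<in> borel_measurable (ref_PiM k)"
  and \<mu>_eq_density: "k \<ge> 1 \<Longrightarrow> \<mu> k = density (ref_PiM k) (\<lambda>z. ennreal (p k z))"
  using coverage_function by (auto simp: coverage_function_def)

lemma p_nonneg: "k \<ge> 1 \<Longrightarrow> z \<in> extensional {..<k} \<Longrightarrow> 0 \<le> p k z"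
  using coverage_function by (auto simp: coverage_function_def space_PiM PiE_def)

lemma measurable_coverage1 [measurable]: "coverage1 p \<in> borel_measurable ref_measure"
  unfolding coverage1_def[abs_def]
  by (rule measurable_compose[OF measurable_restrict measurable_p]) auto

text \<open>The infimum in the stationarity hypothesis is one of reals; it is a genuine lower bound because
  coverage functions are nonnegative.\<close>

lemma coverage1_bounded_below:
  obtains c where "c > 0" "\<And>z. c \<le> coverage1 p z"
proof
  show "(INF z. coverage1 p z) > 0"
    using stationary by (simp add: coverage_reweighted_moment_stationary_def)
  have "bdd_below (range (coverage1 p))"
    using p_nonneg[of 1] by (auto intro!: bdd_belowI[of _ 0] simp: coverage1_def)
  then show "(INF z. coverage1 p z) \<le> coverage1 p z" for z
    by (intro cINF_lower) auto
qed

lemma coverage1_pos: "0 < coverage1 p z"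
  using coverage1_bounded_below by (metis less_le_trans)

text \<open>Campbell's formula for the \<open>k\<close>-th moment measure. Both sides are integrals of \<open>f\<close> against measures
  on \<open>(\<real>\<^sup>d)\<^sup>k\<close> that agree on rectangles by the definition of moment measures. The measure on the
  right is the mixture of the product measures of the components of \<open>\<Psi>\<close>.\<close>

lemma nn_integral_moment:
  assumes k: "k \<ge> 1" and f: "f \<in> borel_measurable (lborel_PiM k)"
  shows "(\<integral>\<^sup>+x. f x * ennreal (p k (labelled k l x)) \<partial>lborel_PiM k) =
    (\<integral>\<^sup>+\<omega>. (\<integral>\<^sup>+x. f x \<partial>PiM {..<k} (\<lambda>j. component (\<Psi> \<omega>) (l j))) \<partial>M)"
proof -
  let ?\<kappa> = "\<lambda>\<omega>. PiM {..<k} (\<lambda>j. component (\<Psi> \<omega>) (l j))"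
  let ?B = "PiM {..<k} (\<lambda>_. borel) :: (nat \<Rightarrow> 'a) measure"
  have p: "(\<lambda>z. ennreal (p k z)) \<in> borel_measurable (ref_PiM k)"
    by (rule measurable_compose[OF measurable_p[OF k] measurable_ennreal])
  have pl: "(\<lambda>x. ennreal (p k (labelled k l x))) \<in> borel_measurable (lborel_PiM k)"
    by (rule measurable_compose[OF measurable_labelled p])
  have \<Psi>: "\<Psi> \<omega> \<in> space lf_measures" if "\<omega> \<in> space M" for \<omega>
    using measurable_\<Psi> that by (rule measurable_space)
  have LB: "sets (lborel_PiM k) = sets ?B" by (intro sets_PiM_cong) simp_all
  have em: "(\<lambda>\<omega>. emeasure (?\<kappa> \<omega>) A) \<in> borel_measurable M" if A: "A \<in> sets ?B" for A
  proof -
    have "(\<lambda>\<omega>. \<integral>\<^sup>+x. indicator A x \<partial>?\<kappa> \<omega>) \<in> borel_measurable M"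
      by (rule measurable_nn_integral_PiM_component[OF measurable_\<Psi>]) (use A in measurable)
    then show ?thesis
      using A by (simp add: sets_PiM_component)
  qed
  obtain Q where Q: "sets Q = sets ?B"
    "\<And>f. f \<in> borel_measurable ?B \<Longrightarrow> (\<integral>\<^sup>+x. f x \<partial>Q) = (\<integral>\<^sup>+\<omega>. (\<integral>\<^sup>+x. f x \<partial>?\<kappa> \<omega>) \<partial>M)"
    using mixture_measure_exists[of M ?\<kappa> ?B] em sets_PiM_component by metis
  \<comment> \<open>\<open>P\<close> is the part of the moment measure with labels \<open>l\<close>\<close>
  define P where "P = density (lborel_PiM k) (\<lambda>x. ennreal (p k (labelled k l x)))"
  have P: "emeasure P (PiE {..<k} A) = emeasure (\<mu> k) (PiE {..<k} (\<lambda>j. A j \<times> {l j}))"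
    if A: "\<And>j. j \<in> {..<k} \<Longrightarrow> A j \<in> sets borel" for A
  proof -
    have R: "PiE {..<k} (\<lambda>j. A j \<times> {l j}) \<in> sets (ref_PiM k)"
      using A unfolding sets_PiM_cong[OF refl sets_ref_measure]
      by (intro sets_PiM_I_finite) (auto simp: sets_ref_measure intro!: pair_measureI)
    have "emeasure P (PiE {..<k} A) =
        (\<integral>\<^sup>+x. indicator (PiE {..<k} (\<lambda>j. A j \<times> {l j})) (labelled k l x) * ennreal (p k (labelled k l x)) \<partial>lborel_PiM k)"
      unfolding P_def using A
      by (subst emeasure_density[OF pl])
        (auto intro!: sets_PiM_I_finite nn_integral_cong simp: indicator_def labelled_def space_PiM PiE_iff)
    also have "\<dots> = (\<integral>\<^sup>+z. (\<Prod>j<k. indicator (UNIV \<times> {l j}) (z j)) *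
        (indicator (PiE {..<k} (\<lambda>j. A j \<times> {l j})) z * ennreal (p k z)) \<partial>ref_PiM k)"
      using R by (intro nn_integral_labelled borel_measurable_times_ennreal borel_measurable_indicator p)
    also have "\<dots> = (\<integral>\<^sup>+z. ennreal (p k z) * indicator (PiE {..<k} (\<lambda>j. A j \<times> {l j})) z \<partial>ref_PiM k)"
      by (intro nn_integral_cong) (auto simp: indicator_def PiE_iff prod_zero_iff mem_Times_iff)
    also have "\<dots> = emeasure (\<mu> k) (PiE {..<k} (\<lambda>j. A j \<times> {l j}))"
      unfolding \<mu>_eq_density[OF k] using R by (subst emeasure_density[OF p]) auto
    finally show ?thesis .
  qed
  have "P = Q"
  proof (rule measure_eqI_PiM_finite)
    show "sets P = ?B" "sets Q = ?B" by (simp_all add: P_def LB Q)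
    fix A :: "nat \<Rightarrow> 'a set" assume A: "\<And>j. j \<in> {..<k} \<Longrightarrow> A j \<in> sets borel"
    have "emeasure P (PiE {..<k} A) = emeasure (\<mu> k) (PiE {..<k} (\<lambda>j. A j \<times> {l j}))"
      by (rule P) (rule A)
    also have "\<dots> = (\<integral>\<^sup>+\<omega>. (\<Prod>j<k. emeasure (component (\<Psi> \<omega>) (l j)) (A j)) \<partial>M)"
      using moment_measure[OF k] A by (simp add: moment_measure_def)
    also have "\<dots> = (\<integral>\<^sup>+\<omega>. emeasure (?\<kappa> \<omega>) (PiE {..<k} A) \<partial>M)"
      using A product_sigma_finite.emeasure_PiM[OF product_sigma_finite_component[OF \<Psi>], of _ "{..<k}" A]
      by (intro nn_integral_cong) auto
    also have "\<dots> = (\<integral>\<^sup>+\<omega>. (\<integral>\<^sup>+x. indicator (PiE {..<k} A) x \<partial>?\<kappa> \<omega>) \<partial>M)"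
      using A by (intro nn_integral_cong) (auto intro!: nn_integral_indicator[symmetric] sets_PiM_I_finite)
    also have "\<dots> = (\<integral>\<^sup>+x. indicator (PiE {..<k} A) x \<partial>Q)"
      using A by (intro Q(2)[symmetric] borel_measurable_indicator sets_PiM_I_finite) auto
    also have "\<dots> = emeasure Q (PiE {..<k} A)"
      using A by (intro nn_integral_indicator) (auto simp: Q intro!: sets_PiM_I_finite)
    finally show "emeasure P (PiE {..<k} A) = emeasure Q (PiE {..<k} A)" .
  next
    let ?A = "\<lambda>n::nat. PiE {..<k} (\<lambda>_. cball (0::'a) (real n))"
    show "range ?A \<subseteq> prod_algebra {..<k} (\<lambda>_. borel)"
      by (auto intro!: prod_algebraI_finite)
    show "(\<Union>n. ?A n) = space ?B"
    proof
      show "space ?B \<subseteq> (\<Union>n. ?A n)"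
      proof
        fix x assume x: "x \<in> space ?B"
        obtain n where "(\<Sum>j<k. norm (x j)) \<le> real n" using real_arch_simple by blast
        moreover have "norm (x j) \<le> (\<Sum>j<k. norm (x j))" if "j < k" for j
          using that by (intro member_le_sum) auto
        ultimately have "x \<in> ?A n" using x by (force simp: space_PiM PiE_iff)
        then show "x \<in> (\<Union>n. ?A n)" by blast
      qed
    qed (auto simp: space_PiM)
    show "emeasure P (?A n) \<noteq> \<infinity>" for n
      using moment_measure[OF k] by (subst P) (auto simp: moment_measure_def less_top)
  qed simp
  have "(\<integral>\<^sup>+x. f x * ennreal (p k (labelled k l x)) \<partial>lborel_PiM k) = (\<integral>\<^sup>+x. f x \<partial>P)"
    unfolding P_def using f by (subst nn_integral_density[OF pl]) (auto simp: mult.commute)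
  also have "\<dots> = (\<integral>\<^sup>+\<omega>. (\<integral>\<^sup>+x. f x \<partial>?\<kappa> \<omega>) \<partial>M)"
    unfolding \<open>P = Q\<close> using f by (intro Q(2)) (simp add: measurable_cong_sets[OF LB refl])
  finally show ?thesis .
qed

text \<open>The integral of \<open>u\<^sub>t\<^sup>a\<close> against \<open>N\<close>; only the second component contributes.\<close>

definition ball_mass :: "real \<Rightarrow> 'a \<Rightarrow> ('a \<times> label) measure \<Rightarrow> ennreal" where
  "ball_mass t a N = (\<integral>\<^sup>+x. ennreal (u_ball p t a (x, L2)) \<partial>component N L2)"

abbreviation cov :: "label \<Rightarrow> 'a \<Rightarrow> real" where
  "cov i x \<equiv> coverage1 p (x, i)"

lemma measurable_cov [measurable]: "cov i \<in> borel_measurable borel"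
  by (rule measurable_compose[OF measurable_Pair_ref_measure measurable_coverage1])

lemma u_ball_nonneg [simp]: "0 \<le> u_ball p t a z"
  using coverage1_pos[of z] by (simp add: u_ball_def less_imp_le)

lemma u_ball_L1 [simp]: "u_ball p t a (x, L1) = 0"
  by (simp add: u_ball_def)

lemma u_ball_L2: "u_ball p t a (x, L2) = indicator (cball a t) x / cov L2 x"
  by (simp add: u_ball_def indicator_times)

lemma measurable_indicator_moving_cball [measurable]:
  assumes [measurable]: "f \<in> borel_measurable N" "g \<in> borel_measurable N"
  shows "(\<lambda>w. indicator (cball (f w :: 'a) t) (g w) :: real) \<in> borel_measurable N"
proof -
  have "(\<lambda>w. indicator (cball (f w) t) (g w) :: real) = (\<lambda>w. if dist (f w) (g w) \<le> t then 1 else 0)"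
    by (auto simp: indicator_def)
  then show ?thesis by simp
qed

lemma measurable_u_ball_L2 [measurable]:
  assumes [measurable]: "f \<in> borel_measurable N" "g \<in> borel_measurable N"
  shows "(\<lambda>w. u_ball p t (f w) (g w, L2)) \<in> borel_measurable N"
  unfolding u_ball_L2 by measurable

text \<open>As \<open>p\<^sub>1\<close> is bounded away from zero, \<open>u\<^sub>t\<^sup>a\<close> is dominated by a multiple of an indicator, with
  a constant that depends neither on \<open>a\<close> nor on \<open>t\<close>. All finiteness statements rest on this.\<close>

lemma u_ball_le:
  obtains c where "0 \<le> c" "\<And>t a x. u_ball p t a (x, L2) \<le> c * indicator (cball a t) x"
proof -
  obtain c where c: "c > 0" "\<And>z. c \<le> coverage1 p z"
    by (rule coverage1_bounded_below) blast
  show ?thesis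
  proof (rule that[of "1 / c"])
    show "0 \<le> 1 / c" using c by simp
    show "u_ball p t a (x, L2) \<le> 1 / c * indicator (cball a t) x" for t a x
      using c by (auto simp: u_ball_L2 indicator_def intro!: divide_left_mono mult_pos_pos coverage1_pos)
  qed
qed

lemma ball_mass_le:
  obtains C where "C < (\<infinity> :: ennreal)"
    "\<And>t a N. ball_mass t a N \<le> C * emeasure (component N L2) (cball a t)"
proof -
  obtain c where c: "0 \<le> c" "\<And>t a x. u_ball p t a (x, L2) \<le> c * indicator (cball a t) x"
    by (rule u_ball_le) blast
  have "ball_mass t a N \<le> ennreal c * emeasure (component N L2) (cball a t)" for t a N
  proof -
    have "ball_mass t a N \<le> (\<integral>\<^sup>+x. ennreal c * indicator (cball a t) x \<partial>component N L2)"
      unfolding ball_mass_def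
    proof (rule nn_integral_mono)
      fix x
      have "ennreal (u_ball p t a (x, L2)) \<le> ennreal (c * indicator (cball a t) x)"
        by (rule ennreal_leI) (rule c)
      also have "\<dots> = ennreal c * indicator (cball a t) x"
        by (auto simp: indicator_def)
      finally show "ennreal (u_ball p t a (x, L2)) \<le> ennreal c * indicator (cball a t) x" .
    qed
    also have "\<dots> = ennreal c * emeasure (component N L2) (cball a t)"
      by (rule nn_integral_cmult_indicator) simp
    finally show ?thesis .
  qed
  then show ?thesis by (intro that[of "ennreal c"]) auto
qed

lemma ball_mass_finite:
  assumes "N \<in> space lf_measures"
  shows "ball_mass t a N < \<infinity>"
proof -
  obtain C where C: "C < (\<infinity> :: ennreal)"
    "\<And>t a N. ball_mass t a N \<le> C * emeasure (component N L2) (cball a t)"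
    by (rule ball_mass_le) blast
  have "C * emeasure (component N L2) (cball a t) < \<infinity>"
    using C(1) emeasure_component_bounded[OF assms, of "cball a t" L2]
    by (simp add: ennreal_mult_less_top)
  with C(2) show ?thesis by (rule le_less_trans)
qed

lemma measurable_ball_mass [measurable]:
  assumes f: "f \<in> borel_measurable S" and K: "K \<in> measurable S lf_measures"
  shows "(\<lambda>s. ball_mass t (f s) (K s)) \<in> borel_measurable S"
  unfolding ball_mass_def
proof (rule measurable_nn_integral_component[OF K])
  note [measurable] = f
  show "(\<lambda>(s, x). ennreal (u_ball p t (f s) (x, L2))) \<in> borel_measurable (S \<Otimes>\<^sub>M borel)"
    unfolding case_prod_beta by measurable
qed

lemma integral_u_ball_component:
  shows "(\<Sum>i\<in>UNIV. \<integral>x. u_ball p t a (x, i) \<partial>component N i) = enn2real (ball_mass t a N)"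
proof -
  have "(\<integral>x. u_ball p t a (x, L2) \<partial>component N L2) = enn2real (ball_mass t a N)"
    unfolding ball_mass_def by (rule integral_eq_nn_integral) auto
  then show ?thesis by (simp add: UNIV_label)
qed

lemma laplace_eq: "laplace Q K (u_ball p t a) = (\<integral>\<omega>. exp (- enn2real (ball_mass t a (K \<omega>))) \<partial>Q)"
  unfolding laplace_def integral_u_ball_component ..

lemma ball_mass_power:
  assumes N: "N \<in> space lf_measures"
  shows "ball_mass t a N ^ k =
    (\<integral>\<^sup>+x. (\<Prod>j<k. ennreal (u_ball p t a (x j, L2))) \<partial>PiM {..<k} (\<lambda>_. component N L2))"
proof -
  interpret C: product_sigma_finite "\<lambda>_::nat. component N L2"
    by (rule product_sigma_finite_component[OF N])
  show ?thesis
    unfolding ball_mass_def by (subst C.product_nn_integral_prod) auto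
qed

lemma correlation_labelled:
  assumes "k \<ge> 1"
  shows "correlation p (labelled k l x) {..<k} = p k (labelled k l x) / (\<Prod>j<k. cov (l j) (x j))"
proof -
  have "coverage1 p (labelled k l x 0) \<noteq> 0"
    using coverage1_pos by (metis less_irrefl)
  then have "correlation p (labelled k l x) {..<k} =
      p k (labelled k l x) / (\<Prod>j<k. coverage1 p (labelled k l x j))"
    using assms by (intro correlation_eq_ratio) (auto simp: labelled_def)
  then show ?thesis
    by (simp add: labelled_def)
qed

text \<open>The partition sum has terms of both signs, but it is a quotient of coverage functions.\<close>

lemma correlation_labelled_nonneg:
  "0 \<le> correlation p (labelled k l x) {..<k}"
proof (cases "k = 0")
  case True
  then show ?thesis by (simp add: correlation_def partition_sum_empty)
next
  case False
  moreover have "labelled k l x \<in> extensional {..<k}"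
    by (simp add: labelled_def)
  ultimately show ?thesis
    using p_nonneg[of k "labelled k l x"] coverage1_pos
    by (subst correlation_labelled) (auto intro!: divide_nonneg_pos prod_pos)
qed

lemma measurable_correlation_labelled:
  "(\<lambda>x. correlation p (labelled k l x) {..<k}) \<in> borel_measurable (lborel_PiM k)"
proof (cases "k = 0")
  case True
  then show ?thesis by (simp add: correlation_def partition_sum_empty)
next
  case False
  then have "p k \<in> borel_measurable (ref_PiM k)" by (intro measurable_p) auto
  then have [measurable]: "(\<lambda>x. p k (labelled k l x)) \<in> borel_measurable (lborel_PiM k)"
    by (rule measurable_compose[OF measurable_labelled])
  show ?thesis
    using False by (simp add: correlation_labelled) measurable
qed

text \<open>The reweighting in \<open>u\<^sub>t\<^sup>a\<close> cancels the normalisation of the coverage function; what remains is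
  the normalised coverage function on \<open>B(a, t)\<^sup>k\<close>.\<close>

lemma prod_u_ball_times_p:
  assumes l: "\<And>j. j \<in> {..<k} \<Longrightarrow> l j = L2" and k: "k \<ge> 1"
  shows "(\<Prod>j<k. ennreal (u_ball p t a (x j, L2))) * ennreal (p k (labelled k l x)) =
    (\<Prod>j<k. indicator (cball a t) (x j)) * ennreal (correlation p (labelled k l x) {..<k})"
proof -
  have pos: "(\<Prod>j<k. cov L2 (x j)) > 0"
    by (intro prod_pos) (auto simp: coverage1_pos)
  have "(\<Prod>j<k. ennreal (u_ball p t a (x j, L2))) * ennreal (p k (labelled k l x)) =
      ennreal ((\<Prod>j<k. u_ball p t a (x j, L2)) * p k (labelled k l x))"
    using p_nonneg[OF k, of "labelled k l x"]
    by (simp add: prod_ennreal ennreal_mult prod_nonneg labelled_def)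
  also have "(\<Prod>j<k. u_ball p t a (x j, L2)) * p k (labelled k l x) =
      (\<Prod>j<k. indicator (cball a t) (x j)) * correlation p (labelled k l x) {..<k}"
    using l by (simp add: u_ball_L2 prod_dividef correlation_labelled[OF k])
  also have "ennreal \<dots> = (\<Prod>j<k. indicator (cball a t) (x j)) * ennreal (correlation p (labelled k l x) {..<k})"
    by (subst ennreal_mult) (auto simp: prod_nonneg correlation_labelled_nonneg simp flip: prod_ennreal ennreal_indicator)
  finally show ?thesis .
qed

lemma nn_integral_ball_PiM:
  assumes "f \<in> borel_measurable (lborel_PiM k)"
  shows "(\<integral>\<^sup>+x. f x \<partial>ball_PiM t a k) = (\<integral>\<^sup>+x. (\<Prod>j<k. indicator (cball a t) (x j)) * f x \<partial>lborel_PiM k)"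
proof -
  have "(\<lambda>x. \<Prod>j<k. indicator (cball a t) (x j) :: ennreal) \<in> borel_measurable (lborel_PiM k)"
    by measurable
  then show ?thesis
    unfolding ball_PiM_eq_density using assms by (rule nn_integral_density)
qed

lemma nn_integral_ball_mass_power_eq:
  assumes k: "k \<ge> 1"
  shows "(\<integral>\<^sup>+\<omega>. ball_mass t a (\<Psi> \<omega>) ^ k \<partial>M) =
    (\<integral>\<^sup>+x. (\<Prod>j<k. ennreal (u_ball p t a (x j, L2))) * ennreal (p k (labelled k (\<lambda>_. L2) x)) \<partial>lborel_PiM k)"
proof -
  have "(\<integral>\<^sup>+\<omega>. ball_mass t a (\<Psi> \<omega>) ^ k \<partial>M) =
      (\<integral>\<^sup>+\<omega>. (\<integral>\<^sup>+x. (\<Prod>j<k. ennreal (u_ball p t a (x j, L2))) \<partial>PiM {..<k} (\<lambda>_. component (\<Psi> \<omega>) L2)) \<partial>M)"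
    by (intro nn_integral_cong ball_mass_power measurable_space[OF measurable_\<Psi>])
  also have "\<dots> = (\<integral>\<^sup>+x. (\<Prod>j<k. ennreal (u_ball p t a (x j, L2))) *
      ennreal (p k (labelled k (\<lambda>_. L2) x)) \<partial>lborel_PiM k)"
    by (rule nn_integral_moment[symmetric, OF k]) measurable
  finally show ?thesis .
qed

lemma nn_integral_ball_mass_power:
  "(\<integral>\<^sup>+\<omega>. ball_mass t a (\<Psi> \<omega>) ^ k \<partial>M) =
    (\<integral>\<^sup>+x. ennreal (correlation p (labelled k (\<lambda>_. L2) x) {..<k}) \<partial>ball_PiM t a k)"
proof (cases "k = 0")
  case True
  then show ?thesis
    using prob_space.emeasure_space_1[OF prob_space_M]
    by (simp add: correlation_def partition_sum_empty PiM_empty)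
next
  case False
  then have k: "k \<ge> 1" by simp
  show ?thesis
    using measurable_correlation_labelled[of k "\<lambda>_. L2"]
    by (subst nn_integral_ball_PiM)
      (simp_all add: nn_integral_ball_mass_power_eq[OF k] prod_u_ball_times_p[OF _ k])
qed

text \<open>\<open>u\<^sub>t\<^sup>a\<close> vanishes at label \<open>L1\<close>, so among all labellings of the \<open>k\<close> points only the constant one
  \<open>L2\<close> contributes.\<close>

lemma integral_u_ball_moment_measure:
  assumes k: "k \<ge> 1"
  shows "(\<integral>z. (\<Prod>j<k. u_ball p t a (z j)) \<partial>\<mu> k) = enn2real (\<integral>\<^sup>+\<omega>. ball_mass t a (\<Psi> \<omega>) ^ k \<partial>M)"
proof -
  have pm: "(\<lambda>z. ennreal (p k z)) \<in> borel_measurable (ref_PiM k)"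
    by (rule measurable_compose[OF measurable_p[OF k] measurable_ennreal])
  have u: "u_ball p t a \<in> borel_measurable ref_measure"
  proof -
    have "cball a t \<times> {L2} \<in> sets ref_measure"
      unfolding sets_ref_measure by (intro pair_measureI) auto
    then show ?thesis
      unfolding u_ball_def[abs_def] by (intro borel_measurable_divide borel_measurable_indicator) auto
  qed
  have "(\<lambda>z. u_ball p t a (z j)) \<in> borel_measurable (ref_PiM k)" if "j \<in> {..<k}" for j
    by (rule measurable_compose[OF measurable_component_singleton[OF that] u])
  then have um: "(\<lambda>z. \<Prod>j<k. u_ball p t a (z j)) \<in> borel_measurable (ref_PiM k)"
    by (rule borel_measurable_prod)
  have "(\<integral>z. (\<Prod>j<k. u_ball p t a (z j)) \<partial>\<mu> k) = enn2real (\<integral>\<^sup>+z. ennreal (\<Prod>j<k. u_ball p t a (z j)) \<partial>\<mu> k)"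
    using um by (intro integral_eq_nn_integral) (auto simp: \<mu>_eq_density[OF k] prod_nonneg)
  also have "(\<integral>\<^sup>+z. ennreal (\<Prod>j<k. u_ball p t a (z j)) \<partial>\<mu> k) =
      (\<integral>\<^sup>+z. ennreal (p k z) * ennreal (\<Prod>j<k. u_ball p t a (z j)) \<partial>ref_PiM k)"
    unfolding \<mu>_eq_density[OF k] using um by (intro nn_integral_density pm) auto
  also have "\<dots> = (\<integral>\<^sup>+z. (\<Prod>j<k. indicator (UNIV \<times> {L2}) (z j)) *
      (ennreal (p k z) * ennreal (\<Prod>j<k. u_ball p t a (z j))) \<partial>ref_PiM k)"
  proof (rule nn_integral_cong)
    fix z
    have "ennreal (\<Prod>j<k. u_ball p t a (z j)) = 0 \<or>
        (\<Prod>j<k. indicator (UNIV \<times> {L2}) (z j)) = (1 :: ennreal)"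
    proof (cases "\<forall>j<k. z j \<in> UNIV \<times> {L2}")
      case False
      then obtain j where j: "j < k" "snd (z j) \<noteq> L2"
        by (auto simp: mem_Times_iff)
      then have "z j \<notin> cball a t \<times> {L2}"
        by (auto simp: mem_Times_iff)
      then have "u_ball p t a (z j) = 0"
        by (simp add: u_ball_def)
      with j have "(\<Prod>j<k. u_ball p t a (z j)) = 0"
        by (intro prod_zero) auto
      then show ?thesis by (simp only: ennreal_0 simp_thms)
    qed simp
    then show "ennreal (p k z) * ennreal (\<Prod>j<k. u_ball p t a (z j)) =
        (\<Prod>j<k. indicator (UNIV \<times> {L2}) (z j)) * (ennreal (p k z) * ennreal (\<Prod>j<k. u_ball p t a (z j)))"
      by (elim disjE) (simp_all only: mult_zero_right mult_1_left)
  qed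
  also have "\<dots> = (\<integral>\<^sup>+x. ennreal (p k (labelled k (\<lambda>_. L2) x)) *
      ennreal (\<Prod>j<k. u_ball p t a (labelled k (\<lambda>_. L2) x j)) \<partial>lborel_PiM k)"
    using um by (intro nn_integral_labelled[symmetric] borel_measurable_times_ennreal pm) auto
  also have "\<dots> = (\<integral>\<^sup>+\<omega>. ball_mass t a (\<Psi> \<omega>) ^ k \<partial>M)"
    unfolding nn_integral_ball_mass_power_eq[OF k]
    by (intro nn_integral_cong) (simp add: labelled_def prod_ennreal mult.commute)
  finally show ?thesis .
qed

lemma nn_integral_component_bounded_finite:
  fixes k :: nat
  assumes "k \<ge> 1" "\<And>j. j < k \<Longrightarrow> B j \<in> sets borel \<and> bounded (B j)"
  shows "(\<integral>\<^sup>+\<omega>. (\<Prod>j<k. emeasure (component (\<Psi> \<omega>) (l j)) (B j)) \<partial>M) < \<infinity>"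
  using moment_measure[OF assms(1)] assms(2) unfolding moment_measure_def by (metis (no_types, lifting))

lemma nn_integral_ball_mass_power_finite:
  "(\<integral>\<^sup>+\<omega>. ball_mass t a (\<Psi> \<omega>) ^ k \<partial>M) < \<infinity>"
proof (cases "k = 0")
  case True
  then show ?thesis
    using prob_space.emeasure_space_1[OF prob_space_M] by simp
next
  case False
  obtain C where C: "C < (\<infinity> :: ennreal)"
    "\<And>t a N. ball_mass t a N \<le> C * emeasure (component N L2) (cball a t)"
    by (rule ball_mass_le) blast
  have em: "(\<lambda>\<omega>. emeasure (component (\<Psi> \<omega>) L2) (cball a t)) \<in> borel_measurable M"
    by (rule measurable_compose[OF measurable_\<Psi> measurable_emeasure_component]) auto
  have "(\<integral>\<^sup>+\<omega>. ball_mass t a (\<Psi> \<omega>) ^ k \<partial>M) \<le>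
      (\<integral>\<^sup>+\<omega>. C ^ k * emeasure (component (\<Psi> \<omega>) L2) (cball a t) ^ k \<partial>M)"
    using C(2) by (intro nn_integral_mono) (simp add: power_mono flip: power_mult_distrib)
  also have "\<dots> = C ^ k * (\<integral>\<^sup>+\<omega>. emeasure (component (\<Psi> \<omega>) L2) (cball a t) ^ k \<partial>M)"
    using em by (intro nn_integral_cmult) auto
  also have "\<dots> < \<infinity>"
    using nn_integral_component_bounded_finite[of k "\<lambda>_. cball a t" "\<lambda>_. L2"] False C(1)
    by (simp add: ennreal_mult_less_top power_less_top_ennreal)
  finally show ?thesis .
qed

section \<open>Moments under the Palm distribution\<close>

text \<open>The labels of the Palm point, which has index \<open>0\<close>, and of the points in the ball around it.\<close>

abbreviation palm_labels :: "nat \<Rightarrow> label" where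
  "palm_labels \<equiv> case_nat L1 (\<lambda>_. L2)"

lemma labelled_case_nat:
  "labelled (Suc k) (case_nat i l) (case_nat a x) = case_nat (a, i) (labelled k l x)"
  by (auto simp: labelled_def fun_eq_iff split: nat.split)

lemma prod_u_ball_times_p_Suc:
  "(\<Prod>j<k. ennreal (u_ball p t a (x j, L2))) * ennreal (p (Suc k) (labelled (Suc k) palm_labels (case_nat a x))) =
    ennreal (cov L1 a) * ((\<Prod>j<k. indicator (cball a t) (x j)) *
      ennreal (correlation p (labelled (Suc k) palm_labels (case_nat a x)) {..<Suc k}))"
proof -
  let ?z = "labelled (Suc k) palm_labels (case_nat a x)"
  have pos: "cov L1 a > 0" "(\<Prod>j<k. cov L2 (x j)) > 0"
    by (auto intro!: prod_pos simp: coverage1_pos)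
  have c: "correlation p ?z {..<Suc k} = p (Suc k) ?z / (cov L1 a * (\<Prod>j<k. cov L2 (x j)))"
    by (subst correlation_labelled) (simp_all add: prod.lessThan_Suc_shift del: prod.lessThan_Suc)
  have "?z \<in> extensional {..<Suc k}" by (simp add: labelled_def)
  then have pn: "p (Suc k) ?z \<ge> 0" by (intro p_nonneg) auto
  have "(\<Prod>j<k. ennreal (u_ball p t a (x j, L2))) * ennreal (p (Suc k) ?z) =
      ennreal ((\<Prod>j<k. u_ball p t a (x j, L2)) * p (Suc k) ?z)"
    using pn by (simp add: prod_ennreal ennreal_mult prod_nonneg)
  also have "(\<Prod>j<k. u_ball p t a (x j, L2)) * p (Suc k) ?z =
      cov L1 a * ((\<Prod>j<k. indicator (cball a t) (x j)) * correlation p ?z {..<Suc k})"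
    unfolding c using pos by (simp add: u_ball_L2 prod_dividef)
  also have "ennreal \<dots> = ennreal (cov L1 a) * ((\<Prod>j<k. indicator (cball a t) (x j)) *
      ennreal (correlation p ?z {..<Suc k}))"
    using pos(1) correlation_labelled_nonneg[of "Suc k" palm_labels "case_nat a x"]
    by (simp add: ennreal_mult prod_nonneg less_imp_le flip: prod_ennreal ennreal_indicator)
  finally show ?thesis .
qed

lemma measurable_case_nat_lborel [measurable]:
  "(\<lambda>w. case_nat (fst w) (snd w)) \<in> measurable (lborel \<Otimes>\<^sub>M lborel_PiM k) (lborel_PiM (Suc k))"
  by measurable

lemma measurable_correlation_case_nat:
  "(\<lambda>w. correlation p (labelled (Suc k) l (case_nat (fst w) (snd w))) {..<Suc k})
    \<in> borel_measurable (lborel \<Otimes>\<^sub>M lborel_PiM k)"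
  by (rule measurable_compose[OF measurable_case_nat_lborel measurable_correlation_labelled])

text \<open>The integral over \<open>B(a, t)\<^sup>k\<close> of the normalised \<open>(k+1)\<close>-point coverage function with first
  argument \<open>(a, 1)\<close>. By \<open>AE_palm_ball_mass_power\<close> it is the \<open>k\<close>-th moment of the ball mass under the
  Palm distribution at \<open>(a, 1)\<close>.\<close>

definition palm_moment :: "real \<Rightarrow> nat \<Rightarrow> 'a \<Rightarrow> ennreal" where
  "palm_moment t k a = (\<integral>\<^sup>+x. ennreal (correlation p (labelled (Suc k) palm_labels (case_nat a x)) {..<Suc k})
      \<partial>ball_PiM t a k)"

lemma palm_moment_eq:
  "ennreal (cov L1 a) * palm_moment t k a =
    (\<integral>\<^sup>+x. (\<Prod>j<k. ennreal (u_ball p t a (x j, L2))) *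
      ennreal (p (Suc k) (labelled (Suc k) palm_labels (case_nat a x))) \<partial>lborel_PiM k)"
proof -
  have m: "(\<lambda>x. ennreal (correlation p (labelled (Suc k) palm_labels (case_nat a x)) {..<Suc k}))
      \<in> borel_measurable (lborel_PiM k)"
  proof -
    have "Pair a \<in> measurable (lborel_PiM k) (lborel \<Otimes>\<^sub>M lborel_PiM k)" by simp
    from measurable_compose[OF this measurable_correlation_case_nat] show ?thesis by simp
  qed
  have i: "(\<lambda>x. \<Prod>j<k. indicator (cball a t) (x j) :: ennreal) \<in> borel_measurable (lborel_PiM k)"
    by measurable
  show ?thesis
    unfolding palm_moment_def nn_integral_ball_PiM[OF m] prod_u_ball_times_p_Suc
    by (rule nn_integral_cmult[symmetric]) (intro borel_measurable_times_ennreal i m)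
qed

lemma measurable_palm_density:
  "(\<lambda>(a, x). (\<Prod>j<k. ennreal (u_ball p t a (x j, L2))) *
      ennreal (p (Suc k) (labelled (Suc k) l (case_nat a x)))) \<in> borel_measurable (lborel \<Otimes>\<^sub>M lborel_PiM k)"
proof -
  have [measurable]: "(\<lambda>w. p (Suc k) (labelled (Suc k) l (case_nat (fst w) (snd w))))
      \<in> borel_measurable (lborel \<Otimes>\<^sub>M lborel_PiM k)"
    by (rule measurable_compose[OF measurable_compose[OF measurable_case_nat_lborel measurable_labelled] measurable_p])
      simp
  show ?thesis
    unfolding case_prod_beta by measurable
qed

lemma measurable_palm_moment [measurable]:
  "(\<lambda>a. ennreal (cov L1 a) * palm_moment t k a) \<in> borel_measurable lborel"
proof -
  interpret L: sigma_finite_measure "lborel_PiM k :: (nat \<Rightarrow> 'a) measure"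
    by (rule sigma_finite_lborel_PiM)
  show ?thesis
    unfolding palm_moment_eq by (rule L.borel_measurable_nn_integral[OF measurable_palm_density])
qed

text \<open>Campbell's formula for \<open>k + 1\<close> points, applied to a function of the first point \<open>a\<close> and of \<open>k\<close>
  further points near \<open>a\<close>. The dependence of the ball on \<open>a\<close> is why rectangles do not suffice.\<close>

lemma nn_integral_palm_moment:
  assumes A: "A \<in> sets borel"
  shows "(\<integral>\<^sup>+a. (ennreal (cov L1 a) * palm_moment t k a) * indicator A a \<partial>lborel) =
    (\<integral>\<^sup>+\<omega>. (\<integral>\<^sup>+a. indicator A a * ball_mass t a (\<Psi> \<omega>) ^ k \<partial>component (\<Psi> \<omega>) L1) \<partial>M)"
proof -
  let ?f = "\<lambda>z. indicator A (z 0) * (\<Prod>j<k. ennreal (u_ball p t (z 0) (z (Suc j), L2)))"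
  have f: "?f \<in> borel_measurable (PiM {..<Suc k} (\<lambda>_. borel :: 'a measure))"
    using A by measurable
  have sB: "sets (lborel_PiM (Suc k)) = sets (PiM {..<Suc k} (\<lambda>_. borel :: 'a measure))"
    by (intro sets_PiM_cong) simp_all
  have fl: "?f \<in> borel_measurable (lborel_PiM (Suc k))"
    using f by (simp add: measurable_cong_sets[OF sB refl])
  have "(\<integral>\<^sup>+\<omega>. (\<integral>\<^sup>+a. indicator A a * ball_mass t a (\<Psi> \<omega>) ^ k \<partial>component (\<Psi> \<omega>) L1) \<partial>M) =
      (\<integral>\<^sup>+\<omega>. (\<integral>\<^sup>+z. ?f z \<partial>PiM {..<Suc k} (\<lambda>j. component (\<Psi> \<omega>) (palm_labels j))) \<partial>M)"
  proof (rule nn_integral_cong)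
    fix \<omega> assume "\<omega> \<in> space M"
    then have N: "\<Psi> \<omega> \<in> space lf_measures" by (rule measurable_space[OF measurable_\<Psi>])
    have fc: "?f \<in> borel_measurable (PiM {..<Suc k} (\<lambda>j. component (\<Psi> \<omega>) (palm_labels j)))"
      using f by (simp only: measurable_cong_sets[OF sets_PiM_component refl])
    have "(\<integral>\<^sup>+z. ?f z \<partial>PiM {..<Suc k} (\<lambda>j. component (\<Psi> \<omega>) (palm_labels j))) =
        (\<integral>\<^sup>+a. \<integral>\<^sup>+x. indicator A a * (\<Prod>j<k. ennreal (u_ball p t a (x j, L2)))
          \<partial>PiM {..<k} (\<lambda>j. component (\<Psi> \<omega>) L2) \<partial>component (\<Psi> \<omega>) L1)"
      by (subst nn_integral_PiM_Suc[OF product_sigma_finite_component[OF N] fc]) simp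
    also have "\<dots> = (\<integral>\<^sup>+a. indicator A a * ball_mass t a (\<Psi> \<omega>) ^ k \<partial>component (\<Psi> \<omega>) L1)"
      unfolding ball_mass_power[OF N]
      by (intro nn_integral_cong nn_integral_cmult) measurable
    finally show "(\<integral>\<^sup>+a. indicator A a * ball_mass t a (\<Psi> \<omega>) ^ k \<partial>component (\<Psi> \<omega>) L1) =
      (\<integral>\<^sup>+z. ?f z \<partial>PiM {..<Suc k} (\<lambda>j. component (\<Psi> \<omega>) (palm_labels j)))" ..
  qed
  also have "\<dots> = (\<integral>\<^sup>+z. ?f z * ennreal (p (Suc k) (labelled (Suc k) palm_labels z)) \<partial>lborel_PiM (Suc k))"
    by (rule nn_integral_moment[symmetric, OF _ fl]) simp
  also have "\<dots> = (\<integral>\<^sup>+a. \<integral>\<^sup>+x. indicator A a * ((\<Prod>j<k. ennreal (u_ball p t a (x j, L2))) *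
      ennreal (p (Suc k) (labelled (Suc k) palm_labels (case_nat a x)))) \<partial>lborel_PiM k \<partial>lborel)"
  proof -
    have "(\<lambda>z. p (Suc k) (labelled (Suc k) palm_labels z)) \<in> borel_measurable (lborel_PiM (Suc k))"
      by (rule measurable_compose[OF measurable_labelled measurable_p]) simp
    then have "(\<lambda>z. ?f z * ennreal (p (Suc k) (labelled (Suc k) palm_labels z))) \<in> borel_measurable (lborel_PiM (Suc k))"
      by (intro borel_measurable_times_ennreal fl measurable_compose[OF _ measurable_ennreal])
    then show ?thesis
      by (subst nn_integral_PiM_Suc[OF product_sigma_finite_lborel]) (simp_all add: mult.assoc)
  qed
  also have "\<dots> = (\<integral>\<^sup>+a. indicator A a * (ennreal (cov L1 a) * palm_moment t k a) \<partial>lborel)"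
    unfolding palm_moment_eq
    by (intro nn_integral_cong nn_integral_cmult)
      (use measurable_compose[OF measurable_Pair1' measurable_palm_density] in simp)
  finally show ?thesis by (simp add: mult.commute)
qed

text \<open>For \<open>a\<close> in a ball of radius \<open>n\<close> the moving balls \<open>B(a, t)\<close> lie in the ball of radius \<open>n + t\<close>, so
  local integrability follows from the local finiteness of the \<open>(k+1)\<close>-st moment measure.\<close>

lemma AE_palm_moment_finite:
  "AE a in lborel. palm_moment t k a < \<infinity>"
proof -
  let ?g = "\<lambda>a. ennreal (cov L1 a) * palm_moment t k a"
  obtain C where C: "C < (\<infinity> :: ennreal)"
    "\<And>t a N. ball_mass t a N \<le> C * emeasure (component N L2) (cball a t)"
    by (rule ball_mass_le) blast
  have "AE a in lborel. ?g a * indicator (cball 0 (real n)) a \<noteq> \<infinity>" for n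
  proof (rule nn_integral_PInf_AE)
    let ?K = "cball (0 :: 'a) (real n)" and ?B = "cball (0 :: 'a) (real n + t)"
    let ?l = "\<lambda>j. palm_labels j" and ?D = "\<lambda>j. case j of 0 \<Rightarrow> ?K | Suc _ \<Rightarrow> ?B"
    have le: "(\<integral>\<^sup>+a. indicator ?K a * ball_mass t a (\<Psi> \<omega>) ^ k \<partial>component (\<Psi> \<omega>) L1) \<le>
        C ^ k * (\<Prod>j<Suc k. emeasure (component (\<Psi> \<omega>) (?l j)) (?D j))" for \<omega>
    proof -
      have "(\<integral>\<^sup>+a. indicator ?K a * ball_mass t a (\<Psi> \<omega>) ^ k \<partial>component (\<Psi> \<omega>) L1) \<le>
          (\<integral>\<^sup>+a. (C * emeasure (component (\<Psi> \<omega>) L2) ?B) ^ k * indicator ?K a \<partial>component (\<Psi> \<omega>) L1)"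
      proof (rule nn_integral_mono)
        fix a
        have "ball_mass t a (\<Psi> \<omega>) \<le> C * emeasure (component (\<Psi> \<omega>) L2) ?B" if "a \<in> ?K"
        proof -
          have "cball a t \<subseteq> ?B"
          proof
            fix x assume "x \<in> cball a t"
            then show "x \<in> ?B"
              using that norm_triangle_sub[of x a] by (simp add: dist_norm norm_minus_commute)
          qed
          then have "emeasure (component (\<Psi> \<omega>) L2) (cball a t) \<le> emeasure (component (\<Psi> \<omega>) L2) ?B"
            by (intro emeasure_mono) auto
          then show ?thesis
            using C(2)[of t a "\<Psi> \<omega>"] by (meson mult_left_mono order_trans zero_le)
        qed
        then show "indicator ?K a * ball_mass t a (\<Psi> \<omega>) ^ k \<le>
            (C * emeasure (component (\<Psi> \<omega>) L2) ?B) ^ k * indicator ?K a"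
          by (auto simp: indicator_def intro!: power_mono)
      qed
      also have "\<dots> = (C * emeasure (component (\<Psi> \<omega>) L2) ?B) ^ k * emeasure (component (\<Psi> \<omega>) L1) ?K"
        by (rule nn_integral_cmult_indicator) simp
      also have "\<dots> = C ^ k * (\<Prod>j<Suc k. emeasure (component (\<Psi> \<omega>) (?l j)) (?D j))"
        unfolding prod.lessThan_Suc_shift by (simp add: power_mult_distrib ac_simps)
      finally show ?thesis .
    qed
    have em: "(\<lambda>\<omega>. emeasure (component (\<Psi> \<omega>) (?l j)) (?D j)) \<in> borel_measurable M" for j
      by (rule measurable_compose[OF measurable_\<Psi> measurable_emeasure_component]) (auto split: nat.split)
    have "(\<integral>\<^sup>+a. ?g a * indicator ?K a \<partial>lborel) \<le>
        (\<integral>\<^sup>+\<omega>. C ^ k * (\<Prod>j<Suc k. emeasure (component (\<Psi> \<omega>) (?l j)) (?D j)) \<partial>M)"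
      by (subst nn_integral_palm_moment) (simp, intro nn_integral_mono le)
    also have "\<dots> = C ^ k * (\<integral>\<^sup>+\<omega>. (\<Prod>j<Suc k. emeasure (component (\<Psi> \<omega>) (?l j)) (?D j)) \<partial>M)"
      using em by (intro nn_integral_cmult borel_measurable_prod_ennreal)
    also have "\<dots> < \<infinity>"
      using nn_integral_component_bounded_finite[of "Suc k" ?D ?l] C(1)
      by (simp add: ennreal_mult_less_top power_less_top_ennreal del: prod.lessThan_Suc split: nat.split)
    finally show "(\<integral>\<^sup>+a. ?g a * indicator ?K a \<partial>lborel) \<noteq> \<infinity>" by simp
  qed (intro borel_measurable_times_ennreal measurable_palm_moment, simp)
  then have "AE a in lborel. \<forall>n. ?g a * indicator (cball 0 (real n)) a \<noteq> \<infinity>"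
    by (simp add: AE_all_countable)
  then show ?thesis
  proof eventually_elim
    fix a :: 'a assume a: "\<forall>n. ?g a * indicator (cball 0 (real n)) a \<noteq> \<infinity>"
    obtain n where "norm a \<le> real n" using real_arch_simple by blast
    then have "?g a \<noteq> \<infinity>" using a[rule_format, of n] by simp
    then show "palm_moment t k a < \<infinity>"
      using coverage1_pos[of "(a, L1)"] by (auto simp: ennreal_mult_eq_top_iff less_top)
  qed
qed

text \<open>By the defining property of Palm distributions and by \<open>nn_integral_palm_moment\<close> the two sides,
  multiplied by \<open>p\<^sub>1(a, 1)\<close>, are densities of the same measure in \<open>a\<close>.\<close>

lemma AE_palm_ball_mass_power:
  assumes palm: "palm_distribution M \<Psi> (\<mu> 1) P"
  shows "AE a in lborel. (\<integral>\<^sup>+N. ball_mass t a N ^ k \<partial>P (a, L1)) = palm_moment t k a"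
proof -
  let ?f = "\<lambda>a. ennreal (cov L1 a) * (\<integral>\<^sup>+N. ball_mass t a N ^ k \<partial>P (a, L1))"
  let ?g = "\<lambda>a. ennreal (cov L1 a) * palm_moment t k a"
  have Pm: "P \<in> measurable ref_measure (prob_algebra lf_measures)"
    using palm by (simp add: palm_distribution_def)
  have PL: "(\<lambda>a. P (a, L1)) \<in> measurable borel (subprob_algebra lf_measures)"
    by (rule measurable_prob_algebraD[OF measurable_compose[OF measurable_Pair_ref_measure Pm]])
  have m: "(\<lambda>(a, N). ball_mass t a N ^ k) \<in> borel_measurable (borel \<Otimes>\<^sub>M lf_measures)"
    unfolding case_prod_beta by measurable
  have h: "(\<lambda>a. \<integral>\<^sup>+N. ball_mass t a N ^ k \<partial>P (a, L1)) \<in> borel_measurable borel"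
    by (rule nn_integral_measurable_subprob_algebra2[OF m PL])
  have f: "?f \<in> borel_measurable lborel"
    using h by measurable
  have key: "(\<integral>\<^sup>+a. ?f a * indicator A a \<partial>lborel) = (\<integral>\<^sup>+a. ?g a * indicator A a \<partial>lborel)"
    if A: "A \<in> sets borel" for A
  proof -
    let ?w = "\<lambda>(z, N). indicator (A \<times> {L1}) z * ball_mass t (fst z) N ^ k"
    have AL: "A \<times> {L1} \<in> sets ref_measure"
      using A unfolding sets_ref_measure by (intro pair_measureI) auto
    have fst: "fst \<in> measurable ref_measure (borel :: 'a measure)"
      by (simp add: measurable_cong_sets[OF sets_ref_measure refl])
    have w: "?w \<in> borel_measurable (ref_measure \<Otimes>\<^sub>M lf_measures)"
      unfolding case_prod_beta
    proof (rule borel_measurable_times_ennreal)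
      show "(\<lambda>x. indicator (A \<times> {L1}) (fst x) :: ennreal) \<in> borel_measurable (ref_measure \<Otimes>\<^sub>M lf_measures)"
        by (rule measurable_compose[OF measurable_fst borel_measurable_indicator[OF AL]])
      have "(\<lambda>x. ball_mass t (fst (fst x)) (snd x)) \<in> borel_measurable (ref_measure \<Otimes>\<^sub>M lf_measures)"
        by (rule measurable_ball_mass[OF measurable_compose[OF measurable_fst fst] measurable_snd])
      then show "(\<lambda>x. ball_mass t (fst (fst x)) (snd x) ^ k) \<in> borel_measurable (ref_measure \<Otimes>\<^sub>M lf_measures)"
        by measurable
    qed
    have "(\<lambda>z. \<integral>\<^sup>+N. ?w (z, N) \<partial>P z) \<in> borel_measurable ref_measure"
      by (rule nn_integral_measurable_subprob_algebra2[OF _ measurable_prob_algebraD[OF Pm]]) (use w in simp)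
    then have W: "(\<lambda>z. \<integral>\<^sup>+N. ?w (z 0, N) \<partial>P (z 0)) \<in> borel_measurable (ref_PiM 1)"
      by (rule measurable_compose[OF measurable_component_singleton, rotated]) simp
    have p1: "(\<lambda>z. ennreal (p 1 z)) \<in> borel_measurable (ref_PiM 1)"
      by (rule measurable_compose[OF measurable_p measurable_ennreal]) simp
    have "(\<integral>\<^sup>+\<omega>. (\<Sum>i\<in>UNIV. \<integral>\<^sup>+x. ?w ((x, i), \<Psi> \<omega>) \<partial>component (\<Psi> \<omega>) i) \<partial>M) =
        (\<integral>\<^sup>+z. (\<integral>\<^sup>+N. ?w (z 0, N) \<partial>P (z 0)) \<partial>\<mu> 1)"
      by (rule palm[unfolded palm_distribution_def, THEN conjunct2, rule_format, OF w])
    moreover have "(\<Sum>i\<in>UNIV. \<integral>\<^sup>+x. ?w ((x, i), \<Psi> \<omega>) \<partial>component (\<Psi> \<omega>) i) =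
        (\<integral>\<^sup>+a. indicator A a * ball_mass t a (\<Psi> \<omega>) ^ k \<partial>component (\<Psi> \<omega>) L1)" for \<omega>
      by (simp add: UNIV_label indicator_times)
    ultimately have "(\<integral>\<^sup>+a. ?g a * indicator A a \<partial>lborel) = (\<integral>\<^sup>+z. (\<integral>\<^sup>+N. ?w (z 0, N) \<partial>P (z 0)) \<partial>\<mu> 1)"
      by (simp only: nn_integral_palm_moment[OF A])
    also have "\<dots> = (\<integral>\<^sup>+z. ennreal (p 1 z) * (\<integral>\<^sup>+N. ?w (z 0, N) \<partial>P (z 0)) \<partial>ref_PiM 1)"
      unfolding \<mu>_eq_density[OF order_refl] by (intro nn_integral_density p1 W)
    also have "\<dots> = (\<integral>\<^sup>+z. (\<Prod>j<1. indicator (UNIV \<times> {L1}) (z j)) *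
        (ennreal (p 1 z) * (\<integral>\<^sup>+N. ?w (z 0, N) \<partial>P (z 0))) \<partial>ref_PiM 1)"
      by (intro nn_integral_cong) (auto simp: indicator_def)
    also have "\<dots> = (\<integral>\<^sup>+x. ennreal (p 1 (labelled 1 (\<lambda>_. L1) x)) *
        (\<integral>\<^sup>+N. ?w (labelled 1 (\<lambda>_. L1) x 0, N) \<partial>P (labelled 1 (\<lambda>_. L1) x 0)) \<partial>lborel_PiM 1)"
      by (intro nn_integral_labelled[symmetric] borel_measurable_times_ennreal p1 W)
    also have "\<dots> = (\<integral>\<^sup>+x. ?f (x 0) * indicator A (x 0) \<partial>lborel_PiM 1)"
    proof (rule nn_integral_cong)
      fix x :: "nat \<Rightarrow> 'a"
      have "labelled 1 (\<lambda>_. L1) x = (\<lambda>_\<in>{..<1}. (x 0, L1))"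
        by (auto simp: labelled_def)
      then have "p 1 (labelled 1 (\<lambda>_. L1) x) = cov L1 (x 0)"
        by (simp add: coverage1_def)
      moreover have "labelled 1 (\<lambda>_. L1) x 0 = (x 0, L1)"
        by (simp add: labelled_def)
      ultimately show "ennreal (p 1 (labelled 1 (\<lambda>_. L1) x)) *
          (\<integral>\<^sup>+N. ?w (labelled 1 (\<lambda>_. L1) x 0, N) \<partial>P (labelled 1 (\<lambda>_. L1) x 0)) = ?f (x 0) * indicator A (x 0)"
        by (auto simp: indicator_def)
    qed
    also have "\<dots> = (\<integral>\<^sup>+a. ?f a * indicator A a \<partial>lborel)"
    proof -
      interpret L: product_sigma_finite "\<lambda>_::nat. lborel :: 'a measure"
        by (rule product_sigma_finite_lborel)
      have "{..<1::nat} = {0}" by auto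
      moreover have "(\<lambda>a. ?f a * indicator A a) \<in> borel_measurable lborel"
        by (rule borel_measurable_times_ennreal[OF f borel_measurable_indicator]) (use A in simp)
      ultimately show ?thesis
        using L.product_nn_integral_singleton[of "\<lambda>a. ?f a * indicator A a" 0] by simp
    qed
    finally show ?thesis ..
  qed
  have "density lborel ?f = density lborel ?g"
  proof (rule measure_eqI)
    fix A assume "A \<in> sets (density lborel ?f)"
    then show "emeasure (density lborel ?f) A = emeasure (density lborel ?g) A"
      using key[of A] f measurable_palm_moment by (simp add: emeasure_density)
  qed simp
  then have "AE a in lborel. ?f a = ?g a"
    by (rule sigma_finite_measure.density_unique[OF sigma_finite_lborel f measurable_palm_moment])
  then show ?thesis
  proof eventually_elim
    fix a assume eq: "?f a = ?g a"
    have "ennreal (cov L1 a) \<noteq> 0" "ennreal (cov L1 a) \<noteq> \<infinity>"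
      using coverage1_pos[of "(a, L1)"] by auto
    then show "(\<integral>\<^sup>+N. ball_mass t a N ^ k \<partial>P (a, L1)) = palm_moment t k a"
      using eq by (simp add: ennreal_mult_cancel_left)
  qed
qed

section \<open>Cumulant densities rooted at a point\<close>

lemma measurable_cumulant: "cumulant p k \<in> borel_measurable (ref_PiM k)"
proof (induction k rule: less_induct)
  case (less k)
  show ?case
  proof (cases "k \<le> 1")
    case True
    then have "cumulant p k = (\<lambda>_. 1)"
      by (subst cumulant.simps[abs_def]) (simp add: fun_eq_iff cumulant.simps)
    then show ?thesis by simp
  next
    case False
    then have eq: "cumulant p k = (\<lambda>z. p k z / (\<Prod>j<k. coverage1 p (z j)) -
        (\<Sum>P\<in>{P. partition_on {..<k} P \<and> P \<noteq> {{..<k}}}. \<Prod>D\<in>P. cumulant p (card D) (subtuple z D)))"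
      by (simp add: fun_eq_iff cumulant.simps[of p k])
    show ?thesis
      unfolding eq
    proof (intro borel_measurable_diff borel_measurable_divide borel_measurable_prod borel_measurable_sum)
      show "p k \<in> borel_measurable (ref_PiM k)" using False by (intro measurable_p) simp
      show "(\<lambda>z. coverage1 p (z j)) \<in> borel_measurable (ref_PiM k)" if "j \<in> {..<k}" for j
        by (rule measurable_compose[OF measurable_component_singleton[OF that] measurable_coverage1])
      fix P D assume P: "P \<in> {P. partition_on {..<k} P \<and> P \<noteq> {{..<k}}}" and D: "D \<in> P"
      have "D \<subseteq> {..<k}" using P D by (auto simp: partition_on_def)
      then show "(\<lambda>z. cumulant p (card D) (subtuple z D)) \<in> borel_measurable (ref_PiM k)"
        using P D by (intro measurable_compose[OF measurable_subtuple] less.IH partition_on_card_less[of k P D]) auto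
    qed
  qed
qed

text \<open>The cumulant density rooted at \<open>(a, i)\<close>, with absolute positions of the other points.\<close>

definition cumulant_at :: "nat \<Rightarrow> label \<Rightarrow> (nat \<Rightarrow> label) \<Rightarrow> 'a \<Rightarrow> (nat \<Rightarrow> 'a) \<Rightarrow> real" where
  "cumulant_at k i l a x = cumulant p (Suc k) (labelled (Suc k) (case_nat i l) (case_nat a x))"

lemma measurable_cumulant_at [measurable]:
  assumes [measurable]: "f \<in> borel_measurable N" "g \<in> measurable N (lborel_PiM k)"
  shows "(\<lambda>w. cumulant_at k i l (f w) (g w)) \<in> borel_measurable N"
proof -
  have "(\<lambda>w. case_nat (f w) (g w)) \<in> measurable N (lborel_PiM (Suc k))"
    by (rule measurable_case_nat_PiM) simp_all
  from measurable_compose[OF measurable_compose[OF this measurable_labelled] measurable_cumulant]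
  show ?thesis unfolding cumulant_at_def .
qed

lemma measurable_add_tuple':
  assumes f: "f \<in> borel_measurable N" and g: "g \<in> measurable N (lborel_PiM k)"
  shows "(\<lambda>w. \<lambda>j\<in>{..<k}. f w + g w j) \<in> measurable N (lborel_PiM k)"
proof (rule measurable_restrict)
  fix j assume "j \<in> {..<k}"
  then have "(\<lambda>w. g w j) \<in> borel_measurable N"
    using measurable_compose[OF g measurable_component_singleton] by simp
  then show "(\<lambda>w. f w + g w j) \<in> measurable N lborel"
    using f by simp
qed

text \<open>Well-definedness of the cumulant densities rooted at the origin. Translation invariance gives, for
  every shift \<open>b\<close>, that the values at base points \<open>a\<close> and \<open>a + b\<close> agree for almost all \<open>(a, x)\<close>. By
  Fubini some fixed base point \<open>a\<close> agrees with almost all others, and the values at this \<open>a\<close> serve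
  as the required function.\<close>

lemma cumulant_origin_exists:
  "\<exists>g. g \<in> borel_measurable (lborel_PiM k) \<and>
    (AE (a, x) in lborel \<Otimes>\<^sub>M lborel_PiM k. g x = cumulant_at k i l a (\<lambda>j\<in>{..<k}. a + x j))"
proof -
  define F where "F a x = cumulant_at k i l a (\<lambda>j\<in>{..<k}. a + x j)" for a x
  let ?B = "lborel_PiM k :: (nat \<Rightarrow> 'a) measure" and ?L = "lborel :: 'a measure"
  interpret B: sigma_finite_measure ?B by (rule sigma_finite_lborel_PiM)
  interpret LB: pair_sigma_finite ?L ?B ..
  interpret LLB: pair_sigma_finite ?L "?L \<Otimes>\<^sub>M ?B" ..
  have F[measurable]: "(\<lambda>w. F (f w) (g w)) \<in> borel_measurable N"
    if "f \<in> borel_measurable N" "g \<in> measurable N ?B" for f g and N :: "'z measure"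
    unfolding F_def by (intro measurable_cumulant_at measurable_add_tuple' that)
  have "AE w in ?L \<Otimes>\<^sub>M ?B. F (fst w + b) (snd w) = F (fst w) (snd w)" for b
  proof -
    have "AE z in lborel_PiM (Suc k). cumulant p (Suc k) (\<lambda>j\<in>{..<Suc k}. (z j + b, case_nat i l j)) =
        cumulant p (Suc k) (\<lambda>j\<in>{..<Suc k}. (z j, case_nat i l j))"
      using stationary unfolding coverage_reweighted_moment_stationary_def by auto
    from AE_lborel_PiM_Suc_shear[OF this]
    show ?thesis
    proof (rule AE_mp, intro AE_I2 impI)
      fix w :: "'a \<times> (nat \<Rightarrow> 'a)"
      have "(\<lambda>j\<in>{..<Suc k}. (case_nat (fst w) (\<lambda>j\<in>{..<k}. fst w + snd w j) j + b, case_nat i l j)) =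
          labelled (Suc k) (case_nat i l) (case_nat (fst w + b) (\<lambda>j\<in>{..<k}. fst w + b + snd w j))"
        by (auto simp: labelled_def fun_eq_iff add_ac split: nat.split)
      moreover have "(\<lambda>j\<in>{..<Suc k}. (case_nat (fst w) (\<lambda>j\<in>{..<k}. fst w + snd w j) j, case_nat i l j)) =
          labelled (Suc k) (case_nat i l) (case_nat (fst w) (\<lambda>j\<in>{..<k}. fst w + snd w j))"
        by (simp add: labelled_def)
      moreover assume "case w of (a, x) \<Rightarrow>
          cumulant p (Suc k) (\<lambda>j\<in>{..<Suc k}. (case_nat a (\<lambda>j\<in>{..<k}. a + x j) j + b, case_nat i l j)) =
          cumulant p (Suc k) (\<lambda>j\<in>{..<Suc k}. (case_nat a (\<lambda>j\<in>{..<k}. a + x j) j, case_nat i l j))"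
      ultimately show "F (fst w + b) (snd w) = F (fst w) (snd w)"
        unfolding F_def cumulant_at_def case_prod_beta by (simp only:)
    qed
  qed
  then have "AE b in ?L. AE w in ?L \<Otimes>\<^sub>M ?B. F (fst w + b) (snd w) = F (fst w) (snd w)"
    by simp
  then have "AE w in ?L \<Otimes>\<^sub>M ?B. AE b in ?L. F (fst w + b) (snd w) = F (fst w) (snd w)"
    by (subst (asm) LLB.AE_commute) measurable
  from LB.AE_pair[OF this] have "AE a in ?L. AE x in ?B. AE b in ?L. F (a + b) x = F a x"
    by simp
  moreover have "ae_filter ?L \<noteq> bot"
    by (simp add: ae_filter_eq_bot_iff)
  ultimately obtain a where "AE x in ?B. AE b in ?L. F (a + b) x = F a x"
    using eventually_happens' by blast
  \<comment> \<open>\<open>a + b\<close> ranges over almost all points as \<open>b\<close> does\<close>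
  then have "AE x in ?B. AE b in ?L. F b x = F a x"
    by eventually_elim (rule AE_lborel_translate)
  then have "AE b in ?L. AE x in ?B. F a x = F b x"
    by (subst LB.AE_commute) (measurable, auto elim!: eventually_mono)
  then have "AE w in ?L \<Otimes>\<^sub>M ?B. F a (snd w) = F (fst w) (snd w)"
  proof (intro LB.AE_pair_measure)
    show "{w \<in> space (?L \<Otimes>\<^sub>M ?B). F a (snd w) = F (fst w) (snd w)} \<in> sets (?L \<Otimes>\<^sub>M ?B)"
      by measurable
  qed simp
  moreover have "F a \<in> borel_measurable ?B"
    by measurable
  ultimately show ?thesis
    unfolding F_def case_prod_beta by blast
qed

lemma cumulant_origin:
  shows measurable_cumulant_origin: "cumulant_origin p k i l \<in> borel_measurable (lborel_PiM k)"
    and AE_cumulant_origin: "AE (a, x) in lborel \<Otimes>\<^sub>M lborel_PiM k.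
      cumulant_origin p k i l x = cumulant_at k i l a (\<lambda>j\<in>{..<k}. a + x j)"
proof -
  have eq: "(\<lambda>j\<in>{..<Suc k}. case j of 0 \<Rightarrow> (a, i) | Suc j' \<Rightarrow> (a + x j', l j')) =
      labelled (Suc k) (case_nat i l) (case_nat a (\<lambda>j\<in>{..<k}. a + x j))" for a :: 'a and x
    by (auto simp: labelled_def fun_eq_iff split: nat.split)
  have "cumulant_origin p k i l \<in> borel_measurable (lborel_PiM k) \<and>
    (AE (a, x) in lborel \<Otimes>\<^sub>M lborel_PiM k.
      cumulant_origin p k i l x = cumulant_at k i l a (\<lambda>j\<in>{..<k}. a + x j))"
    unfolding cumulant_origin_def eq cumulant_at_def[symmetric]
    by (rule someI_ex[OF cumulant_origin_exists])
  then show "cumulant_origin p k i l \<in> borel_measurable (lborel_PiM k)"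
    "AE (a, x) in lborel \<Otimes>\<^sub>M lborel_PiM k.
      cumulant_origin p k i l x = cumulant_at k i l a (\<lambda>j\<in>{..<k}. a + x j)"
    by auto
qed

text \<open>\<open>J\<^sub>1\<^sub>2\<^sup>(\<^sup>k\<^sup>)(t)\<close>, defined by a function rooted at the origin, is the integral of the cumulant density
  rooted at almost any \<open>a\<close> over the ball around that \<open>a\<close>.\<close>

lemma AE_J12k_eq:
  "AE a in lborel. J12k p k t = (\<integral>x. cumulant_at k L1 (\<lambda>_. L2) a x \<partial>ball_PiM t a k)"
proof -
  let ?g = "cumulant_origin p k L1 (\<lambda>_. L2)"
  interpret B: sigma_finite_measure "lborel_PiM k :: (nat \<Rightarrow> 'a) measure"
    by (rule sigma_finite_lborel_PiM)
  interpret LB: pair_sigma_finite "lborel :: 'a measure" "lborel_PiM k :: (nat \<Rightarrow> 'a) measure" ..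
  note [measurable] = measurable_cumulant_origin
  have J: "J12k p k t = (\<integral>x. ?g x \<partial>ball_PiM t 0 k)"
  proof -
    have d: "ball_PiM t 0 k = density (lborel_PiM k) (\<lambda>x. ennreal (\<Prod>j<k. indicator (cball 0 t) (x j)))"
      by (simp add: ball_PiM_eq_density prod_ennreal flip: ennreal_indicator)
    have "J12k p k t = (\<integral>x. (\<Prod>j<k. indicator (cball 0 t) (x j)) *\<^sub>R ?g x \<partial>lborel_PiM k)"
      unfolding J12k_def set_lebesgue_integral_def
    proof (rule Bochner_Integration.integral_cong[OF refl])
      fix x :: "nat \<Rightarrow> 'a" assume "x \<in> space (lborel_PiM k)"
      then have "indicator (\<Pi>\<^sub>E j\<in>{..<k}. cball 0 t) x = (\<Prod>j<k. indicator (cball 0 t) (x j) :: real)"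
        by (auto simp: indicator_def prod_zero_iff space_PiM PiE_iff)
      then show "indicator (\<Pi>\<^sub>E j\<in>{..<k}. cball 0 t) x *\<^sub>R ?g x = (\<Prod>j<k. indicator (cball 0 t) (x j)) *\<^sub>R ?g x"
        by simp
    qed
    also have "\<dots> = (\<integral>x. ?g x \<partial>ball_PiM t 0 k)"
      unfolding d by (rule integral_density[symmetric]) (auto simp: prod_nonneg)
    finally show ?thesis .
  qed
  have "AE a in lborel. AE x in lborel_PiM k. ?g x = cumulant_at k L1 (\<lambda>_. L2) a (\<lambda>j\<in>{..<k}. a + x j)"
    using LB.AE_pair[OF AE_cumulant_origin] by simp
  then show ?thesis
  proof eventually_elim
    fix a assume a: "AE x in lborel_PiM k. ?g x = cumulant_at k L1 (\<lambda>_. L2) a (\<lambda>j\<in>{..<k}. a + x j)"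
    have sB: "sets (ball_PiM t 0 k) = sets (lborel_PiM k)" by (rule sets_ball_PiM)
    have tr: "(\<lambda>x. \<lambda>j\<in>{..<k}. a + x j) \<in> measurable (ball_PiM t 0 k) (lborel_PiM k)"
      using measurable_add_tuple by (simp add: measurable_cong_sets[OF sB refl])
    have c: "cumulant_at k L1 (\<lambda>_. L2) a \<in> borel_measurable (lborel_PiM k)"
      by (rule measurable_cumulant_at) simp_all
    have "(\<integral>x. ?g x \<partial>ball_PiM t 0 k) = (\<integral>x. cumulant_at k L1 (\<lambda>_. L2) a (\<lambda>j\<in>{..<k}. a + x j) \<partial>ball_PiM t 0 k)"
    proof (rule integral_cong_AE)
      show "?g \<in> borel_measurable (ball_PiM t 0 k)"
        using measurable_cumulant_origin by (simp add: measurable_cong_sets[OF sB refl])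
      show "(\<lambda>x. cumulant_at k L1 (\<lambda>_. L2) a (\<lambda>j\<in>{..<k}. a + x j)) \<in> borel_measurable (ball_PiM t 0 k)"
        by (rule measurable_compose[OF tr c])
    qed (rule AE_ball_PiM[OF a])
    also have "\<dots> = (\<integral>x. cumulant_at k L1 (\<lambda>_. L2) a x \<partial>ball_PiM t a k)"
      using integral_distr[OF tr c] by (simp only: distr_translate_ball_PiM)
    finally show "J12k p k t = (\<integral>x. cumulant_at k L1 (\<lambda>_. L2) a x \<partial>ball_PiM t a k)"
      by (simp only: J)
  qed
qed

section \<open>The product formula\<close>

text \<open>The \<open>k\<close>-th moment of the ball mass under the distribution of \<open>\<Psi>\<close>, by \<open>ball_moment_eq\<close>.\<close>

definition ball_moment :: "real \<Rightarrow> nat \<Rightarrow> 'a \<Rightarrow> real" where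
  "ball_moment t k a = (\<integral>x. correlation p (labelled k (\<lambda>_. L2) x) {..<k} \<partial>ball_PiM t a k)"

lemma correlation_palm_expansion:
  "correlation p (labelled (Suc k) palm_labels (case_nat a x)) {..<Suc k} =
    (\<Sum>D\<in>Pow {..<k}. cumulant_at (card D) L1 (\<lambda>_. L2) a (subtuple x D) *
      correlation p (labelled (card ({..<k} - D)) (\<lambda>_. L2) (subtuple x ({..<k} - D))) {..<card ({..<k} - D)})"
  unfolding labelled_case_nat correlation_case_nat
proof (intro sum.cong refl)
  fix D assume "D \<in> Pow {..<k}"
  then have D: "D \<subseteq> {..<k}" by simp
  then have "card ({..<k} - D) = k - card D"
    using finite_subset by (subst card_Diff_subset) auto
  then show "cumulant p (Suc (card D)) (case_nat (a, L1) (subtuple (labelled k (\<lambda>_. L2) x) D)) *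
      correlation p (subtuple (labelled k (\<lambda>_. L2) x) ({..<k} - D)) {..<k - card D} =
    cumulant_at (card D) L1 (\<lambda>_. L2) a (subtuple x D) *
      correlation p (labelled (card ({..<k} - D)) (\<lambda>_. L2) (subtuple x ({..<k} - D))) {..<card ({..<k} - D)}"
    using D by (simp add: subtuple_labelled cumulant_at_def labelled_case_nat)
qed

lemma integrable_ball_correlation:
  "integrable (ball_PiM t a k) (\<lambda>x. correlation p (labelled k (\<lambda>_. L2) x) {..<k})"
proof (rule integrableI_nonneg)
  show "(\<lambda>x. correlation p (labelled k (\<lambda>_. L2) x) {..<k}) \<in> borel_measurable (ball_PiM t a k)"
    using measurable_correlation_labelled by (simp add: measurable_cong_sets[OF sets_ball_PiM refl])
  show "(\<integral>\<^sup>+x. ennreal (correlation p (labelled k (\<lambda>_. L2) x) {..<k}) \<partial>ball_PiM t a k) < \<infinity>"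
    using nn_integral_ball_mass_power_finite[of t a k] by (simp add: nn_integral_ball_mass_power)
qed (simp add: correlation_labelled_nonneg)

lemma ball_moment_nonneg: "0 \<le> ball_moment t k a"
  unfolding ball_moment_def by (intro Bochner_Integration.integral_nonneg correlation_labelled_nonneg)

lemma ball_moment_eq: "(\<integral>\<^sup>+\<omega>. ball_mass t a (\<Psi> \<omega>) ^ k \<partial>M) = ennreal (ball_moment t k a)"
  unfolding nn_integral_ball_mass_power ball_moment_def
  by (intro nn_integral_eq_integral integrable_ball_correlation AE_I2 correlation_labelled_nonneg)

lemma measurable_correlation_case_nat_at:
  "(\<lambda>x. correlation p (labelled (Suc k) l (case_nat a x)) {..<Suc k}) \<in> borel_measurable (lborel_PiM k)"
proof -
  have "Pair a \<in> measurable (lborel_PiM k) (lborel \<Otimes>\<^sub>M lborel_PiM k)" by simp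
  from measurable_compose[OF this measurable_correlation_case_nat] show ?thesis by simp
qed

lemma integrable_palm_correlation:
  assumes "palm_moment t k a < \<infinity>"
  shows "integrable (ball_PiM t a k) (\<lambda>x. correlation p (labelled (Suc k) palm_labels (case_nat a x)) {..<Suc k})"
proof (rule integrableI_nonneg)
  show "(\<lambda>x. correlation p (labelled (Suc k) palm_labels (case_nat a x)) {..<Suc k}) \<in> borel_measurable (ball_PiM t a k)"
    using measurable_correlation_case_nat_at by (simp only: measurable_cong_sets[OF sets_ball_PiM refl])
qed (use assms in \<open>simp_all add: palm_moment_def correlation_labelled_nonneg del: lessThan_Suc\<close>)

text \<open>In the expansion of the normalised \<open>(k+1)\<close>-point function, the block \<open>D = {..<k}\<close> contributes the
  cumulant of order \<open>k + 1\<close> itself. All other terms are integrable by induction.\<close>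

lemma integrable_cumulant_at:
  assumes fin: "\<And>k. palm_moment t k a < \<infinity>"
  shows "integrable (ball_PiM t a k) (cumulant_at k L1 (\<lambda>_. L2) a)"
proof (induction k rule: less_induct)
  case (less k)
  let ?G = "\<lambda>m x. correlation p (labelled m (\<lambda>_. L2) x) {..<m}"
  let ?T = "\<lambda>x D. cumulant_at (card D) L1 (\<lambda>_. L2) a (subtuple x D) *
      ?G (card ({..<k} - D)) (subtuple x ({..<k} - D))"
  have "integrable (ball_PiM t a k) (\<lambda>x. ?T x D)" if D: "D \<in> Pow {..<k} - {{..<k}}" for D
  proof (rule integral_PiM_subtuple_mult(1)[OF sigma_finite_ball_measure])
    have "card D < card {..<k}"
      using D by (intro psubset_card_mono) auto
    then show "integrable (ball_PiM t a (card D)) (cumulant_at (card D) L1 (\<lambda>_. L2) a)"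
      using less by simp
  qed (use D integrable_ball_correlation in auto)
  then have int: "integrable (ball_PiM t a k) (\<lambda>x. correlation p (labelled (Suc k) palm_labels (case_nat a x)) {..<Suc k} -
      (\<Sum>D\<in>Pow {..<k} - {{..<k}}. ?T x D))"
    by (intro Bochner_Integration.integrable_diff Bochner_Integration.integrable_sum integrable_palm_correlation fin)
  have eq: "correlation p (labelled (Suc k) palm_labels (case_nat a x)) {..<Suc k} -
      (\<Sum>D\<in>Pow {..<k} - {{..<k}}. ?T x D) = cumulant_at k L1 (\<lambda>_. L2) a x"
    if "x \<in> space (ball_PiM t a k)" for x
  proof -
    \<comment> \<open>the complement of the full block is empty, so its second factor is \<open>1\<close>\<close>
    have "subtuple x {..<k} = x"
      using that by (intro subtuple_lessThan) (auto simp: space_PiM PiE_def)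
    then have "?T x {..<k} = cumulant_at k L1 (\<lambda>_. L2) a x"
      by (simp add: correlation_def partition_sum_empty)
    then show ?thesis
      unfolding correlation_palm_expansion by (subst sum.remove[of _ "{..<k}"]) auto
  qed
  have "integrable (ball_PiM t a k) (\<lambda>x. correlation p (labelled (Suc k) palm_labels (case_nat a x)) {..<Suc k} -
      (\<Sum>D\<in>Pow {..<k} - {{..<k}}. ?T x D)) \<longleftrightarrow> integrable (ball_PiM t a k) (cumulant_at k L1 (\<lambda>_. L2) a)"
    by (rule Bochner_Integration.integrable_cong[OF refl eq])
  with int show ?case by blast
qed

text \<open>The Palm moments are the binomial convolution of the cumulant integrals with the ordinary moments:
  the integral of a term of the expansion depends on \<open>D\<close> through its cardinality only. On the level
  of generating functions this is the product formula of the theorem.\<close>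

lemma palm_moment_binomial:
  fixes k :: nat
  assumes fin: "\<And>k. palm_moment t k a < \<infinity>"
  defines "q \<equiv> (\<Sum>n\<le>k. real (k choose n) *
    ((\<integral>x. cumulant_at n L1 (\<lambda>_. L2) a x \<partial>ball_PiM t a n) * ball_moment t (k - n) a))"
  shows "palm_moment t k a = ennreal q" and "0 \<le> q"
proof -
  let ?c = "\<lambda>n. \<integral>x. cumulant_at n L1 (\<lambda>_. L2) a x \<partial>ball_PiM t a n"
  let ?G = "\<lambda>m x. correlation p (labelled m (\<lambda>_. L2) x) {..<m}"
  let ?T = "\<lambda>x D. cumulant_at (card D) L1 (\<lambda>_. L2) a (subtuple x D) *
      ?G (card ({..<k} - D)) (subtuple x ({..<k} - D))"
  have T: "integrable (ball_PiM t a k) (\<lambda>x. ?T x D)"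
    "(\<integral>x. ?T x D \<partial>ball_PiM t a k) = ?c (card D) * ball_moment t (k - card D) a"
    if D: "D \<in> Pow {..<k}" for D
  proof -
    have "card ({..<k} - D) = k - card D"
      using D finite_subset by (subst card_Diff_subset) auto
    moreover note integral_PiM_subtuple_mult[OF sigma_finite_ball_measure, of D k t a,
        OF _ integrable_cumulant_at[OF fin] integrable_ball_correlation]
    ultimately show "integrable (ball_PiM t a k) (\<lambda>x. ?T x D)"
      "(\<integral>x. ?T x D \<partial>ball_PiM t a k) = ?c (card D) * ball_moment t (k - card D) a"
      using D by (auto simp: ball_moment_def)
  qed
  have "palm_moment t k a = ennreal (\<integral>x. correlation p (labelled (Suc k) palm_labels (case_nat a x)) {..<Suc k} \<partial>ball_PiM t a k)"
    unfolding palm_moment_def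
    by (intro nn_integral_eq_integral integrable_palm_correlation fin AE_I2 correlation_labelled_nonneg)
  moreover have "0 \<le> (\<integral>x. correlation p (labelled (Suc k) palm_labels (case_nat a x)) {..<Suc k} \<partial>ball_PiM t a k)"
    by (intro Bochner_Integration.integral_nonneg correlation_labelled_nonneg)
  moreover have "(\<integral>x. correlation p (labelled (Suc k) palm_labels (case_nat a x)) {..<Suc k} \<partial>ball_PiM t a k) = q"
  proof -
    have "(\<integral>x. correlation p (labelled (Suc k) palm_labels (case_nat a x)) {..<Suc k} \<partial>ball_PiM t a k) =
      (\<Sum>D\<in>Pow {..<k}. ?c (card D) * ball_moment t (k - card D) a)"
    unfolding correlation_palm_expansion using T by (subst Bochner_Integration.integral_sum) auto
    also have "\<dots> = q"
      unfolding q_def using sum_Pow_card[of "{..<k}" "\<lambda>n. ?c n * ball_moment t (k - n) a"] by simp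
    finally show ?thesis .
  qed
  ultimately show "palm_moment t k a = ennreal q" "0 \<le> q"
    by auto
qed

lemma laplace_term_eq:
  assumes "k \<ge> 1"
  shows "laplace_term \<mu> (u_ball p t a) k = (- 1) ^ k / fact k * ball_moment t k a"
  unfolding laplace_term_def integral_u_ball_moment_measure[OF assms] ball_moment_eq
  by (simp add: ball_moment_nonneg)

lemma ball_moment_0: "ball_moment t 0 a = 1"
  by (simp add: ball_moment_def correlation_def partition_sum_empty PiM_empty)

lemma integral_cumulant_at_0: "(\<integral>x. cumulant_at 0 i l a x \<partial>ball_PiM t a 0) = 1"
  by (simp add: cumulant_at_def cumulant.simps PiM_empty)

lemma laplace_pos: "0 < laplace M \<Psi> (u_ball p t a)"
proof -
  interpret prob_space M by (rule prob_space_M)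
  let ?e = "\<lambda>\<omega>. exp (- enn2real (ball_mass t a (\<Psi> \<omega>)))"
  have m: "(\<lambda>\<omega>. ball_mass t a (\<Psi> \<omega>)) \<in> borel_measurable M"
    by (rule measurable_ball_mass[OF _ measurable_\<Psi>]) simp
  have int: "integrable M ?e"
    using m by (intro integrable_const_bound[of _ 1]) auto
  have "0 \<noteq> (\<integral>\<omega>. ?e \<omega> \<partial>M)"
  proof
    assume "0 = (\<integral>\<omega>. ?e \<omega> \<partial>M)"
    then have "AE \<omega> in M. ?e \<omega> = 0"
      using integral_nonneg_eq_0_iff_AE[OF int] by simp
    then have "AE \<omega> in M. False" by simp
    then show False by simp
  qed
  moreover have "0 \<le> (\<integral>\<omega>. ?e \<omega> \<partial>M)"
    by (intro Bochner_Integration.integral_nonneg) simp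
  ultimately show ?thesis
    unfolding laplace_eq by linarith
qed

lemma binomial_term_eq_Cauchy:
  "(- 1 :: real) ^ k / fact k * (\<Sum>n\<le>k. real (k choose n) * (c n * g (k - n))) =
    (\<Sum>n\<le>k. ((- 1) ^ n / fact n * c n) * ((- 1) ^ (k - n) / fact (k - n) * g (k - n)))"
  unfolding sum_distrib_left
proof (rule sum.cong[OF refl])
  fix n assume "n \<in> {..k}"
  then have n: "n \<le> k" by simp
  have "(- 1 :: real) ^ k = (- 1) ^ n * (- 1) ^ (k - n)"
    using n by (simp flip: power_add)
  then show "(- 1 :: real) ^ k / fact k * (real (k choose n) * (c n * g (k - n))) =
      (- 1) ^ n / fact n * c n * ((- 1) ^ (k - n) / fact (k - n) * g (k - n))"
    using n by (simp add: binomial_fact field_simps)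
qed

text \<open>For almost every \<open>a\<close> the Palm moments \<open>q k\<close> are the binomial convolution of the cumulant integrals
  \<open>c n\<close> and the ordinary moments. The two absolutely convergent series \<open>A\<close> and \<open>B\<close>, with sums
  \<open>J\<^sub>1\<^sub>2(t)\<close> and \<open>L(u\<^sub>t\<^sup>a)\<close>, therefore have the moment series of \<open>L\<^sup>(\<^sup>a\<^sup>,\<^sup>1\<^sup>)(u\<^sub>t\<^sup>a)\<close> as their
  Cauchy product. The same product, taken with absolute values, shows that this series converges
  absolutely, which gives the exponential moments under the Palm distribution.\<close>

lemma AE_J12_eq_laplace_ratio:
  assumes palm: "palm_distribution M \<Psi> (\<mu> 1) P"
    and sL: "\<And>a. summable (\<lambda>k. \<bar>laplace_term \<mu> (u_ball p t a) (Suc k)\<bar>)"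
    and sJ: "summable (\<lambda>k. \<bar>J12_term p t (Suc k)\<bar>)"
  shows "AE a in lborel.
    J12 p t = laplace (P (a, L1)) (\<lambda>N. N) (u_ball p t a) / laplace M \<Psi> (u_ball p t a)"
proof -
  have "AE a in lborel. \<forall>k. J12k p k t = (\<integral>x. cumulant_at k L1 (\<lambda>_. L2) a x \<partial>ball_PiM t a k)"
    using AE_J12k_eq by (simp add: AE_all_countable)
  moreover have "AE a in lborel. \<forall>k. palm_moment t k a < \<infinity>"
    using AE_palm_moment_finite by (simp add: AE_all_countable)
  moreover have "AE a in lborel. \<forall>k. (\<integral>\<^sup>+N. ball_mass t a N ^ k \<partial>P (a, L1)) = palm_moment t k a"
    using AE_palm_ball_mass_power[OF palm] by (simp add: AE_all_countable)
  ultimately show ?thesis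
  proof eventually_elim
    fix a :: 'a
    assume J: "\<forall>k. J12k p k t = (\<integral>x. cumulant_at k L1 (\<lambda>_. L2) a x \<partial>ball_PiM t a k)"
      and fin: "\<forall>k. palm_moment t k a < \<infinity>"
      and pm: "\<forall>k. (\<integral>\<^sup>+N. ball_mass t a N ^ k \<partial>P (a, L1)) = palm_moment t k a"
    define c where "c n = (\<integral>x. cumulant_at n L1 (\<lambda>_. L2) a x \<partial>ball_PiM t a n)" for n
    define A where "A n = (- 1) ^ n / fact n * c n" for n
    define B where "B n = (- 1) ^ n / fact n * ball_moment t n a" for n
    define q where "q k = (\<Sum>n\<le>k. real (k choose n) * (c n * ball_moment t (k - n) a))" for k
    have A0: "A 0 = 1" 
      using integral_cumulant_at_0[where i = L1 and l = "\<lambda>_. L2" and a = a and t = t]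
      by (simp add: A_def c_def)
    have B0: "B 0 = 1" by (simp add: B_def ball_moment_0)
    have AS: "A (Suc n) = J12_term p t (Suc n)" for n
      using J by (simp add: A_def c_def J12_term_def)
    have BS: "B (Suc n) = laplace_term \<mu> (u_ball p t a) (Suc n)" for n
      by (simp add: B_def laplace_term_eq)
    have sA: "summable (\<lambda>n. norm (A n))"
      using sJ by (subst summable_Suc_iff[symmetric]) (simp add: AS)
    have sB: "summable (\<lambda>n. norm (B n))"
      using sL[of a] by (subst summable_Suc_iff[symmetric]) (simp add: BS)
    have sumA: "(\<Sum>n. A n) = J12 p t"
      using suminf_split_head[OF summable_norm_cancel[OF sA]] by (simp add: A0 AS J12_def)
    have C: "(- 1) ^ k / fact k * q k = (\<Sum>n\<le>k. A n * B (k - n))" for k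
      unfolding q_def A_def B_def by (rule binomial_term_eq_Cauchy)
    have q: "palm_moment t k a = ennreal (q k)" and q0: "0 \<le> q k" for k
      using palm_moment_binomial[of t a k] fin by (simp_all add: q_def c_def)
    have sC: "summable (\<lambda>k. \<bar>(- 1) ^ k / fact k * q k\<bar>)"
    proof (rule summable_comparison_test)
      show "summable (\<lambda>k. \<Sum>n\<le>k. norm (A n) * norm (B (k - n)))"
        using sA sB by (intro summable_Cauchy_product) simp_all
      have "norm \<bar>(- 1) ^ k / fact k * q k\<bar> \<le> (\<Sum>n\<le>k. norm (A n) * norm (B (k - n)))" for k
        unfolding C by (simp only: real_norm_def abs_idempotent abs_mult[symmetric]) (rule sum_abs)
      then show "\<exists>N. \<forall>k\<ge>N. norm \<bar>(- 1) ^ k / fact k * q k\<bar> \<le> (\<Sum>n\<le>k. norm (A n) * norm (B (k - n)))"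
        by blast
    qed
    have "laplace M \<Psi> (u_ball p t a) = (\<Sum>k. B k)"
      unfolding laplace_eq B_def
    proof (rule integral_exp_neg_eq_moment_series[OF _ _ ball_moment_eq ball_moment_nonneg])
      show "(\<lambda>\<omega>. ball_mass t a (\<Psi> \<omega>)) \<in> borel_measurable M"
        by (rule measurable_ball_mass[OF _ measurable_\<Psi>]) simp
      show "ball_mass t a (\<Psi> \<omega>) < \<infinity>" if "\<omega> \<in> space M" for \<omega>
        by (rule ball_mass_finite[OF measurable_space[OF measurable_\<Psi> that]])
      show "summable (\<lambda>k. \<bar>(- 1) ^ k / fact k * ball_moment t k a\<bar>)"
        using sB by (simp add: B_def)
    qed
    moreover have "laplace (P (a, L1)) (\<lambda>N. N) (u_ball p t a) = (\<Sum>k. (- 1) ^ k / fact k * q k)"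
      unfolding laplace_eq
    proof (rule integral_exp_neg_eq_moment_series[OF _ _ _ q0 sC])
      have "P \<in> measurable ref_measure (prob_algebra lf_measures)"
        using palm by (simp add: palm_distribution_def)
      then have "P (a, L1) \<in> space (prob_algebra lf_measures)"
        by (rule measurable_space) simp
      then have s: "sets (P (a, L1)) = sets lf_measures"
        by (simp add: space_prob_algebra)
      show "(\<lambda>N. ball_mass t a N) \<in> borel_measurable (P (a, L1))"
        unfolding measurable_cong_sets[OF s refl]
        by (rule measurable_ball_mass) simp_all
      show "ball_mass t a N < \<infinity>" if "N \<in> space (P (a, L1))" for N
        using that by (intro ball_mass_finite) (simp add: sets_eq_imp_space_eq[OF s])
      show "(\<integral>\<^sup>+N. ball_mass t a N ^ k \<partial>P (a, L1)) = ennreal (q k)" for k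
        using pm q by simp
    qed
    moreover have "(\<Sum>k. (- 1) ^ k / fact k * q k) = (\<Sum>k. A k) * (\<Sum>k. B k)"
      unfolding C by (rule Cauchy_product[OF sA sB, symmetric])
    ultimately have "laplace (P (a, L1)) (\<lambda>N. N) (u_ball p t a) = J12 p t * laplace M \<Psi> (u_ball p t a)"
      by (simp add: sumA)
    then show "J12 p t = laplace (P (a, L1)) (\<lambda>N. N) (u_ball p t a) / laplace M \<Psi> (u_ball p t a)"
      using laplace_pos[of t a] by simp
  qed
qed

end

theorem theorem3:
  fixes M :: "'w measure"
    and \<Psi> :: "'w \<Rightarrow> ('a::euclidean_space \<times> label) measure"
    and \<mu> :: "nat \<Rightarrow> (nat \<Rightarrow> 'a \<times> label) measure"
    and p :: "nat \<Rightarrow> (nat \<Rightarrow> 'a \<times> label) \<Rightarrow> real"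
    and P :: "'a \<times> label \<Rightarrow> ('a \<times> label) measure measure"
    and t :: real
  assumes "random_measure M \<Psi>"
    and "coverage_reweighted_moment_stationary M \<Psi> \<mu> p"
    and "palm_distribution M \<Psi> (\<mu> 1) P"
    and "t \<ge> 0"
    and "\<And>a. summable (\<lambda>k. \<bar>laplace_term \<mu> (u_ball p t a) (Suc k)\<bar>)"
    and "summable (\<lambda>k. \<bar>J12_term p t (Suc k)\<bar>)"
  shows "(AE a in lborel.
            J12 p t = laplace (P (a, L1)) (\<lambda>N. N) (u_ball p t a) / laplace M \<Psi> (u_ball p t a)) \<and>
         (\<exists>c. AE a in lborel.
            laplace (P (a, L1)) (\<lambda>N. N) (u_ball p t a) / laplace M \<Psi> (u_ball p t a) = c)"
proof -
  interpret reweighted_moment_stationary M \<Psi> \<mu> p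
    using assms(1,2) by unfold_locales
  have *: "AE a in lborel.
      J12 p t = laplace (P (a, L1)) (\<lambda>N. N) (u_ball p t a) / laplace M \<Psi> (u_ball p t a)"
    by (rule AE_J12_eq_laplace_ratio[OF assms(3,5,6)])
  moreover have "AE a in lborel.
      laplace (P (a, L1)) (\<lambda>N. N) (u_ball p t a) / laplace M \<Psi> (u_ball p t a) = J12 p t"
    using * by eventually_elim simp
  ultimately show ?thesis by blast
qed

end
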